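(* Let $D(x)$ denote the Dedekind sum of a rational number $x$, let $\mathscr{F}(Q)=\{a/b\in\mathbb{Q}:\gcd(a,b)=1,\ 0\le a\le b\le Q\}$ and $\mathscr{F}_0(Q)=\mathscr{F}(Q)\cap[0,1/2)$. Then, as $Q\to\infty$, \[ \frac{1}{\#\mathscr{F}(Q)}\sum_{x\in\mathscr{F}_0(Q)} D(x)=\frac{1}{16}\log Q+O(1). \] In particular, \[ \lim_{Q\to\infty}\frac{1}{\#\mathscr{F}(Q)}\sum_{x\in\mathscr{F}_0(Q)} D(x)=+\infty . \]
   Context: Let $((\eta))=\eta-\lfloor\eta\rfloor-1/2$ if $\eta\in\mathbb{R}\setminus\mathbb{Z}$ and $((\eta))=0$ if $\eta\in\mathbb{Z}$. For integers $a$ and $b\neq0$, the Dedekind sum is $D(a,b)=\sum_{n\le b}((n/b))((na/b))$. It satisfies $D(ka,kb)=D(a,b)$ for every nonzero integer $k$, so $D(a/b):=D(a,b)$ is well defined on $\mathbb{Q}$. The sets $\mathscr{F}(Q)$ are the Farey fractions of order $Q$. *)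

theory Defs
  imports Complex_Main "HOL-Library.Landau_Symbols"
begin

definition sawtooth :: "real \<Rightarrow> real" where
  "sawtooth \<eta> = (if \<eta> \<in> \<int> then 0 else \<eta> - of_int \<lfloor>\<eta>\<rfloor> - 1 / 2)"

text \<open>
  For \<open>b > 0\<close> this is the sum of \<open>((n/b)) ((na/b))\<close> over \<open>1 \<le> n \<le> b\<close>. For \<open>b < 0\<close> the
  modulus is \<open>\<bar>b\<bar>\<close>, both as the range of \<open>n\<close> and in the first factor; this is what makes
  the sum invariant under multiplying \<open>a\<close> and \<open>b\<close> by a negative integer, see
  \<open>dedekind_sum_mult\<close>.
\<close>

definition dedekind_sum :: "int \<Rightarrow> int \<Rightarrow> real" where
  "dedekind_sum a b =
     (\<Sum>n = 1..\<bar>b\<bar>. sawtooth (of_int n / of_int \<bar>b\<bar>) * sawtooth (of_int n * of_int a / of_int b))"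

text \<open>
  The value is taken at the representation in lowest terms with positive denominator;
  \<open>dedekind_of_int_div\<close> shows that any other representation gives the same value.
\<close>

definition dedekind :: "rat \<Rightarrow> real" where
  "dedekind x = (case quotient_of x of (a, b) \<Rightarrow> dedekind_sum a b)"

definition farey :: "nat \<Rightarrow> rat set" where
  "farey Q = {of_int a / of_int b | a b :: int. gcd a b = 1 \<and> 0 \<le> a \<and> a \<le> b \<and> b \<le> int Q}"

definition farey0 :: "nat \<Rightarrow> rat set" where
  "farey0 Q = farey Q \<inter> {0..<1/2}"

lemma finite_farey: "finite (farey Q)"
proof (rule finite_subset)
  show "farey Q \<subseteq> (\<lambda>(a, b). of_int a / of_int b) ` ({0..int Q} \<times> {0..int Q})"
    unfolding farey_def by force
qed auto

lemma sawtooth_add_of_int: "sawtooth (x + of_int m) = sawtooth x"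
proof -
  have "x + of_int m \<in> \<int> \<longleftrightarrow> x \<in> \<int>"
    by (metis Ints_add Ints_diff Ints_of_int add_diff_cancel_right')
  then show ?thesis by (simp add: sawtooth_def)
qed

lemma sum_sawtooth_shift:
  assumes "k > 0"
  shows "(\<Sum>j<k. sawtooth (x + real j / real k)) = sawtooth (real k * x)"
proof -
  define h where "h x = (\<Sum>j<k. sawtooth (x + real j / real k)) - sawtooth (real k * x)" for x
  have step: "h (x + 1 / real k) = h x" for x
  proof -
    let ?f = "\<lambda>j. sawtooth (x + real j / real k)"
    have "(\<Sum>j<k. sawtooth (x + 1 / real k + real j / real k)) = (\<Sum>j<k. ?f (Suc j))"
      by (intro sum.cong refl arg_cong[of _ _ sawtooth]) (simp add: add_divide_distrib)
    also have "\<dots> = (\<Sum>j<k. ?f j) + ?f k - ?f 0"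
      using sum.lessThan_Suc_shift[of ?f k] by simp
    also have "?f k = ?f 0"
      using sawtooth_add_of_int[of x 1] assms by simp
    finally have 1: "(\<Sum>j<k. sawtooth (x + 1 / real k + real j / real k)) = (\<Sum>j<k. ?f j)"
      by simp
    have "sawtooth (real k * (x + 1 / real k)) = sawtooth (real k * x)"
      using sawtooth_add_of_int[of "real k * x" 1] assms by (simp add: distrib_left)
    then show ?thesis using 1 by (simp add: h_def)
  qed
  have stepn: "h (x + real n / real k) = h x" for x n
  proof (induction n)
    case (Suc n)
    have "x + real (Suc n) / real k = (x + real n / real k) + 1 / real k"
      by (simp add: add_divide_distrib)
    then show ?case using step[of "x + real n / real k"] Suc by metis
  qed simp
  have stepi: "h (x + of_int m / real k) = h x" for x m
  proof (cases "m \<ge> 0")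
    case True
    then show ?thesis using stepn[of x "nat m"] by simp
  next
    case False
    then show ?thesis using stepn[of "x + of_int m / real k" "nat (-m)"] by simp
  qed
  have gauss: "(\<Sum>j<k. real j) = real k * (real k - 1) / 2"
    by (induction k) (auto simp: field_simps)
  have base: "h y = 0" if y: "0 \<le> y" "y < 1 / real k" for y
  proof -
    have frac: "sawtooth z = z - 1 / 2" if "0 < z" "z < 1" for z
    proof -
      have "z \<notin> \<int>" using that by (auto elim!: Ints_cases)
      moreover have "\<lfloor>z\<rfloor> = 0" using that by (simp add: floor_eq_iff)
      ultimately show ?thesis by (simp add: sawtooth_def)
    qed
    have lt1: "y + real j / real k < 1" if "j < k" for j
    proof -
      have "real j + 1 \<le> real k" using that by linarith
      then have "(real j + 1) / real k \<le> 1" using assms by simp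
      then show ?thesis using y by (simp add: add_divide_distrib)
    qed
    have tot: "(\<Sum>j<k. y + real j / real k - 1 / 2) = real k * y - 1 / 2"
    proof -
      have "(\<Sum>j<k. y + real j / real k - 1 / 2) =
          real k * y + (\<Sum>j<k. real j) / real k - real k / 2"
        by (simp add: sum.distrib sum_subtractf sum_divide_distrib)
      then show ?thesis unfolding gauss using assms by (simp only:) (simp add: field_simps)
    qed
    show ?thesis
    proof (cases "y = 0")
      case False
      then have "sawtooth (real k * y) = real k * y - 1 / 2"
        using y assms by (intro frac) (auto simp: field_simps)
      moreover have "(\<Sum>j<k. sawtooth (y + real j / real k)) = (\<Sum>j<k. y + real j / real k - 1 / 2)"
        using y False lt1 by (intro sum.cong refl frac) (auto intro: add_pos_nonneg)
      ultimately show ?thesis using tot by (simp add: h_def)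
    next
      case True
      have "(\<Sum>j<k. sawtooth (real j / real k)) =
            (\<Sum>j<k. (real j / real k - 1 / 2) + (if j = 0 then 1 / 2 else 0))"
        using lt1 True assms by (intro sum.cong refl) (auto simp: frac, simp add: sawtooth_def)
      also have "\<dots> = 0"
        using tot True assms by (subst sum.distrib) simp
      finally show ?thesis using True by (simp add: h_def sawtooth_def)
    qed
  qed
  define m where "m = \<lfloor>real k * x\<rfloor>"
  have "h (x - of_int m / real k) = 0"
  proof (rule base)
    have "of_int m \<le> real k * x" "real k * x < of_int m + 1"
      unfolding m_def by linarith+
    moreover have "x - of_int m / real k = (real k * x - of_int m) / real k"
      using assms by (simp add: diff_divide_distrib)
    ultimately show "0 \<le> x - of_int m / real k" "x - of_int m / real k < 1 / real k"
      using assms by (simp_all add: divide_strict_right_mono)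
  qed
  then have "h x = 0" using stepi[of "x - of_int m / real k" m] by simp
  then show ?thesis by (simp add: h_def)
qed

lemma dedekind_sum_mult_pos:
  assumes k: "k > 0" and b: "b > 0"
  shows "dedekind_sum (int k * a) (int k * b) = dedekind_sum a b"
proof -
  let ?s = "\<lambda>m. sawtooth (of_int m * of_int a / of_int b)"
  have kb: "int k * b > 0" using k b by simp
  have "dedekind_sum (int k * a) (int k * b) =
      (\<Sum>n = 1..int k * b. sawtooth (of_int n / of_int (int k * b)) * ?s n)"
    unfolding dedekind_sum_def using k b kb by (intro sum.cong) (auto simp: abs_mult)
  also have "\<dots> = (\<Sum>(m, j) \<in> {1..b} \<times> {..<k}.
      sawtooth (of_int m / of_int b / real k + real j / real k) * ?s m)"
  proof (rule sum.reindex_bij_witness[where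
        i = "\<lambda>(m, j). m + b * int j" and j = "\<lambda>n. ((n - 1) mod b + 1, nat ((n - 1) div b))"])
    fix n assume n: "n \<in> {1..int k * b}"
    have "0 \<le> (n - 1) div b" using n b by (simp add: pos_imp_zdiv_nonneg_iff)
    moreover have "(n - 1) div b < int k"
    proof (rule ccontr)
      assume "\<not> (n - 1) div b < int k"
      then have "b * int k \<le> b * ((n - 1) div b)" using b by simp
      also have "\<dots> = (n - 1) - (n - 1) mod b" by (simp add: minus_mod_eq_mult_div)
      also have "\<dots> \<le> n - 1" using pos_mod_sign[OF b, of "n - 1"] by linarith
      finally show False using n by (simp add: mult.commute)
    qed
    moreover have eq: "(n - 1) mod b + 1 + b * ((n - 1) div b) = n"
      using mult_div_mod_eq[of b "n - 1"] by linarith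
    ultimately show "(case ((n - 1) mod b + 1, nat ((n - 1) div b)) of (m, j) \<Rightarrow> m + b * int j) = n"
      and "((n - 1) mod b + 1, nat ((n - 1) div b)) \<in> {1..b} \<times> {..<k}"
      using b pos_mod_bound[of b "n - 1"] by (auto simp: nat_less_iff zless_imp_add1_zle)
    define m where "m = (n - 1) mod b + 1"
    define j where "j = nat ((n - 1) div b)"
    have n': "n = m + b * int j"
      using eq \<open>0 \<le> (n - 1) div b\<close> by (simp add: m_def j_def)
    have 1: "of_int n / of_int (int k * b) = of_int m / of_int b / real k + real j / real k"
      unfolding n' using k b by (simp add: field_simps)
    have "of_int n * of_int a / of_int b =
        of_int m * of_int a / of_int b + (of_int (int j * a) :: real)"
      unfolding n' using b by (simp add: field_simps)
    then have 2: "?s n = ?s m" using sawtooth_add_of_int by metis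
    show "(case ((n - 1) mod b + 1, nat ((n - 1) div b)) of (m, j) \<Rightarrow>
        sawtooth (of_int m / of_int b / real k + real j / real k) * ?s m)
        = sawtooth (of_int n / of_int (int k * b)) * ?s n"
      unfolding m_def[symmetric] j_def[symmetric] 1 2 by simp
  next
    fix p assume "p \<in> {1..b} \<times> {..<k}"
    then obtain m j where p: "p = (m, j)" "1 \<le> m" "m \<le> b" "j < k" by auto
    have e: "m + b * int j - 1 = (m - 1) + b * int j" by simp
    have "(m + b * int j - 1) div b = int j" "(m + b * int j - 1) mod b = m - 1"
      unfolding e using p b by (simp_all add: div_pos_pos_trivial)
    then show "(((case p of (m, j) \<Rightarrow> m + b * int j) - 1) mod b + 1,
        nat (((case p of (m, j) \<Rightarrow> m + b * int j) - 1) div b)) = p"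
      using p by auto
    have "b * (int j + 1) \<le> b * int k" using p b by (intro mult_left_mono) auto
    then have "m + b * int j \<le> b * int k" using p(3) unfolding distrib_left mult_1_right by linarith
    moreover have "0 \<le> b * int j" using b by simp
    then have "1 \<le> m + b * int j" using p(2) by linarith
    ultimately show "(case p of (m, j) \<Rightarrow> m + b * int j) \<in> {1..int k * b}"
      using p by (simp add: mult.commute)
  qed
  also have "\<dots> = (\<Sum>m = 1..b. sawtooth (of_int m / of_int b) * ?s m)"
    unfolding sum.cartesian_product[symmetric] sum_distrib_right[symmetric]
    using k by (simp add: sum_sawtooth_shift)
  also have "\<dots> = dedekind_sum a b"
    unfolding dedekind_sum_def using b by simp
  finally show ?thesis .
qed

lemma dedekind_sum_minus: "dedekind_sum (- a) (- b) = dedekind_sum a b"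
  by (simp add: dedekind_sum_def)

lemma dedekind_sum_mult:
  assumes "k \<noteq> 0" "b \<noteq> 0"
  shows "dedekind_sum (k * a) (k * b) = dedekind_sum a b"
proof -
  have pos: "dedekind_sum (k * a) (k * b) = dedekind_sum a b" if "k > 0" "b \<noteq> 0" for k a b :: int
  proof (cases "b > 0")
    case True
    then show ?thesis using dedekind_sum_mult_pos[of "nat k" b a] that by simp
  next
    case False
    then show ?thesis
      using dedekind_sum_mult_pos[of "nat k" "- b" "- a"] that by (simp add: dedekind_sum_minus)
  qed
  show ?thesis
  proof (cases "k > 0")
    case True
    then show ?thesis using pos assms by simp
  next
    case False
    then have "dedekind_sum (- k * a) (- k * b) = dedekind_sum a b"
      using pos[of "- k"] assms by simp
    then show ?thesis by (simp add: dedekind_sum_minus)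
  qed
qed

lemma dedekind_of_int_div:
  assumes "b \<noteq> 0"
  shows "dedekind (of_int a / of_int b) = dedekind_sum a b"
proof -
  obtain p q where pq: "quotient_of (of_int a / of_int b) = (p, q)" by force
  have q: "q > 0" using pq by (rule quotient_of_denom_pos)
  have "(of_int a / of_int b :: rat) = of_int p / of_int q" using pq by (rule quotient_of_div)
  then have "(of_int (a * q) :: rat) = of_int (p * b)" using assms q by (simp add: field_simps)
  then have e: "a * q = b * p" by (metis mult.commute of_int_eq_iff)
  have "dedekind_sum a b = dedekind_sum (q * a) (q * b)"
    using q assms by (simp add: dedekind_sum_mult)
  also have "\<dots> = dedekind_sum (b * p) (b * q)" by (metis e mult.commute)
  also have "\<dots> = dedekind_sum p q" using q assms by (simp add: dedekind_sum_mult)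
  finally show ?thesis by (simp add: dedekind_def pq)
qed

end

theory Submission
  imports Defs "HOL-Analysis.Analysis" "HOL-Number_Theory.Totient"
begin

text \<open>
  Summing \<open>D(a, n)\<close> over all \<open>0 < a < n/2\<close>, coprime to \<open>n\<close> or not, groups the Farey sums of all orders
  \<open>Q div d\<close> together, and a contraction argument recovers the sum of order \<open>Q\<close>; so it suffices to show that
  these half sums, added up over \<open>n \<le> M\<close>, give \<open>M\<^sup>2 log M / 32 + O(M\<^sup>2)\<close>.

  By the cotangent formula for Dedekind sums, the half sum at \<open>n\<close> is the sum over \<open>0 < k < n/2\<close> of
  \<open>cot(\<pi>k/n) C(n, k) / 2n\<close>, where \<open>C(n, k)\<close> is the sum of \<open>cot(\<pi>ka/n)\<close> over \<open>0 < a < n/2\<close>. A reciprocity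
  law expresses \<open>k C(n, k) + n C(k, n)\<close> as \<open>n log n / \<pi>\<close> for odd \<open>k\<close>, as \<open>0\<close> for even \<open>k\<close>, up to an error
  \<open>O(n (1 + log k))\<close>. The first term contributes \<open>n log n / 16\<close>, because the odd inverse squares add up to
  \<open>\<pi>\<^sup>2/8\<close>. As a function of \<open>n\<close>, \<open>C(k, n)\<close> is \<open>k\<close>-periodic with mean zero, so after summation over \<open>n \<le> M\<close>
  only an incomplete period is left. This is affordable because the sum of \<open>|C(k, n)|\<close> over a period is
  \<open>O(k\<^sup>2)\<close> without a logarithm, which follows from mean square bounds for the sums of \<open>((r\<mu>/k))\<close> over
  \<open>r \<le> R\<close>, averaged over \<open>\<mu>\<close> modulo \<open>k\<close>.
\<close>

section \<open>The cotangent formula for Dedekind sums\<close>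

lemma real_eq_mod_div: "real n = real (n mod q) + real q * real (n div q)"
  by (metis mod_mult_div_eq of_nat_add of_nat_mult)

lemma real_div_mod: "q > 0 \<Longrightarrow> real n / real q = real (n mod q) / real q + real (n div q)"
  using real_eq_mod_div[of n q] by (simp add: field_simps)

definition cotpi :: "real \<Rightarrow> real" where
  "cotpi x = cot (pi * x)"

lemma cotpi_0 [simp]: "cotpi 0 = 0"
  by (simp add: cotpi_def)

lemma cotpi_minus [simp]: "cotpi (- x) = - cotpi x"
  by (simp add: cotpi_def)

lemma cotpi_add_1 [simp]: "cotpi (x + 1) = cotpi x"
  by (simp add: cotpi_def cot_def distrib_left)

lemma cotpi_add_nat [simp]: "cotpi (x + real n) = cotpi x"
proof (induction n)
  case (Suc n)
  have "x + real (Suc n) = (x + real n) + 1" by simp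
  then show ?case using Suc cotpi_add_1 by metis
qed simp

lemma cotpi_add_int [simp]: "cotpi (x + of_int m) = cotpi x"
proof (cases "m \<ge> 0")
  case True
  then show ?thesis using cotpi_add_nat[of x "nat m"] by simp
next
  case False
  then show ?thesis using cotpi_add_nat[of "x + of_int m" "nat (-m)"] by simp
qed

lemma cotpi_1_minus: "cotpi (1 - x) = - cotpi x"
  using cotpi_add_1[of "-x"] by (simp add: add.commute)

lemma cotpi_half [simp]: "cotpi (1/2) = 0"
  by (simp add: cotpi_def cot_def)

lemma cotpi_mod: "b > 0 \<Longrightarrow> cotpi (of_int (m mod int b) / real b) = cotpi (of_int m / real b)"
proof -
  assume b: "b > 0"
  have "of_int m = of_int (m mod int b) + real b * of_int (m div int b)"
    by (metis mod_mult_div_eq of_int_add of_int_mult of_int_of_nat_eq)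
  then have "of_int m / real b = of_int (m mod int b) / real b + of_int (m div int b)"
    using b by (simp add: field_simps)
  then show ?thesis by (metis cotpi_add_int)
qed

lemma sin_add_2pi_nat: "sin (x + 2 * pi * real n) = sin x"
  using sin_int_2pin[of "int n"] cos_int_2pin[of "int n"] by (simp add: sin_add)

lemma sin_2pi_nat_minus: "sin (2 * pi * real n - x) = - sin x"
  using sin_int_2pin[of "int n"] cos_int_2pin[of "int n"] by (simp add: sin_diff)

lemma sum_cos_multiples:
  assumes b: "b > 0"
  shows "(\<Sum>k<b. cos (2 * pi * of_int m * real k / real b)) = (if int b dvd m then real b else 0)"
proof (cases "int b dvd m")
  case True
  then obtain c where c: "m = int b * c" by blast
  have "cos (2 * pi * of_int m * real k / real b) = 1" for k
  proof -
    have "2 * pi * of_int m * real k / real b = 2 * pi * of_int (c * int k)"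
      using b by (simp add: c)
    then show ?thesis by (simp only: cos_int_2pin)
  qed
  then show ?thesis using True by simp
next
  case False
  define \<theta> where "\<theta> = pi * of_int m / real b"
  have s: "sin \<theta> \<noteq> 0"
  proof
    assume "sin \<theta> = 0"
    then obtain i :: int where "\<theta> = of_int i * pi" by (auto simp: sin_zero_iff_int2)
    then have "real_of_int m = of_int (int b * i)" using b by (simp add: \<theta>_def field_simps)
    then show False using False by (metis dvd_triv_left of_int_eq_iff)
  qed
  have "2 * sin \<theta> * (\<Sum>k<n. cos (2 * pi * of_int m * real k / real b)) = sin (\<theta> * (2 * real n - 1)) + sin \<theta>" for n
  proof (induction n)
    case (Suc n)
    have "2 * pi * of_int m * real n / real b = \<theta> * (2 * real n)" by (simp add: \<theta>_def)
    moreover have "2 * sin \<theta> * cos (\<theta> * (2 * real n)) = sin (\<theta> * (2 * real n + 1)) - sin (\<theta> * (2 * real n - 1))"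
      by (simp add: distrib_left right_diff_distrib sin_add sin_diff)
    ultimately show ?case using Suc by (simp add: distrib_left add.commute)
  qed simp
  from this[of b] have "2 * sin \<theta> * (\<Sum>k<b. cos (2 * pi * of_int m * real k / real b)) = sin (\<theta> * (2 * real b - 1)) + sin \<theta>" .
  moreover have "\<theta> * (2 * real b - 1) = 2 * pi * of_int m - \<theta>"
    using b by (simp add: \<theta>_def field_simps)
  moreover have "sin (2 * pi * of_int m - \<theta>) = - sin \<theta>"
    by (simp add: sin_diff)
  ultimately show ?thesis using s False by simp
qed

lemma sawtooth_eq: "sawtooth x = x - (of_int \<lfloor>x\<rfloor> + of_int \<lceil>x\<rceil>) / 2"
proof (cases "x \<in> \<int>")
  case True
  then show ?thesis by (auto simp: sawtooth_def elim!: Ints_cases)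
next
  case False
  then have "\<lceil>x\<rceil> = \<lfloor>x\<rfloor> + 1"
    by (metis Ints_of_int ceiling_altdef)
  then show ?thesis using False by (simp add: sawtooth_def field_simps)
qed

lemma sawtooth_0 [simp]: "sawtooth 0 = 0" and sawtooth_1 [simp]: "sawtooth 1 = 0"
  by (simp_all add: sawtooth_def)

lemma sawtooth_frac: "0 < x \<Longrightarrow> x < 1 \<Longrightarrow> sawtooth x = x - 1/2"
proof -
  assume "0 < x" "x < 1"
  then have "\<lfloor>x\<rfloor> = 0" "\<lceil>x\<rceil> = 1" by linarith+
  then show ?thesis by (simp add: sawtooth_eq)
qed

lemma sawtooth_minus [simp]: "sawtooth (- x) = - sawtooth x"
  by (simp add: sawtooth_eq ceiling_minus floor_minus field_simps)

lemma abs_sawtooth_le: "\<bar>sawtooth x\<bar> \<le> 1/2"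
proof -
  have *: "\<bar>x - (f + c) / 2\<bar> \<le> 1/2" if "f \<le> x" "x \<le> c" "c \<le> f + 1" for f c :: real
    using that by (auto simp: abs_le_iff field_simps)
  have "\<lceil>x\<rceil> \<le> \<lfloor>x\<rfloor> + 1" by linarith
  then have "of_int \<lceil>x\<rceil> \<le> (of_int \<lfloor>x\<rfloor> + 1 :: real)" by linarith
  then show ?thesis unfolding sawtooth_eq by (intro *) auto
qed

lemma sawtooth_add_nat [simp]: "sawtooth (x + real n) = sawtooth x"
  using sawtooth_add_of_int[of x "int n"] by simp

lemma sawtooth_mod: "b > 0 \<Longrightarrow> sawtooth (real (m mod b) / real b) = sawtooth (real m / real b)"
  using real_div_mod[of b m] by (simp only: sawtooth_add_nat)

lemma sum_cotpi_sin_lt: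
  assumes "n < b"
  shows "(\<Sum>k=1..<b. cotpi (real k / real b) * sin (2 * pi * real n * real k / real b)) = - 2 * real b * sawtooth (real n / real b)"
  using assms
proof (induction n)
  case (Suc n)
  have b: "b > 0" using Suc.prems by simp
  have cs: "(\<Sum>k=1..<b. cos (2 * pi * real m * real k / real b)) = (if b dvd m then real b else 0) - 1" for m
  proof -
    have "{..<b} = insert 0 {1..<b}" using b by auto
    then have "(\<Sum>k<b. cos (2 * pi * of_int (int m) * real k / real b)) = 1 + (\<Sum>k=1..<b. cos (2 * pi * real m * real k / real b))"
      by simp
    then show ?thesis using sum_cos_multiples[OF b, of "int m"] by simp
  qed
  have "(\<Sum>k=1..<b. cotpi (real k / real b) * sin (2 * pi * real (Suc n) * real k / real b)) -
        (\<Sum>k=1..<b. cotpi (real k / real b) * sin (2 * pi * real n * real k / real b))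
      = (\<Sum>k=1..<b. cos (2 * pi * real (Suc n) * real k / real b) + cos (2 * pi * real n * real k / real b))"
    unfolding sum_subtractf[symmetric]
  proof (rule sum.cong)
    fix k assume k: "k \<in> {1..<b}"
    define t where "t = pi * (real k / real b)"
    define u where "u = t * (2 * real n + 1)"
    have st: "sin t \<noteq> 0"
    proof -
      have "real k / real b < 1" using k b by auto
      then have "t < pi" using mult_strict_left_mono[of "real k / real b" 1 pi] by (simp add: t_def)
      moreover have "0 < t" using k b by (auto simp: t_def)
      ultimately have "0 < t" "t < pi" by auto
      then show ?thesis using sin_gt_zero by force
    qed
    have e1: "2 * pi * real (Suc n) * real k / real b = u + t" "2 * pi * real n * real k / real b = u - t"
      by (simp_all add: u_def t_def algebra_simps add_divide_distrib)
    have "cotpi (real k / real b) * sin (u + t) - cotpi (real k / real b) * sin (u - t) = cos t / sin t * (2 * cos u * sin t)"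
      unfolding cotpi_def cot_def t_def[symmetric] by (simp add: sin_add sin_diff algebra_simps)
    also have "\<dots> = 2 * cos u * cos t" using st by simp
    also have "\<dots> = cos (u + t) + cos (u - t)" by (simp add: cos_add cos_diff)
    finally show "cotpi (real k / real b) * sin (2 * pi * real (Suc n) * real k / real b) -
       cotpi (real k / real b) * sin (2 * pi * real n * real k / real b)
       = cos (2 * pi * real (Suc n) * real k / real b) + cos (2 * pi * real n * real k / real b)"
      unfolding e1 .
  qed simp
  also have "\<dots> = (if b dvd Suc n then real b else 0) + (if b dvd n then real b else 0) - 2"
    unfolding sum.distrib cs by simp
  also have "\<dots> = (if n = 0 then real b else 0) - 2"
    using Suc.prems by (auto dest: dvd_imp_le)
  finally have d: "(\<Sum>k=1..<b. cotpi (real k / real b) * sin (2 * pi * real (Suc n) * real k / real b)) = 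
     - 2 * real b * sawtooth (real n / real b) + (if n = 0 then real b else 0) - 2"
    using Suc by simp
  have "sawtooth (real (Suc n) / real b) = real (Suc n) / real b - 1/2"
    by (rule sawtooth_frac) (use Suc.prems in auto)
  moreover have "sawtooth (real n / real b) = (if n = 0 then 0 else real n / real b - 1/2)"
    using Suc.prems by (auto intro!: sawtooth_frac)
  ultimately have e: "real b * sawtooth (real (Suc n) / real b) = real n + 1 - real b / 2"
     "real b * sawtooth (real n / real b) = (if n = 0 then 0 else real n - real b / 2)"
    using b by (simp_all add: field_simps)
  define h where "h = (if n = 0 then real b else 0)"
  have "real b * sawtooth (real n / real b) = real n - real b / 2 + h / 2"
    unfolding e h_def by simp
  then show ?case unfolding d h_def[symmetric] using e(1) by linarith
qed simp

lemma sum_cotpi_sin: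
  assumes b: "b > 0"
  shows "(\<Sum>k=1..<b. cotpi (real k / real b) * sin (2 * pi * real n * real k / real b)) = - 2 * real b * sawtooth (real n / real b)"
proof -
  have e: "sin (2 * pi * real n * real k / real b) = sin (2 * pi * real (n mod b) * real k / real b)" for k
  proof -
    have "real n = real (n mod b) + real b * real (n div b)"
      by (rule real_eq_mod_div)
    then have "2 * pi * real n * real k / real b = 2 * pi * real (n mod b) * real k / real b + 2 * pi * real (n div b * k)"
      using b by (simp add: field_simps)
    then show ?thesis by (simp only: sin_add_2pi_nat)
  qed
  show ?thesis
    unfolding e using sum_cotpi_sin_lt[of "n mod b" b] b by (simp add: sawtooth_mod)
qed

lemma sum_dvd_delta:
  fixes f :: "nat \<Rightarrow> real"
  assumes b: "b > 0"
  shows "(\<Sum>k<b. f k * (if int b dvd int k - m then c else 0)) = f (nat (m mod int b)) * c"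
proof -
  let ?j = "nat (m mod int b)"
  have "(int b dvd int k - m) = (k = ?j)" if "k < b" for k
  proof -
    have "(int b dvd int k - m) = (int k mod int b = m mod int b)"
      by (simp add: mod_eq_dvd_iff)
    also have "int k mod int b = int k" using that by simp
    also have "(int k = m mod int b) = (k = ?j)" using b by auto
    finally show ?thesis .
  qed
  then have "(\<Sum>k<b. f k * (if int b dvd int k - m then c else 0)) = (\<Sum>k<b. if k = ?j then f k * c else 0)"
    by (intro sum.cong) auto
  also have "\<dots> = f ?j * c"
    using b by (simp add: nat_less_iff)
  finally show ?thesis .
qed

lemma sum_sawtooth_sin:
  assumes b: "b > 0"
  shows "(\<Sum>n<b. sawtooth (real n / real b) * sin (2 * pi * real m * real n / real b)) = - cotpi (real m / real b) / 2"
proof -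
  let ?c = "\<lambda>k. cotpi (real k / real b)"
  have "{..<b} = insert 0 {1..<b}" using b by auto
  then have ex: "(\<Sum>k=1..<b. ?c k * g k) = (\<Sum>k<b. ?c k * g k)" for g
    by simp
  have "- 2 * real b * (\<Sum>n<b. sawtooth (real n / real b) * sin (2 * pi * real m * real n / real b))
     = (\<Sum>n<b. (\<Sum>k<b. ?c k * sin (2 * pi * real n * real k / real b)) * sin (2 * pi * real m * real n / real b))"
    unfolding ex[symmetric] sum_cotpi_sin[OF b] by (simp add: sum_distrib_left mult.assoc)
  also have "\<dots> = (\<Sum>k<b. ?c k * (\<Sum>n<b. sin (2 * pi * real n * real k / real b) * sin (2 * pi * real m * real n / real b)))"
    unfolding sum_distrib_right sum_distrib_left by (subst sum.swap) (simp add: mult.assoc)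
  also have "\<dots> = (\<Sum>k<b. ?c k * (if int b dvd int k - int m then real b / 2 else 0) - ?c k * (if int b dvd int k - - int m then real b / 2 else 0))"
  proof (rule sum.cong)
    fix k
    have "(\<Sum>n<b. sin (2 * pi * real n * real k / real b) * sin (2 * pi * real m * real n / real b))
       = (\<Sum>n<b. cos (2 * pi * of_int (int k - int m) * real n / real b) / 2 - cos (2 * pi * of_int (int k - - int m) * real n / real b) / 2)"
    proof (rule sum.cong)
      fix n
      define x y where "x = 2 * pi * real n * real k / real b" and "y = 2 * pi * real m * real n / real b"
      have "2 * pi * of_int (int k - int m) * real n / real b = x - y"
           "2 * pi * of_int (int k - - int m) * real n / real b = x + y"
        by (simp_all add: x_def y_def algebra_simps add_divide_distrib diff_divide_distrib)
      then show "sin (2 * pi * real n * real k / real b) * sin (2 * pi * real m * real n / real b)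
         = cos (2 * pi * of_int (int k - int m) * real n / real b) / 2 - cos (2 * pi * of_int (int k - - int m) * real n / real b) / 2"
        unfolding x_def[symmetric] y_def[symmetric] by (simp only: cos_add cos_diff) (simp add: field_simps)
    qed simp
    also have "\<dots> = (if int b dvd int k - int m then real b / 2 else 0) - (if int b dvd int k - - int m then real b / 2 else 0)"
      unfolding sum_subtractf sum_divide_distrib[symmetric] sum_cos_multiples[OF b] by simp
    finally show "?c k * (\<Sum>n<b. sin (2 * pi * real n * real k / real b) * sin (2 * pi * real m * real n / real b)) =
       ?c k * (if int b dvd int k - int m then real b / 2 else 0) - ?c k * (if int b dvd int k - - int m then real b / 2 else 0)"
      by (simp add: right_diff_distrib)
  qed simp
  also have "\<dots> = cotpi (of_int (int m mod int b) / real b) * (real b / 2) - cotpi (of_int ((- int m) mod int b) / real b) * (real b / 2)"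
    unfolding sum_subtractf sum_dvd_delta[OF b] using b by simp
  also have "\<dots> = cotpi (real m / real b) * real b"
    unfolding cotpi_mod[OF b] by simp
  finally have "real b * (2 * (\<Sum>n<b. sawtooth (real n / real b) * sin (2 * pi * real m * real n / real b)) + cotpi (real m / real b)) = 0"
    by (simp add: algebra_simps)
  then show ?thesis using b by simp
qed

lemma dedekind_sum_cotpi:
  assumes b: "b > 0"
  shows "dedekind_sum (int a) (int b) = (\<Sum>k=1..<b. cotpi (real k / real b) * cotpi (real (k * a) / real b)) / (4 * real b)"
proof -
  have "dedekind_sum (int a) (int b) = (\<Sum>n=1..b. sawtooth (real n / real b) * sawtooth (real (n * a) / real b))"
    unfolding dedekind_sum_def
    by (rule sum.reindex_bij_witness[where i = int and j = nat]) auto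
  also have "{1..b} = insert b {1..<b}" using b by auto
  also have "(\<Sum>n\<in>insert b {1..<b}. sawtooth (real n / real b) * sawtooth (real (n * a) / real b))
     = (\<Sum>n\<in>insert 0 {1..<b}. sawtooth (real n / real b) * sawtooth (real (n * a) / real b))"
    using b by simp
  also have "insert 0 {1..<b} = {..<b}" using b by auto
  finally have "- 2 * real b * dedekind_sum (int a) (int b) = (\<Sum>n<b. sawtooth (real n / real b) * (- 2 * real b * sawtooth (real (n * a) / real b)))"
    by (simp add: sum_distrib_left mult_ac)
  also have "\<dots> = (\<Sum>n<b. sawtooth (real n / real b) * (\<Sum>k=1..<b. cotpi (real k / real b) * sin (2 * pi * real (n * a) * real k / real b)))"
    unfolding sum_cotpi_sin[OF b] ..
  also have "\<dots> = (\<Sum>k=1..<b. cotpi (real k / real b) * (\<Sum>n<b. sawtooth (real n / real b) * sin (2 * pi * real (k * a) * real n / real b)))"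
    unfolding sum_distrib_left by (subst sum.swap) (simp add: mult_ac)
  also have "\<dots> = - (\<Sum>k=1..<b. cotpi (real k / real b) * cotpi (real (k * a) / real b)) / 2"
    unfolding sum_sawtooth_sin[OF b] by (simp add: sum_divide_distrib sum_negf)
  finally show ?thesis using b by (simp add: field_simps)
qed

text \<open>This includes the case that one of the terms is at a pole, where \<open>cot\<close> takes the value \<open>0\<close>.\<close>

lemma sum_cotpi_shift:
  assumes b: "b > 0" and q: "q > 0"
  shows "(\<Sum>i<q. cotpi (real a / real b + real i / real q)) = real q * cotpi (real (q * a) / real b)"
proof -
  define N where "N = b * q"
  have N: "N > 0" using b q by (simp add: N_def)
  have x: "real a / real b + real i / real q = real (a * q + i * b) / real N" for i
    using b q by (simp add: N_def field_simps)
  have "- (\<Sum>i<q. cotpi (real a / real b + real i / real q)) / 2 =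
     (\<Sum>i<q. (\<Sum>n<N. sawtooth (real n / real N) * sin (2 * pi * real (a * q + i * b) * real n / real N)))"
    unfolding x sum_sawtooth_sin[OF N] by (simp add: sum_divide_distrib sum_negf)
  also have "\<dots> = (\<Sum>n<N. sawtooth (real n / real N) * (\<Sum>i<q. sin (2 * pi * real (a * q + i * b) * real n / real N)))"
    unfolding sum_distrib_left by (rule sum.swap)
  also have "\<dots> = (\<Sum>n<N. if q dvd n then real q * (sawtooth (real n / real N) * sin (2 * pi * real a * real n / real b)) else 0)"
  proof (rule sum.cong)
    fix n
    let ?x = "2 * pi * real a * real n / real b"
    have e: "2 * pi * real (a * q + i * b) * real n / real N = ?x + 2 * pi * of_int (int n) * real i / real q" for i
      using b q by (simp add: N_def field_simps)
    have c: "(\<Sum>i<q. cos (2 * pi * of_int (int n) * real i / real q)) = (if q dvd n then real q else 0)"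
      using sum_cos_multiples[OF q, of "int n"] by simp
    have s: "(\<Sum>i<q. sin (2 * pi * of_int (int n) * real i / real q)) = 0"
    proof -
      have eq: "(\<Sum>i<q. sin (2 * pi * of_int (int n) * real i / real q)) = (\<Sum>i=1..<q. sin (2 * pi * of_int (int n) * real i / real q))"
        by (rule sum.mono_neutral_right) (auto simp: not_le)
      have "(\<Sum>i=1..<q. sin (2 * pi * of_int (int n) * real i / real q)) = (\<Sum>i=1..<q. - sin (2 * pi * of_int (int n) * real i / real q))"
      proof (rule sum.reindex_bij_witness[where i = "\<lambda>i. q - i" and j = "\<lambda>i. q - i"])
        fix i assume i: "i \<in> {1..<q}"
        have "2 * pi * of_int (int n) * real (q - i) / real q = 2 * pi * real n - 2 * pi * of_int (int n) * real i / real q"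
          using i q by (simp add: of_nat_diff field_simps)
        then have "sin (2 * pi * of_int (int n) * real (q - i) / real q) = - sin (2 * pi * of_int (int n) * real i / real q)"
          by (simp only: sin_2pi_nat_minus)
        then show "- sin (2 * pi * of_int (int n) * real (q - i) / real q) = sin (2 * pi * of_int (int n) * real i / real q)"
          by simp
      qed auto
      then show ?thesis using eq by (simp add: sum_negf)
    qed
    have "(\<Sum>i<q. sin (2 * pi * real (a * q + i * b) * real n / real N)) = sin ?x * (if q dvd n then real q else 0)"
      unfolding e sin_add sum.distrib sum_distrib_left[symmetric] s c by simp
    then show "sawtooth (real n / real N) * (\<Sum>i<q. sin (2 * pi * real (a * q + i * b) * real n / real N)) =
       (if q dvd n then real q * (sawtooth (real n / real N) * sin ?x) else 0)"
      by simp
  qed simp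
  also have "\<dots> = (\<Sum>n\<in>{n\<in>{..<N}. q dvd n}. real q * (sawtooth (real n / real N) * sin (2 * pi * real a * real n / real b)))"
    by (subst sum.inter_filter) auto
  also have "\<dots> = (\<Sum>n<b. real q * (sawtooth (real n / real b) * sin (2 * pi * real (q * a) * real n / real b)))"
    by (rule sum.reindex_bij_witness[where i = "\<lambda>n. q * n" and j = "\<lambda>n. n div q"])
       (use q in \<open>auto simp: N_def mult_ac\<close>)
  also have "\<dots> = - real q * cotpi (real (q * a) / real b) / 2"
    unfolding sum_distrib_left[symmetric] sum_sawtooth_sin[OF b] by simp
  finally show ?thesis by simp
qed

section \<open>Reciprocity for cotangent sums\<close>

lemma mult_cos_le_sin: "0 \<le> x \<Longrightarrow> x \<le> pi \<Longrightarrow> x * cos x \<le> sin x" for x :: real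
proof -
  assume x: "0 \<le> x" "x \<le> pi"
  have "sin 0 - 0 * cos 0 \<le> sin x - x * cos x"
  proof (rule DERIV_nonneg_imp_nondecreasing[OF x(1)])
    fix t :: real assume t: "0 \<le> t" "t \<le> x"
    have "((\<lambda>t. sin t - t * cos t) has_real_derivative t * sin t) (at t)"
      by (auto intro!: derivative_eq_intros)
    moreover have "t * sin t \<ge> 0" using t x by (intro mult_nonneg_nonneg sin_ge_zero) auto
    ultimately show "\<exists>y. ((\<lambda>t. sin t - t * cos t) has_real_derivative y) (at t) \<and> 0 \<le> y" by blast
  qed
  then show ?thesis by simp
qed

lemma half_le_sin: "0 \<le> x \<Longrightarrow> x \<le> pi / 2 \<Longrightarrow> x / 2 \<le> sin x" for x :: real
proof -
  assume x: "0 \<le> x" "x \<le> pi / 2"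
  have c: "cos (x/2) \<ge> 0" using x by (intro cos_ge_zero) auto
  have "(x/2) * cos (x/2) \<le> sin (x/2)" using x by (intro mult_cos_le_sin) auto
  then have "(x/2) * cos (x/2) * (2 * cos (x/2)) \<le> sin (x/2) * (2 * cos (x/2))"
    by (rule mult_right_mono) (use c in auto)
  also have "\<dots> = sin x" using sin_double[of "x/2"] by simp
  also have "(x/2) * cos (x/2) * (2 * cos (x/2)) = x * (1 + cos x) / 2"
    using cos_double_cos[of "x/2"] by (simp add: power2_eq_square field_simps)
  finally have "x * (1 + cos x) / 2 \<le> sin x" .
  moreover have "x * cos x \<ge> 0" using x by (intro mult_nonneg_nonneg cos_ge_zero) auto
  ultimately show ?thesis by (simp add: field_simps)
qed

lemma cotpi_pos: "0 < x \<Longrightarrow> x < 1/2 \<Longrightarrow> 0 < cotpi x"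
  unfolding cotpi_def by (rule cot_gt_zero) auto

lemma cotpi_nonneg: "0 \<le> x \<Longrightarrow> x \<le> 1/2 \<Longrightarrow> 0 \<le> cotpi x"
  using cotpi_pos[of x] cotpi_half cotpi_0 by (metis less_eq_real_def)

lemma cotpi_approx:
  assumes "0 < x" "x \<le> 1/2"
  shows "cotpi x \<le> 1 / (pi * x)" "1 / (pi * x) - cotpi x \<le> 2"
proof -
  define z where "z = pi * x"
  have z: "0 < z" "z \<le> pi / 2" using assms by (auto simp: z_def)
  have s: "sin z > 0" using z by (intro sin_gt_zero) auto
  have "z * cos z \<le> sin z" using z by (intro mult_cos_le_sin) auto
  then show "cotpi x \<le> 1 / (pi * x)"
    unfolding cotpi_def cot_def z_def[symmetric] using z s by (simp add: field_simps)
  have "1 / z - cot z = (sin z - z * cos z) / (z * sin z)"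
    using z s by (simp add: cot_def field_simps)
  also have "\<dots> \<le> (z * z\<^sup>2 / 2) / (z * (z / 2))"
  proof (rule frac_le)
    have "(sin (z/2))\<^sup>2 \<le> (z/2)\<^sup>2" using z by (intro power_mono sin_x_le_x sin_ge_zero) auto
    then have "1 - cos z \<le> z\<^sup>2 / 2"
      using cos_double_sin[of "z/2"] by (simp add: power2_eq_square field_simps)
    then have "z * (1 - cos z) \<le> z * (z\<^sup>2 / 2)" using z by (intro mult_left_mono) auto
    moreover have "sin z \<le> z" using z by (intro sin_x_le_x) auto
    ultimately show "sin z - z * cos z \<le> z * z\<^sup>2 / 2" by (simp add: algebra_simps)
    show "z * (z / 2) \<le> z * sin z" using half_le_sin[of z] z by (intro mult_left_mono) auto
  qed (use z in auto)
  also have "\<dots> = z" using z by (simp add: field_simps power2_eq_square)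
  also have "\<dots> \<le> 2" using z pi_half_less_two by linarith
  finally show "1 / (pi * x) - cotpi x \<le> 2" unfolding cotpi_def z_def .
qed

lemma inverse_sin_pi_squared_le:
  assumes "0 < y" "y < 1"
  shows "1 / (sin (pi * y))\<^sup>2 \<le> 4 / pi\<^sup>2 * (1 / y\<^sup>2 + 1 / (1 - y)\<^sup>2)"
proof -
  have *: "1 / (sin (pi * y))\<^sup>2 \<le> 4 / pi\<^sup>2 * (1 / y\<^sup>2)" if "0 < y" "y \<le> 1/2" for y
  proof -
    have "pi * y / 2 \<le> sin (pi * y)" using that half_le_sin[of "pi * y"] by simp
    moreover have "0 < pi * y / 2" using that by simp
    ultimately have "pi * y / 2 \<le> sin (pi * y)" "0 < pi * y / 2" "0 < sin (pi * y)" by linarith+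
    then have "1 / (sin (pi * y))\<^sup>2 \<le> 1 / (pi * y / 2)\<^sup>2"
      using that by (intro divide_left_mono power_mono mult_pos_pos zero_less_power) auto
    also have "\<dots> = 4 / pi\<^sup>2 * (1 / y\<^sup>2)" by (simp add: power2_eq_square)
    finally show ?thesis .
  qed
  show ?thesis
  proof (cases "y \<le> 1/2")
    case True
    have "4 / pi\<^sup>2 * (1 / y\<^sup>2) \<le> 4 / pi\<^sup>2 * (1 / y\<^sup>2 + 1 / (1 - y)\<^sup>2)"
      by (intro mult_left_mono) auto
    then show ?thesis using *[of y] True assms by linarith
  next
    case False
    have "4 / pi\<^sup>2 * (1 / (1 - y)\<^sup>2) \<le> 4 / pi\<^sup>2 * (1 / y\<^sup>2 + 1 / (1 - y)\<^sup>2)"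
      by (intro mult_left_mono) auto
    moreover have "sin (pi * (1 - y)) = sin (pi * y)" by (simp add: right_diff_distrib sin_diff)
    ultimately show ?thesis using *[of "1 - y"] False assms by simp
  qed
qed

lemma cotpi_diff_bounds:
  assumes "0 \<le> \<eta>" "2 * \<eta> \<le> x" "0 < x" "x < 1"
  shows "0 \<le> cotpi (x - \<eta>) - cotpi x"
    and "cotpi (x - \<eta>) - cotpi x \<le> 4 * \<eta> * (1 / x\<^sup>2 + 1 / (1 - x)\<^sup>2)"
proof -
  define u v where "u = sin (pi * (x - \<eta>))" and "v = sin (pi * x)"
  have y: "0 < x - \<eta>" "x - \<eta> < 1" using assms by auto
  have less: "pi * t < pi" if "t < 1" for t using that by simp
  have uv: "u > 0" "v > 0" unfolding u_def v_def using assms y less by (auto intro!: sin_gt_zero)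
  have e: "cotpi (x - \<eta>) - cotpi x = sin (pi * \<eta>) / (u * v)"
  proof -
    have "sin (pi * \<eta>) = sin (pi * x - pi * (x - \<eta>))" by (simp add: right_diff_distrib)
    also have "\<dots> = v * cos (pi * (x - \<eta>)) - cos (pi * x) * u" unfolding sin_diff u_def v_def by simp
    finally show ?thesis
      unfolding cotpi_def cot_def u_def[symmetric] v_def[symmetric] using uv by (simp add: field_simps)
  qed
  have s: "0 \<le> sin (pi * \<eta>)" using assms less[of \<eta>] by (intro sin_ge_zero) auto
  then show "0 \<le> cotpi (x - \<eta>) - cotpi x" unfolding e using uv by simp
  have amgm: "1 / (u * v) \<le> (1 / u\<^sup>2 + 1 / v\<^sup>2) / 2"
    using sum_squares_bound[of "1/u" "1/v"] by (simp add: power_divide)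
  have "1 / u\<^sup>2 \<le> 4 / pi\<^sup>2 * (1 / (x - \<eta>)\<^sup>2 + 1 / (1 - (x - \<eta>))\<^sup>2)"
    unfolding u_def by (rule inverse_sin_pi_squared_le) (use y in auto)
  also have "\<dots> \<le> 4 / pi\<^sup>2 * (4 * (1 / x\<^sup>2) + 1 / (1 - x)\<^sup>2)"
  proof (intro mult_left_mono add_mono)
    have "1 / (x - \<eta>)\<^sup>2 \<le> 1 / (x / 2)\<^sup>2"
      using assms y by (intro divide_left_mono power_mono mult_pos_pos zero_less_power) auto
    then show "1 / (x - \<eta>)\<^sup>2 \<le> 4 * (1 / x\<^sup>2)" by (simp add: power_divide)
    show "1 / (1 - (x - \<eta>))\<^sup>2 \<le> 1 / (1 - x)\<^sup>2"
      using assms y by (intro divide_left_mono power_mono mult_pos_pos zero_less_power) auto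
  qed auto
  finally have U: "1 / u\<^sup>2 \<le> 4 / pi\<^sup>2 * (4 * (1 / x\<^sup>2) + 1 / (1 - x)\<^sup>2)" .
  have V: "1 / v\<^sup>2 \<le> 4 / pi\<^sup>2 * (1 / x\<^sup>2 + 1 / (1 - x)\<^sup>2)"
    unfolding v_def by (rule inverse_sin_pi_squared_le) (use assms in auto)
  have nn: "0 \<le> 1 / x\<^sup>2" "0 \<le> 1 / (1 - x)\<^sup>2" by auto
  have "1 / u\<^sup>2 + 1 / v\<^sup>2 \<le> 4 / pi\<^sup>2 * (4 * (1 / x\<^sup>2) + 1 / (1 - x)\<^sup>2 + (1 / x\<^sup>2 + 1 / (1 - x)\<^sup>2))"
    using U V by (simp add: distrib_left)
  also have "\<dots> \<le> 4 / pi\<^sup>2 * (6 * (1 / x\<^sup>2 + 1 / (1 - x)\<^sup>2))"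
      proof (rule mult_left_mono)
    have "4 * A + B + (A + B) \<le> 6 * (A + B)" if "0 \<le> A" "0 \<le> B" for A B :: real
      using that by (simp add: algebra_simps)
    from this[OF nn] show "4 * (1 / x\<^sup>2) + 1 / (1 - x)\<^sup>2 + (1 / x\<^sup>2 + 1 / (1 - x)\<^sup>2) \<le> 6 * (1 / x\<^sup>2 + 1 / (1 - x)\<^sup>2)" .
  qed simp
  finally have "1 / u\<^sup>2 + 1 / v\<^sup>2 \<le> 4 / pi\<^sup>2 * (6 * (1 / x\<^sup>2 + 1 / (1 - x)\<^sup>2))" .
  then have "(1 / u\<^sup>2 + 1 / v\<^sup>2) / 2 \<le> 4 / pi\<^sup>2 * (6 * (1 / x\<^sup>2 + 1 / (1 - x)\<^sup>2)) / 2"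
    by (rule divide_right_mono) simp
  also have "\<dots> = 12 / pi\<^sup>2 * (1 / x\<^sup>2 + 1 / (1 - x)\<^sup>2)" by (simp add: field_simps)
  finally have W: "1 / (u * v) \<le> 12 / pi\<^sup>2 * (1 / x\<^sup>2 + 1 / (1 - x)\<^sup>2)"
    by (rule order_trans[OF amgm])
  have "cotpi (x - \<eta>) - cotpi x = sin (pi * \<eta>) * (1 / (u * v))" unfolding e by simp
  also have "\<dots> \<le> (pi * \<eta>) * (12 / pi\<^sup>2 * (1 / x\<^sup>2 + 1 / (1 - x)\<^sup>2))"
    using W s assms uv by (intro mult_mono sin_x_le_x) auto
  also have "\<dots> = 12 / pi * \<eta> * (1 / x\<^sup>2 + 1 / (1 - x)\<^sup>2)" by (simp add: power2_eq_square)
  also have "\<dots> \<le> 4 * \<eta> * (1 / x\<^sup>2 + 1 / (1 - x)\<^sup>2)"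
    using assms nn pi_gt3 by (intro mult_right_mono) (auto simp: field_simps)
  finally show "cotpi (x - \<eta>) - cotpi x \<le> 4 * \<eta> * (1 / x\<^sup>2 + 1 / (1 - x)\<^sup>2)" .
qed

definition half_range :: "nat \<Rightarrow> nat set" where
  "half_range b = {a. 0 < a \<and> 2 * a < b}"

lemma half_range_eq: "half_range b = {1..(b - 1) div 2}"
  by (auto simp: half_range_def)

lemma finite_half_range [simp]: "finite (half_range b)"
  by (simp add: half_range_eq)

lemma half_range_frac: "a \<in> half_range b \<Longrightarrow> 0 < real a / real b \<and> real a / real b < 1/2"
  by (auto simp: half_range_def field_simps)

lemma sum_residues_halves:
  fixes f :: "real \<Rightarrow> real"
  assumes per: "\<And>x. f (x + 1) = f x" and q: "q > 0"
  shows "(\<Sum>i<q. f (real i / real q)) = f 0 + (\<Sum>i\<in>half_range q. f (real i / real q) + f (- (real i / real q)))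
     + (if even q then f (1/2) else 0)"
proof -
  let ?g = "\<lambda>i. f (real i / real q)"
  let ?U = "(\<lambda>i. q - i) ` half_range q"
  let ?M = "if even q then {q div 2} else {}"
  have mem: "x \<in> ?U \<longleftrightarrow> x < q \<and> q < 2 * x" for x
  proof
    assume "x < q \<and> q < 2 * x"
    then have "x = q - (q - x)" "q - x \<in> half_range q" by (auto simp: half_range_def)
    then show "x \<in> ?U" by blast
  qed (auto simp: half_range_def)
  have "{..<q} = {0} \<union> half_range q \<union> ?U \<union> ?M"
  proof (rule set_eqI)
    fix x
    have "x < q \<longleftrightarrow> x = 0 \<or> (0 < x \<and> 2 * x < q) \<or> (x < q \<and> q < 2 * x) \<or> (even q \<and> x = q div 2)"
      using q by (auto elim!: evenE) presburger
    then show "x \<in> {..<q} \<longleftrightarrow> x \<in> {0} \<union> half_range q \<union> ?U \<union> ?M"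
      using mem[of x] by (auto simp: half_range_def)
  qed
  then have "sum ?g {..<q} = sum ?g ({0} \<union> half_range q \<union> ?U \<union> ?M)" by simp
  also have "\<dots> = sum ?g ({0} \<union> half_range q \<union> ?U) + sum ?g ?M"
    using mem q by (intro sum.union_disjoint finite_UnI finite_imageI finite_half_range) (auto simp: half_range_def)
  also have "sum ?g ({0} \<union> half_range q \<union> ?U) = sum ?g ({0} \<union> half_range q) + sum ?g ?U"
    using mem q by (intro sum.union_disjoint finite_UnI finite_imageI finite_half_range) (auto simp: half_range_def)
  also have "sum ?g ({0} \<union> half_range q) = ?g 0 + sum ?g (half_range q)"
    by (subst sum.union_disjoint) (use finite_half_range in \<open>auto simp: half_range_def\<close>)
  also have "sum ?g ?U = (\<Sum>i\<in>half_range q. f (- (real i / real q)))"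
  proof (subst sum.reindex)
    show "inj_on (\<lambda>i. q - i) (half_range q)" by (auto simp: inj_on_def half_range_def)
    have "?g (q - i) = f (- (real i / real q))" if "i \<in> half_range q" for i
    proof -
      have "real (q - i) / real q = - (real i / real q) + 1"
        using that by (simp add: half_range_def field_simps)
      then show ?thesis using per by metis
    qed
    then show "sum (?g \<circ> (\<lambda>i. q - i)) (half_range q) = (\<Sum>i\<in>half_range q. f (- (real i / real q)))"
      by simp
  qed
  also have "sum ?g ?M = (if even q then f (1/2) else 0)"
    using q by (auto elim!: evenE simp: field_simps)
  finally show ?thesis by (simp add: sum.distrib)
qed

definition cotsum :: "nat \<Rightarrow> nat \<Rightarrow> real" where
  "cotsum b q = (\<Sum>a\<in>half_range b. cotpi (real (q * a) / real b))"

definition cot_edge :: "nat \<Rightarrow> nat \<Rightarrow> real" where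
  "cot_edge b q = (\<Sum>a\<in>half_range b. cotpi (real a / real b) + (if even q then cotpi (real a / real b + 1/2) else 0))"

lemma cotsum_expand:
  assumes b: "b > 0" and q: "q > 0"
  shows "real q * cotsum b q = cot_edge b q + (\<Sum>a\<in>half_range b. \<Sum>i\<in>half_range q.
     cotpi (real a / real b + real i / real q) + cotpi (real a / real b - real i / real q))"
proof -
  have "real q * cotpi (real (q * a) / real b) = cotpi (real a / real b) + (if even q then cotpi (real a / real b + 1/2) else 0)
      + (\<Sum>i\<in>half_range q. cotpi (real a / real b + real i / real q) + cotpi (real a / real b - real i / real q))" for a
  proof -
    have "cotpi (real a / real b + (x + 1)) = cotpi (real a / real b + x)" for x
      using cotpi_add_1[of "real a / real b + x"] by (simp add: add.assoc)
    from sum_residues_halves[where f = "\<lambda>x. cotpi (real a / real b + x)", OF this q] show ?thesis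
      unfolding sum_cotpi_shift[OF b q] by simp
  qed
  then show ?thesis
    unfolding cotsum_def cot_edge_def sum_distrib_left by (simp add: sum.distrib)
qed

text \<open>The terms with a difference of fractions cancel because the cotangent is odd. The arguments that
  remain lie strictly between \<open>0\<close> and \<open>1\<close>, so that poles occur only at the ends of the range.\<close>

lemma cotsum_reciprocity:
  assumes b: "b > 0" and q: "q > 0"
  shows "real q * cotsum b q + real b * cotsum q b = 
     2 * (\<Sum>a\<in>half_range b. \<Sum>i\<in>half_range q. cotpi (real a / real b + real i / real q)) + cot_edge b q + cot_edge q b"
proof -
  have "(\<Sum>i\<in>half_range q. \<Sum>a\<in>half_range b. cotpi (real i / real q + real a / real b) + cotpi (real i / real q - real a / real b))
     = (\<Sum>a\<in>half_range b. \<Sum>i\<in>half_range q. cotpi (real a / real b + real i / real q) - cotpi (real a / real b - real i / real q))"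
    by (subst sum.swap) (intro sum.cong refl, metis add.commute cotpi_minus minus_diff_eq diff_conv_add_uminus)
  then show ?thesis
    unfolding cotsum_expand[OF b q] cotsum_expand[OF q b]
    by (simp add: sum.distrib sum_subtractf)
qed

lemma sum_inverse_le:
  assumes "n \<ge> 1"
  shows "(\<Sum>i=1..n. 1 / real i) \<le> 1 + ln (real n)"
  using assms
proof (induction n rule: dec_induct)
  case (step n)
  have "ln (real n / real (Suc n)) \<le> real n / real (Suc n) - 1"
    using step by (intro ln_le_minus_one) auto
  then have "1 / real (Suc n) \<le> ln (real (Suc n)) - ln (real n)"
    using step by (simp add: ln_div field_simps)
  then show ?case using step by simp
qed simp

lemma sum_inverse_half_range_le:
  assumes "q \<ge> 1"
  shows "(\<Sum>i\<in>half_range q. 1 / real i) \<le> 1 + ln (real q)"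
proof -
  have "(\<Sum>i\<in>half_range q. 1 / real i) \<le> (\<Sum>i=1..q. 1 / real i)"
    by (rule sum_mono2) (auto simp: half_range_def)
  then show ?thesis using sum_inverse_le[OF assms] by linarith
qed

lemma sum_inverse_squares_shift_le:
  assumes "c > (0::real)"
  shows "(\<Sum>a=1..n. 1 / (real a + c)\<^sup>2) \<le> 1 / c"
proof -
  have "(\<Sum>a=1..n. 1 / (real a + c)\<^sup>2) \<le> 1 / c - 1 / (real n + c)"
  proof (induction n)
    case (Suc n)
    let ?x = "real n + c"
    have "1 / (?x + 1)\<^sup>2 \<le> 1 / (?x * (?x + 1))"
      using assms by (intro divide_left_mono) (auto simp: power2_eq_square intro!: mult_right_mono)
    also have "\<dots> = 1 / ?x - 1 / (?x + 1)" using assms by (simp add: field_simps)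
    finally show ?case using Suc by (simp add: add_ac)
  qed simp
  moreover have "1 / (real n + c) \<ge> 0" using assms by simp
  ultimately show ?thesis by linarith
qed

lemma sum_inverse_squares_le: "(\<Sum>a=1..n. 1 / (real a)\<^sup>2) \<le> 2"
proof (cases "n = 0")
  case False
  have "(\<Sum>a=1..n. 1 / (real a)\<^sup>2) = 1 + (\<Sum>a=2..n. 1 / (real a)\<^sup>2)"
    using False by (subst sum.atLeast_Suc_atMost) (auto simp: numeral_2_eq_2)
  also have "(\<Sum>a=2..n. 1 / (real a)\<^sup>2) = (\<Sum>a=1..n - 1. 1 / (real a + 1)\<^sup>2)"
    by (rule sum.reindex_bij_witness[where i = Suc and j = "\<lambda>a. a - 1"]) auto
  also have "\<dots> \<le> 1 / 1" by (rule sum_inverse_squares_shift_le) simp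
  finally show ?thesis by simp
qed simp

lemma bij_reflect_half_range: "bij_betw (\<lambda>a. (b + 1) div 2 - a) (half_range b) (half_range b)"
  by (rule bij_betw_byWitness[where f' = "\<lambda>a. (b + 1) div 2 - a"]) (auto simp: half_range_def)

lemma reflect_half_range:
  assumes "a \<in> half_range b"
  shows "real ((b + 1) div 2 - a) / real b = 1/2 + real (b mod 2) / (2 * real b) - real a / real b"
proof -
  have "a \<le> (b + 1) div 2" using assms by (auto simp: half_range_def)
  moreover have "2 * ((b + 1) div 2) = b + b mod 2" by presburger
  then have "2 * real ((b + 1) div 2) = real b + real (b mod 2)" by (metis of_nat_add of_nat_mult of_nat_numeral)
  ultimately show ?thesis using assms by (auto simp: half_range_def field_simps)
qed

lemma cotpi_add_reflected_bound:
  assumes "0 \<le> \<eta>" "2 * \<eta> \<le> x" "0 < x" "x < 1" "y = 1 + \<eta> - x" "2 * \<eta> \<le> y"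
  shows "\<bar>cotpi x + cotpi y\<bar> \<le> 4 * \<eta> * (1 / x\<^sup>2 + 4 * (1 / y\<^sup>2))"
proof -
  have "y = 1 - (x - \<eta>)" using assms by simp
  then have "cotpi y = - cotpi (x - \<eta>)" by (simp only: cotpi_1_minus)
  then have "\<bar>cotpi x + cotpi y\<bar> \<le> 4 * \<eta> * (1 / x\<^sup>2 + 1 / (1 - x)\<^sup>2)"
    using cotpi_diff_bounds[OF assms(1-4)] by linarith
  also have "\<dots> \<le> 4 * \<eta> * (1 / x\<^sup>2 + 4 * (1 / y\<^sup>2))"
  proof (intro mult_left_mono add_left_mono)
    have "1 / (1 - x)\<^sup>2 \<le> 1 / (y / 2)\<^sup>2"
      using assms by (intro divide_left_mono power_mono mult_pos_pos zero_less_power) auto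
    then show "1 / (1 - x)\<^sup>2 \<le> 4 * (1 / y\<^sup>2)" by (simp add: power_divide)
  qed (use assms in auto)
  finally show ?thesis .
qed

lemma sum_cotpi_quadrant_bound:
  assumes q: "1 \<le> q" "q \<le> b"
  shows "\<bar>2 * (\<Sum>a\<in>half_range b. \<Sum>i\<in>half_range q. cotpi (real a / real b + real i / real q))\<bar> \<le> 20 * real b * (1 + ln (real q))"
proof -
  define \<eta> where "\<eta> = real (b mod 2) / (2 * real b) + real (q mod 2) / (2 * real q)"
  define r where "r p = ((b + 1) div 2 - fst p, (q + 1) div 2 - snd p)" for p :: "nat \<times> nat"
  define x where "x p = real (fst p) / real b + real (snd p) / real q" for p :: "nat \<times> nat"
  let ?S = "half_range b \<times> half_range q"
  have bij: "bij_betw r ?S ?S"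
  proof -
    have "bij_betw (map_prod (\<lambda>a. (b + 1) div 2 - a) (\<lambda>i. (q + 1) div 2 - i)) ?S ?S"
      by (intro bij_betw_map_prod bij_reflect_half_range)
    then show ?thesis by (simp add: map_prod_def r_def[abs_def] case_prod_unfold)
  qed
  have \<eta>0: "\<eta> \<ge> 0" by (simp add: \<eta>_def)
  have \<eta>2: "2 * \<eta> \<le> 1 / real b + 1 / real q"
  proof -
    have "real (b mod 2) \<le> 1" "real (q mod 2) \<le> 1" by (auto simp: mod2_eq_if)
    then have "real (b mod 2) / real b \<le> 1 / real b" "real (q mod 2) / real q \<le> 1 / real q"
      using q by (intro divide_right_mono; simp)+
    then show ?thesis by (simp add: \<eta>_def add_divide_distrib)
  qed
  have "1 / real b \<le> 1 / real q" using q by (intro divide_left_mono) auto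
  then have \<eta>1: "\<eta> \<le> 1 / real q" using \<eta>2 by linarith
  have x: "2 * \<eta> \<le> x p" "0 < x p" "x p < 1" "x (r p) = 1 + \<eta> - x p" if pS: "p \<in> ?S" for p
  proof -
    from pS obtain a i where p: "p = (a, i)" "a \<in> half_range b" "i \<in> half_range q" by blast
    have "1 / real b \<le> real a / real b" "1 / real q \<le> real i / real q"
      using p q by (auto simp: half_range_def intro!: divide_right_mono)
    then show "2 * \<eta> \<le> x p" using \<eta>2 p by (auto simp: x_def)
    have "0 < u + v \<and> u + v < 1" if "0 < u \<and> u < 1/2" "0 < v \<and> v < 1/2" for u v :: real
      using that by linarith
    from this[OF half_range_frac[OF p(2)] half_range_frac[OF p(3)]] show "0 < x p" "x p < 1"
      by (simp_all add: p x_def)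
    show "x (r p) = 1 + \<eta> - x p"
      using reflect_half_range[OF p(2)] reflect_half_range[OF p(3)] by (simp add: \<eta>_def x_def r_def p)
  qed
  have inv: "(\<Sum>p\<in>?S. g (x (r p))) = (\<Sum>p\<in>?S. g (x p))" for g :: "real \<Rightarrow> real"
    using sum.reindex_bij_betw[OF bij, of "\<lambda>p. g (x p)"] .
  have "2 * (\<Sum>a\<in>half_range b. \<Sum>i\<in>half_range q. cotpi (real a / real b + real i / real q)) = (\<Sum>p\<in>?S. cotpi (x p)) + (\<Sum>p\<in>?S. cotpi (x (r p)))"
    unfolding inv by (simp add: x_def sum.cartesian_product case_prod_unfold)
  also have "\<dots> = (\<Sum>p\<in>?S. cotpi (x p) + cotpi (x (r p)))" by (simp only: sum.distrib)
  also have "\<bar>\<dots>\<bar> \<le> (\<Sum>p\<in>?S. 4 * \<eta> * (1 / (x p)\<^sup>2 + 4 * (1 / (x (r p))\<^sup>2)))"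
  proof (rule order_trans[OF sum_abs], rule sum_mono)
    fix p assume p: "p \<in> ?S"
    show "\<bar>cotpi (x p) + cotpi (x (r p))\<bar> \<le> 4 * \<eta> * (1 / (x p)\<^sup>2 + 4 * (1 / (x (r p))\<^sup>2))"
      using x[OF p] x(1)[OF bij_betw_apply[OF bij p]] \<eta>0 by (intro cotpi_add_reflected_bound) auto
  qed
  also have "\<dots> = 20 * \<eta> * (\<Sum>p\<in>?S. 1 / (x p)\<^sup>2)"
    unfolding sum_distrib_left[symmetric] sum.distrib inv[of "\<lambda>x. 1 / x\<^sup>2"] by simp
  also have "(\<Sum>p\<in>?S. 1 / (x p)\<^sup>2) = (\<Sum>i\<in>half_range q. \<Sum>a\<in>half_range b. 1 / (real a / real b + real i / real q)\<^sup>2)"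
    by (subst sum.swap) (simp add: sum.cartesian_product case_prod_unfold x_def)
  also have "20 * \<eta> * \<dots> \<le> 20 * (1 / real q) * (\<Sum>i\<in>half_range q. real b * real q * (1 / real i))"
  proof (intro mult_mono sum_mono)
    fix i assume i: "i \<in> half_range q"
    define c where "c = real b * real i / real q"
    have c: "c > 0" using i q by (auto simp: c_def half_range_def)
    have "(\<Sum>a\<in>half_range b. 1 / (real a / real b + real i / real q)\<^sup>2) = (\<Sum>a\<in>half_range b. (real b)\<^sup>2 * (1 / (real a + c)\<^sup>2))"
    proof (rule sum.cong)
      fix a
      have "real a / real b + real i / real q = (real a + c) / real b" using q by (simp add: c_def field_simps)
      then show "1 / (real a / real b + real i / real q)\<^sup>2 = (real b)\<^sup>2 * (1 / (real a + c)\<^sup>2)" by (simp add: power_divide)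
    qed simp
    also have "\<dots> \<le> (real b)\<^sup>2 * (1 / c)"
      unfolding sum_distrib_left[symmetric] half_range_eq
      by (intro mult_left_mono sum_inverse_squares_shift_le c) auto
    also have "\<dots> = real b * real q * (1 / real i)" using q i by (simp add: c_def power2_eq_square half_range_def)
    finally show "(\<Sum>a\<in>half_range b. 1 / (real a / real b + real i / real q)\<^sup>2) \<le> real b * real q * (1 / real i)" .
  qed (use \<eta>0 \<eta>1 in \<open>auto intro!: sum_nonneg\<close>)
  also have "\<dots> = 20 * real b * (\<Sum>i\<in>half_range q. 1 / real i)"
    unfolding sum_distrib_left[symmetric] using q by simp
  also have "\<dots> \<le> 20 * real b * (1 + ln (real q))"
    by (intro mult_left_mono sum_inverse_half_range_le q) auto
  finally show ?thesis .
qed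


lemma sum_cotpi_half_range:
  assumes b: "b \<ge> 1"
  shows "\<bar>(\<Sum>a\<in>half_range b. cotpi (real a / real b)) - real b / pi * ln (real b)\<bar> \<le> 2 * real b"
proof -
  define n where "n = (b - 1) div 2"
  define H where "H = (\<Sum>a\<in>half_range b. 1 / real a)"
  have H: "H = (\<Sum>a=1..n. 1 / real a)" by (simp add: H_def n_def half_range_eq)
  have "H \<le> 1 + ln (real b)" unfolding H_def by (rule sum_inverse_half_range_le) fact
  moreover have "ln (real b) - 1 \<le> H"
  proof -
    have "b \<le> 2 * (n + 1)" unfolding n_def by presburger
    then have "real b \<le> real (2 * (n + 1))" by (rule of_nat_mono)
    then have "real b \<le> 2 * (real n + 1)" by simp
    then have "ln (real b) \<le> ln (2 * (real n + 1))" using b by (subst ln_le_cancel_iff) auto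
    also have "\<dots> = ln 2 + ln (real n + 1)" by (subst ln_mult) auto
    also have "ln (real n + 1) \<le> H"
      using ln_le_harm[of n] unfolding H harm_def by (simp add: inverse_eq_divide)
    finally show ?thesis using ln_2_less_1 by linarith
  qed
  ultimately have "\<bar>H - ln (real b)\<bar> \<le> 1" by linarith
  then have "\<bar>real b / pi * (H - ln (real b))\<bar> \<le> real b / pi * 1"
    unfolding abs_mult by (intro mult_mono) auto
  also have "\<dots> \<le> real b" using b pi_gt3 by (simp add: field_simps)
  finally have 1: "\<bar>real b / pi * H - real b / pi * ln (real b)\<bar> \<le> real b" by (simp add: right_diff_distrib)
  have "\<bar>(\<Sum>a\<in>half_range b. cotpi (real a / real b)) - real b / pi * H\<bar> \<le> (\<Sum>a\<in>half_range b. 2)"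
    unfolding H_def sum_distrib_left sum_subtractf[symmetric]
  proof (rule order_trans[OF sum_abs], rule sum_mono)
    fix a assume "a \<in> half_range b"
    then have "0 < real a / real b" "real a / real b \<le> 1/2" using half_range_frac[of a b] by auto
    from cotpi_approx[OF this] show "\<bar>cotpi (real a / real b) - real b / pi * (1 / real a)\<bar> \<le> 2" by simp
  qed
  also have "\<dots> \<le> real b" by (simp add: half_range_eq)
  finally have 2: "\<bar>(\<Sum>a\<in>half_range b. cotpi (real a / real b)) - real b / pi * H\<bar> \<le> real b" .
  have "\<bar>A - C\<bar> \<le> 2 * x" if "\<bar>A - B\<bar> \<le> x" "\<bar>B - C\<bar> \<le> x" for A B C x :: real
    using that by linarith
  from this[OF 2 1] show ?thesis .
qed

lemma sum_cotpi_double_half_range: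
  assumes b: "b \<ge> 1"
  shows "\<bar>\<Sum>a\<in>half_range b. cotpi (real a / real b) + cotpi (real a / real b + 1/2)\<bar> \<le> 10 * real b"
proof -
  define \<eta> where "\<eta> = real (b mod 2) / real b"
  define r where "r a = (b + 1) div 2 - a" for a
  define y where "y a = 2 * real a / real b" for a
  let ?S = "half_range b"
  have bij: "bij_betw r ?S ?S" using bij_reflect_half_range[of b] by (simp add: r_def[abs_def])
  have \<eta>0: "\<eta> \<ge> 0" by (simp add: \<eta>_def)
  have "real (b mod 2) \<le> 1" by (auto simp: mod2_eq_if)
  then have \<eta>1: "\<eta> \<le> 1 / real b" unfolding \<eta>_def by (intro divide_right_mono) auto
  have y: "2 * \<eta> \<le> y a" "0 < y a" "y a < 1" "y (r a) = 1 + \<eta> - y a" if "a \<in> ?S" for a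
  proof -
    have "2 * (1 / real b) \<le> y a"
      using that b by (auto simp: half_range_def y_def intro!: divide_right_mono)
    then show "2 * \<eta> \<le> y a" using \<eta>1 by linarith
    show "0 < y a" "y a < 1" using that by (auto simp: half_range_def y_def)
    show "y (r a) = 1 + \<eta> - y a"
      using reflect_half_range[OF that] by (simp add: \<eta>_def y_def r_def field_simps)
  qed
  have inv: "(\<Sum>a\<in>?S. g (y (r a))) = (\<Sum>a\<in>?S. g (y a))" for g :: "real \<Rightarrow> real"
    using sum.reindex_bij_betw[OF bij, of "\<lambda>a. g (y a)"] .
  have "cotpi (real a / real b) + cotpi (real a / real b + 1/2) = 2 * cotpi (y a)" for a
    using sum_cotpi_shift[of b 2 a] b by (simp add: numeral_2_eq_2 y_def)
  then have "(\<Sum>a\<in>?S. cotpi (real a / real b) + cotpi (real a / real b + 1/2)) = (\<Sum>a\<in>?S. cotpi (y a)) + (\<Sum>a\<in>?S. cotpi (y (r a)))"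
    unfolding inv by (simp add: sum_distrib_left[symmetric])
  also have "\<dots> = (\<Sum>a\<in>?S. cotpi (y a) + cotpi (y (r a)))" by (simp only: sum.distrib)
  also have "\<bar>\<dots>\<bar> \<le> (\<Sum>a\<in>?S. 4 * \<eta> * (1 / (y a)\<^sup>2 + 4 * (1 / (y (r a))\<^sup>2)))"
  proof (rule order_trans[OF sum_abs], rule sum_mono)
    fix a assume a: "a \<in> ?S"
    show "\<bar>cotpi (y a) + cotpi (y (r a))\<bar> \<le> 4 * \<eta> * (1 / (y a)\<^sup>2 + 4 * (1 / (y (r a))\<^sup>2))"
      using y[OF a] y(1)[OF bij_betw_apply[OF bij a]] \<eta>0 by (intro cotpi_add_reflected_bound) auto
  qed
  also have "\<dots> = 20 * \<eta> * (\<Sum>a\<in>?S. 1 / (y a)\<^sup>2)"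
    unfolding sum_distrib_left[symmetric] sum.distrib inv[of "\<lambda>x. 1 / x\<^sup>2"] by simp
  also have "\<dots> \<le> 20 * (1 / real b) * ((real b)\<^sup>2 / 4 * 2)"
  proof (intro mult_mono)
    have "(\<Sum>a\<in>?S. 1 / (y a)\<^sup>2) = (real b)\<^sup>2 / 4 * (\<Sum>a\<in>?S. 1 / (real a)\<^sup>2)"
      unfolding sum_distrib_left by (intro sum.cong) (auto simp: y_def power_divide power_mult_distrib)
    also have "(\<Sum>a\<in>?S. 1 / (real a)\<^sup>2) \<le> 2"
    proof -
      have "(\<Sum>a\<in>?S. 1 / (real a)\<^sup>2) \<le> (\<Sum>a=1..b. 1 / (real a)\<^sup>2)"
        by (rule sum_mono2) (auto simp: half_range_def)
      also have "\<dots> \<le> 2" by (rule sum_inverse_squares_le)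
      finally show ?thesis by simp
    qed
    finally show "(\<Sum>a\<in>?S. 1 / (y a)\<^sup>2) \<le> (real b)\<^sup>2 / 4 * 2" by (simp add: mult_left_mono)
  qed (use \<eta>0 \<eta>1 in \<open>auto intro!: sum_nonneg\<close>)
  also have "\<dots> = 10 * real b" using b by (simp add: power2_eq_square)
  finally show ?thesis .
qed

lemma cot_edge_bound:
  assumes b: "b \<ge> 1"
  shows "\<bar>cot_edge b q - (if odd q then real b / pi * ln (real b) else 0)\<bar> \<le> 10 * real b"
proof (cases "odd q")
  case True
  have "2 * real b \<le> 10 * real b" by simp
  then show ?thesis unfolding cot_edge_def
    using True order_trans[OF sum_cotpi_half_range[OF b] \<open>2 * real b \<le> 10 * real b\<close>]
    by (simp only: if_True if_False add_0_right not_False_eq_True simp_thms)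
next
  case False
  with sum_cotpi_double_half_range[OF b] show ?thesis unfolding cot_edge_def
    by (simp only: if_True if_False diff_zero not_True_eq_False not_not)
qed

lemma cotsum_approx_reciprocity:
  assumes q: "1 \<le> q" "q \<le> b"
  shows "\<bar>real q * cotsum b q + real b * cotsum q b - (if odd q then real b / pi * ln (real b) else 0)\<bar> \<le> 41 * real b * (1 + ln (real q))"
proof -
  have lq: "ln (real q) \<ge> 0" using q by simp
  have 1: "\<bar>cot_edge q b\<bar> \<le> 11 * real b * (1 + ln (real q))"
  proof -
    have "\<bar>cot_edge q b\<bar> \<le> 10 * real q + real q / pi * ln (real q)"
    proof -
      have "real q / pi * ln (real q) \<ge> 0" using lq by simp
      moreover have "\<bar>A\<bar> \<le> x + B" if "\<bar>A - (if odd b then B else 0)\<bar> \<le> x" "0 \<le> B" for A B x :: real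
        using that by (auto split: if_splits)
      ultimately show ?thesis using cot_edge_bound[OF q(1), of b] by blast
    qed
    also have "real q / pi * ln (real q) \<le> real q * ln (real q)"
      using lq q pi_gt3 by (intro mult_right_mono) (auto simp: field_simps)
    also have "10 * real q + real q * ln (real q) \<le> 11 * real q * (1 + ln (real q))"
      using lq q by (simp add: algebra_simps)
    also have "\<dots> \<le> 11 * real b * (1 + ln (real q))"
      using lq q by (intro mult_right_mono) auto
    finally show ?thesis by simp
  qed
  have 2: "10 * real b \<le> 10 * real b * (1 + ln (real q))"
    using lq by (simp add: algebra_simps)
  have *: "\<bar>L - h\<bar> \<le> 41 * X" if "L = A + B + C" "\<bar>A\<bar> \<le> 20 * X" "\<bar>B - h\<bar> \<le> Y" "Y \<le> 10 * X" "\<bar>C\<bar> \<le> 11 * X"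
    for L A B C X Y h :: real
    using that by linarith
  have "\<bar>real q * cotsum b q + real b * cotsum q b - (if odd q then real b / pi * ln (real b) else 0)\<bar> \<le> 41 * (real b * (1 + ln (real q)))"
  proof (rule *[OF cotsum_reciprocity])
    show "\<bar>2 * (\<Sum>a\<in>half_range b. \<Sum>i\<in>half_range q. cotpi (real a / real b + real i / real q))\<bar> \<le> 20 * (real b * (1 + ln (real q)))"
      using sum_cotpi_quadrant_bound[OF q] by (simp only: mult.assoc)
    show "\<bar>cot_edge b q - (if odd q then real b / pi * ln (real b) else 0)\<bar> \<le> 10 * real b"
      using q by (intro cot_edge_bound) simp
    show "10 * real b \<le> 10 * (real b * (1 + ln (real q)))" using 2 by (simp only: mult.assoc)
    show "\<bar>cot_edge q b\<bar> \<le> 11 * (real b * (1 + ln (real q)))" using 1 by (simp only: mult.assoc)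
  qed (use q in auto)
  then show ?thesis by (simp only: mult.assoc)
qed

section \<open>Mean values of sawtooth sums\<close>

lemma sum_permute_residues:
  fixes f :: "nat \<Rightarrow> real"
  assumes k: "k > 0" and c: "coprime m k"
  shows "(\<Sum>t<k. f (m * t mod k)) = (\<Sum>t<k. f t)"
proof -
  have inj: "inj_on (\<lambda>t. m * t mod k) {..<k}"
  proof (rule inj_onI)
    fix x y assume xy: "x \<in> {..<k}" "y \<in> {..<k}" "m * x mod k = m * y mod k"
    then have "[m * x = m * y] (mod k)" by (simp add: cong_def)
    then have "[x = y] (mod k)" using c by (metis cong_mult_lcancel_nat)
    then show "x = y" using xy by (simp add: cong_def)
  qed
  moreover have "(\<lambda>t. m * t mod k) ` {..<k} \<subseteq> {..<k}" using k by auto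
  ultimately have "bij_betw (\<lambda>t. m * t mod k) {..<k} {..<k}"
    by (simp add: bij_betw_def endo_inj_surj)
  then show ?thesis by (rule sum.reindex_bij_betw)
qed

lemma abs_sum_sawtooth_progression_le:
  assumes r: "r > 0"
  shows "\<bar>\<Sum>i<r. sawtooth (y + real r' * real i / real r)\<bar> \<le> real (gcd r r') / 2"
proof -
  define g where "g = gcd r r'"
  define k m where "k = r div g" and "m = r' div g"
  have km: "r = g * k" "r' = g * m" "coprime m k"
    using r by (auto simp: g_def k_def m_def div_gcd_coprime coprime_commute)
  have g: "g > 0" and k: "k > 0" using km r by auto
  have e: "real r' * real i / real r = real m * real i / real k" for i
    using g k by (simp add: km)
  have per: "sawtooth (y + real m * real (j * k + t) / real k) = sawtooth (y + real m * real t / real k)" for j t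
  proof -
    have "y + real m * real (j * k + t) / real k = (y + real m * real t / real k) + real (m * j)"
      using k by (simp add: field_simps)
    then show ?thesis by (simp only: sawtooth_add_nat)
  qed
  have "(\<Sum>i<r. sawtooth (y + real r' * real i / real r)) = (\<Sum>j<g. \<Sum>i\<in>{j * k..<j * k + k}. sawtooth (y + real m * real i / real k))"
    unfolding sum.nat_group e by (simp only: km(1))
  also have "\<dots> = (\<Sum>j<g. \<Sum>t<k. sawtooth (y + real m * real t / real k))"
  proof (rule sum.cong)
    fix j
    have "(\<Sum>i\<in>{j * k..<j * k + k}. sawtooth (y + real m * real i / real k)) = (\<Sum>t<k. sawtooth (y + real m * real (j * k + t) / real k))"
      by (rule sum.reindex_bij_witness[where i = "\<lambda>t. j * k + t" and j = "\<lambda>i. i - j * k"]) auto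
    then show "(\<Sum>i\<in>{j * k..<j * k + k}. sawtooth (y + real m * real i / real k)) = (\<Sum>t<k. sawtooth (y + real m * real t / real k))"
      by (simp only: per)
  qed simp
  also have "(\<Sum>t<k. sawtooth (y + real m * real t / real k)) = (\<Sum>t<k. sawtooth (y + real (m * t mod k) / real k))"
  proof (rule sum.cong)
    fix t
    have "real (m * t) = real (m * t mod k) + real k * real (m * t div k)"
      by (rule real_eq_mod_div)
    then have "y + real m * real t / real k = (y + real (m * t mod k) / real k) + real (m * t div k)"
      using k by (simp add: field_simps)
    then show "sawtooth (y + real m * real t / real k) = sawtooth (y + real (m * t mod k) / real k)"
      by (simp only: sawtooth_add_nat)
  qed simp
  also have "\<dots> = sawtooth (real k * y)"
    unfolding sum_permute_residues[OF k km(3), of "\<lambda>t. sawtooth (y + real t / real k)"]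
    by (rule sum_sawtooth_shift[OF k])
  finally have "\<bar>\<Sum>i<r. sawtooth (y + real r' * real i / real r)\<bar> = real g * \<bar>sawtooth (real k * y)\<bar>"
    by (simp add: abs_mult)
  also have "\<dots> \<le> real g * (1/2)" by (intro mult_left_mono abs_sawtooth_le) simp
  finally show ?thesis by (simp add: g_def)
qed

definition roundings :: "real \<Rightarrow> real" where
  "roundings x = (of_int \<lfloor>x\<rfloor> + of_int \<lceil>x\<rceil>) / 2"

lemma roundings_mono: "x \<le> y \<Longrightarrow> roundings x \<le> roundings y"
  unfolding roundings_def by (intro divide_right_mono add_mono) (auto intro: floor_mono ceiling_mono)

lemma abs_sawtooth_diff_le:
  assumes "x \<le> y" "y \<le> z"
  shows "\<bar>sawtooth y - sawtooth x\<bar> \<le> (z + roundings z) - (x + roundings x)"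
  using roundings_mono[OF assms(1)] roundings_mono[OF assms(2)] assms
  unfolding sawtooth_eq roundings_def[symmetric] by linarith

text \<open>The average over multiples of \<open>1/q\<close> is compared with the average over multiples of
  \<open>1/(qr)\<close>, where shifting the argument by \<open>1/r\<close> fixes the first factor.\<close>

lemma sawtooth_correlation_le:
  assumes q: "q > 0" and r: "r > 0"
  shows "\<bar>\<Sum>\<mu><q. sawtooth (real r * real \<mu> / real q) * sawtooth (real r' * real \<mu> / real q)\<bar>
     \<le> real q * real (gcd r r') / (4 * real r) + (real r + real r')"
proof -
  define F where "F x = sawtooth (real r * x) * sawtooth (real r' * x)" for x
  define v where "v n \<mu> = (real n * (real (Suc \<mu>) / real q) + roundings (real n * (real (Suc \<mu>) / real q)))
     - (real n * (real \<mu> / real q) + roundings (real n * (real \<mu> / real q)))" for n \<mu>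
  define total where "total = (\<Sum>\<nu><q * r. F (real \<nu> / real (q * r)))"
  have v: "(\<Sum>\<mu><q. v n \<mu>) = 2 * real n" for n
  proof -
    have "(\<Sum>\<mu><q. v n \<mu>) = real n * (real q / real q) + roundings (real n * (real q / real q))
       - (real n * (real 0 / real q) + roundings (real n * (real 0 / real q)))"
      unfolding v_def by (rule sum_lessThan_telescope)
    then show ?thesis using q by (simp add: roundings_def)
  qed
  have st: "\<bar>sawtooth (real n * (real \<nu> / real (q * r))) - sawtooth (real n * (real \<mu> / real q))\<bar> \<le> v n \<mu>"
    if "\<mu> * r \<le> \<nu>" "\<nu> \<le> \<mu> * r + r" for n \<mu> \<nu>
  proof -
    have "real (\<mu> * r) \<le> real \<nu>" "real \<nu> \<le> real (\<mu> * r + r)" using that by (auto simp only: of_nat_le_iff)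
    then have "real \<mu> / real q \<le> real \<nu> / real (q * r)" "real \<nu> / real (q * r) \<le> real (Suc \<mu>) / real q"
      using q r by (auto simp: field_simps)
    then have "real n * (real \<mu> / real q) \<le> real n * (real \<nu> / real (q * r))" 
      "real n * (real \<nu> / real (q * r)) \<le> real n * (real (Suc \<mu>) / real q)"
      by (intro mult_left_mono; simp)+
    from abs_sawtooth_diff_le[OF this] show ?thesis unfolding v_def .
  qed
  have dF: "\<bar>F (real \<nu> / real (q * r)) - F (real \<mu> / real q)\<bar> \<le> (v r \<mu> + v r' \<mu>) / 2"
    if "\<mu> * r \<le> \<nu>" "\<nu> \<le> \<mu> * r + r" for \<mu> \<nu>
  proof -
    define a a' c c' where "a = sawtooth (real r * (real \<nu> / real (q * r)))" and "a' = sawtooth (real r * (real \<mu> / real q))"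
      and "c = sawtooth (real r' * (real \<nu> / real (q * r)))" and "c' = sawtooth (real r' * (real \<mu> / real q))"
    have b: "\<bar>c\<bar> \<le> 1/2" "\<bar>a'\<bar> \<le> 1/2" "\<bar>a - a'\<bar> \<le> v r \<mu>" "\<bar>c - c'\<bar> \<le> v r' \<mu>"
      using st[OF that, of r] st[OF that, of r'] abs_sawtooth_le by (auto simp only: a_def a'_def c_def c'_def)
    have "F (real \<nu> / real (q * r)) - F (real \<mu> / real q) = (a - a') * c + a' * (c - c')"
      unfolding F_def a_def[symmetric] a'_def[symmetric] c_def[symmetric] c'_def[symmetric] by (simp add: algebra_simps)
    also have "\<bar>\<dots>\<bar> \<le> \<bar>a - a'\<bar> * \<bar>c\<bar> + \<bar>a'\<bar> * \<bar>c - c'\<bar>"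
      unfolding abs_mult[symmetric] by (rule abs_triangle_ineq)
    also have "\<dots> \<le> v r \<mu> * (1/2) + (1/2) * v r' \<mu>"
      using b by (intro add_mono mult_mono) auto
    finally show ?thesis by simp
  qed
  have 1: "\<bar>total - real r * (\<Sum>\<mu><q. F (real \<mu> / real q))\<bar> \<le> real r * (real r + real r')"
  proof -
    have "total - real r * (\<Sum>\<mu><q. F (real \<mu> / real q)) = (\<Sum>\<mu><q. (\<Sum>\<nu>\<in>{\<mu> * r..<\<mu> * r + r}. F (real \<nu> / real (q * r)) - F (real \<mu> / real q)))"
    proof -
      have "total = (\<Sum>\<mu><q. \<Sum>\<nu>\<in>{\<mu> * r..<\<mu> * r + r}. F (real \<nu> / real (q * r)))"
        unfolding total_def sum.nat_group ..
      moreover have "real r * (\<Sum>\<mu><q. F (real \<mu> / real q)) = (\<Sum>\<mu><q. \<Sum>\<nu>\<in>{\<mu> * r..<\<mu> * r + r}. F (real \<mu> / real q))"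
        by (simp add: sum_distrib_left)
      ultimately show ?thesis by (simp only: sum_subtractf)
    qed
    also have "\<bar>\<dots>\<bar> \<le> (\<Sum>\<mu><q. (\<Sum>\<nu>\<in>{\<mu> * r..<\<mu> * r + r}. (v r \<mu> + v r' \<mu>) / 2))"
      by (intro order_trans[OF sum_abs] sum_mono dF) auto
    also have "\<dots> = real r / 2 * ((\<Sum>\<mu><q. v r \<mu>) + (\<Sum>\<mu><q. v r' \<mu>))"
      unfolding sum.distrib[symmetric] sum_distrib_left by simp
    finally show ?thesis unfolding v by (simp add: field_simps)
  qed
  have 2: "\<bar>total\<bar> \<le> real q * (real (gcd r r') / 4)"
  proof -
    have "total = (\<Sum>\<nu><r * q. F (real \<nu> / real (q * r)))"
      unfolding total_def by (simp only: mult.commute)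
    also have "\<dots> = (\<Sum>i<r. \<Sum>\<nu>\<in>{i * q..<i * q + q}. F (real \<nu> / real (q * r)))"
      by (rule sum.nat_group[symmetric])
    also have "\<dots> = (\<Sum>i<r. \<Sum>\<nu><q. sawtooth (real \<nu> / real q) * sawtooth (real r' * real \<nu> / real (q * r) + real r' * real i / real r))"
    proof (rule sum.cong)
      fix i
      have F: "sawtooth (real \<nu> / real q) * sawtooth (real r' * real \<nu> / real (q * r) + real r' * real i / real r) = F (real (i * q + \<nu>) / real (q * r))" for \<nu>
      proof -
        have "real r * (real (i * q + \<nu>) / real (q * r)) = real \<nu> / real q + real i"
          using q r by (simp add: field_simps)
        moreover have "real r' * (real (i * q + \<nu>) / real (q * r)) = real r' * real \<nu> / real (q * r) + real r' * real i / real r"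
          using q r by (simp add: field_simps)
        ultimately show ?thesis unfolding F_def by (simp only: sawtooth_add_nat)
      qed
      show "(\<Sum>\<nu>\<in>{i * q..<i * q + q}. F (real \<nu> / real (q * r))) = (\<Sum>\<nu><q. sawtooth (real \<nu> / real q) * sawtooth (real r' * real \<nu> / real (q * r) + real r' * real i / real r))"
        unfolding F by (rule sum.reindex_bij_witness[where i = "\<lambda>\<nu>. i * q + \<nu>" and j = "\<lambda>\<nu>. \<nu> - i * q"]) auto
    qed simp
    also have "\<dots> = (\<Sum>\<nu><q. sawtooth (real \<nu> / real q) * (\<Sum>i<r. sawtooth (real r' * real \<nu> / real (q * r) + real r' * real i / real r)))"
      unfolding sum_distrib_left by (rule sum.swap)
    also have "\<bar>\<dots>\<bar> \<le> (\<Sum>\<nu><q. 1/2 * (real (gcd r r') / 2))"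
      by (intro order_trans[OF sum_abs] sum_mono, unfold abs_mult)
         (intro mult_mono abs_sawtooth_le abs_sum_sawtooth_progression_le r, auto)
    finally show ?thesis by simp
  qed
  have "real r * \<bar>\<Sum>\<mu><q. F (real \<mu> / real q)\<bar> = \<bar>real r * (\<Sum>\<mu><q. F (real \<mu> / real q))\<bar>"
    by (simp add: abs_mult)
  also have "\<dots> \<le> real q * (real (gcd r r') / 4) + real r * (real r + real r')"
    using 1 2 by linarith
  also have "\<dots> = real r * (real q * real (gcd r r') / (4 * real r) + (real r + real r'))"
    using r by (simp add: field_simps)
  finally have "\<bar>\<Sum>\<mu><q. F (real \<mu> / real q)\<bar> \<le> real q * real (gcd r r') / (4 * real r) + (real r + real r')"
    using r by (simp only: mult_le_cancel_left_pos of_nat_0_less_iff)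
  then show ?thesis by (simp add: F_def)
qed

lemma multiples_upto_eq: "d > 0 \<Longrightarrow> {x \<in> {1..n}. d dvd x} = (\<lambda>k. d * k) ` {1..n div d}" for d n :: nat
proof (intro equalityI subsetI)
  fix x assume d: "d > 0" and "x \<in> {x \<in> {1..n}. d dvd x}"
  then obtain k where "x = d * k" "1 \<le> d * k" "d * k \<le> n" by auto
  then show "x \<in> (\<lambda>k. d * k) ` {1..n div d}"
    using d by (intro image_eqI[of _ _ k]) (auto simp: less_eq_div_iff_mult_less_eq mult.commute Suc_le_eq)
next
  fix x assume d: "d > 0" and "x \<in> (\<lambda>k. d * k) ` {1..n div d}"
  then obtain k where k: "x = d * k" "1 \<le> k" "k \<le> n div d" by auto
  have "d * k \<le> n" using k d by (simp add: less_eq_div_iff_mult_less_eq mult.commute)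
  then show "x \<in> {x \<in> {1..n}. d dvd x}" using k d by auto
qed

lemma card_multiples_upto: "d > 0 \<Longrightarrow> card {x \<in> {1..n}. d dvd x} = n div d" for d n :: nat
  unfolding multiples_upto_eq by (subst card_image) (auto simp: inj_on_def)

lemma sum_gcd_div_le:
  assumes R: "R \<ge> 1"
  shows "(\<Sum>r=1..R. \<Sum>r'=1..r. real (gcd r r') / real r) \<le> real R * (1 + ln (real R))"
proof -
  have "(\<Sum>r=1..R. \<Sum>r'=1..r. real (gcd r r') / real r) 
     \<le> (\<Sum>r=1..R. \<Sum>r'=1..r. \<Sum>d=1..R. if d dvd r \<and> d dvd r' then real d / real r else 0)"
  proof (intro sum_mono)
    fix r r' assume "r \<in> {1..R}" "r' \<in> {1..r}"
    then have "r \<noteq> 0" "r \<le> R" by auto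
    then have "gcd r r' \<in> {1..R}" using order_trans[OF gcd_le1_nat[of r r']] by (simp add: Suc_le_eq)
    then have "(\<Sum>d\<in>{gcd r r'}. if d dvd r \<and> d dvd r' then real d / real r else 0)
       \<le> (\<Sum>d=1..R. if d dvd r \<and> d dvd r' then real d / real r else 0)"
      by (intro sum_mono2) auto
    then show "real (gcd r r') / real r \<le> (\<Sum>d=1..R. if d dvd r \<and> d dvd r' then real d / real r else 0)" by simp
  qed
  also have "\<dots> = (\<Sum>r=1..R. \<Sum>d=1..R. \<Sum>r'=1..r. if d dvd r \<and> d dvd r' then real d / real r else 0)"
    by (intro sum.cong sum.swap refl)
  also have "\<dots> \<le> (\<Sum>r=1..R. \<Sum>d=1..R. if d dvd r then 1 else 0)"
  proof (intro sum_mono)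
    fix r d assume rd: "r \<in> {1..R}" "d \<in> {1..R}"
    show "(\<Sum>r'=1..r. if d dvd r \<and> d dvd r' then real d / real r else 0) \<le> (if d dvd r then 1 else 0)"
    proof (cases "d dvd r")
      case True
      have "(\<Sum>r'=1..r. if d dvd r \<and> d dvd r' then real d / real r else 0) = (\<Sum>r'\<in>{x\<in>{1..r}. d dvd x}. real d / real r)"
        using True by (subst sum.inter_filter) auto
      also have "\<dots> = real (card {x\<in>{1..r}. d dvd x}) * (real d / real r)" by simp
      also have "\<dots> = real (r div d) * (real d / real r)"
        using rd by (subst card_multiples_upto) auto
      also have "\<dots> = 1" using True rd by (simp add: real_of_nat_div)
      finally show ?thesis using True by simp
    qed simp
  qed
  also have "\<dots> = (\<Sum>d=1..R. \<Sum>r=1..R. if d dvd r then 1 else 0)" by (rule sum.swap)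
  also have "\<dots> \<le> (\<Sum>d=1..R. real R * (1 / real d))"
  proof (rule sum_mono)
    fix d assume d: "d \<in> {1..R}"
    have "(\<Sum>r=1..R. if d dvd r then 1 else 0 :: real) = real (card {x\<in>{1..R}. d dvd x})"
      by (subst sum.inter_filter[symmetric]) auto
    also have "\<dots> = real (R div d)" using d by (subst card_multiples_upto) auto
    also have "\<dots> \<le> real R * (1 / real d)" using of_nat_div_le_of_nat[of R d] by simp
    finally show "(\<Sum>r=1..R. if d dvd r then 1 else 0) \<le> real R * (1 / real d)" .
  qed
  also have "\<dots> \<le> real R * (1 + ln (real R))"
    unfolding sum_distrib_left[symmetric] by (intro mult_left_mono sum_inverse_le R) auto
  finally show ?thesis .
qed

lemma one_plus_ln_le_sqrt:
  assumes "x \<ge> (1::real)"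
  shows "1 + ln x \<le> 2 * sqrt x"
proof -
  have "ln (sqrt x) \<le> sqrt x - 1" using assms by (intro ln_le_minus_one) auto
  then show ?thesis using assms by (simp add: ln_sqrt)
qed

lemma sawtooth_second_moment:
  assumes q: "q > 0" and e: "e > 0" and R: "R \<ge> 1"
  shows "(\<Sum>\<mu><q. (\<Sum>r=1..R. sawtooth (real (e * r) * real \<mu> / real q))\<^sup>2) \<le> real q * (real R * sqrt (real R)) + 2 * real e * (real R) ^ 3"
proof -
  define c where "c r r' = (\<Sum>\<mu><q. sawtooth (real (e * r) * real \<mu> / real q) * sawtooth (real (e * r') * real \<mu> / real q))" for r r'
  define T where "T r r' = (if r' \<le> r then real (gcd r r') / real r else 0)" for r r' :: nat
  have ord: "\<bar>c r r'\<bar> \<le> real q / 4 * (real (gcd r r') / real r) + 2 * real e * real R"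
    if "r \<in> {1..R}" "r' \<in> {1..R}" for r r'
  proof -
    have "\<bar>c r r'\<bar> \<le> real q * real (gcd (e * r) (e * r')) / (4 * real (e * r)) + (real (e * r) + real (e * r'))"
      unfolding c_def using that e q by (intro sawtooth_correlation_le) auto
    also have "real q * real (gcd (e * r) (e * r')) / (4 * real (e * r)) = real q / 4 * (real (gcd r r') / real r)"
      using e by (simp add: gcd_mult_distrib_nat[symmetric])
    also have "real (e * r) + real (e * r') \<le> real (e * R) + real (e * R)"
      using that by (intro add_mono of_nat_mono mult_left_mono) auto
    also have "real (e * R) + real (e * R) = 2 * real e * real R" by simp
    finally show ?thesis by simp
  qed
  have cT: "c r r' \<le> real q / 4 * (T r r' + T r' r) + 2 * real e * real R"
    if "r \<in> {1..R}" "r' \<in> {1..R}" for r r'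
  proof -
    have le: "x \<le> y + z" if "\<bar>x\<bar> \<le> Q * a + z" "Q * a \<le> y" for x y z Q a :: real using that by linarith
    have sym: "c r r' = c r' r" by (simp add: c_def mult.commute)
    show ?thesis
    proof (cases "r' \<le> r")
      case True
      show ?thesis by (rule le[OF ord[OF that]], rule mult_left_mono) (use True in \<open>auto simp: T_def\<close>)
    next
      case False
      show ?thesis unfolding sym by (rule le[OF ord[OF that(2,1)]], rule mult_left_mono) (use False in \<open>auto simp: T_def\<close>)
    qed
  qed
  have sT: "(\<Sum>r=1..R. \<Sum>r'=1..R. T r r') = (\<Sum>r=1..R. \<Sum>r'=1..r. real (gcd r r') / real r)"
  proof (rule sum.cong)
    fix r assume r: "r \<in> {1..R}"
    have "(\<Sum>r'=1..R. T r r') = (\<Sum>r'\<in>{x\<in>{1..R}. x \<le> r}. real (gcd r r') / real r)"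
      unfolding T_def by (subst sum.inter_filter) auto
    also have "{x\<in>{1..R}. x \<le> r} = {1..r}" using r by auto
    finally show "(\<Sum>r'=1..R. T r r') = (\<Sum>r'=1..r. real (gcd r r') / real r)" .
  qed simp
  have sT': "(\<Sum>r=1..R. \<Sum>r'=1..R. T r' r) = (\<Sum>r=1..R. \<Sum>r'=1..r. real (gcd r r') / real r)"
    by (subst sum.swap) (rule sT)
  have "(\<Sum>\<mu><q. (\<Sum>r=1..R. sawtooth (real (e * r) * real \<mu> / real q))\<^sup>2) = (\<Sum>\<mu><q. \<Sum>r=1..R. \<Sum>r'=1..R. sawtooth (real (e * r) * real \<mu> / real q) * sawtooth (real (e * r') * real \<mu> / real q))"
    by (simp only: power2_eq_square sum_product)
  also have "\<dots> = (\<Sum>r=1..R. \<Sum>r'=1..R. c r r')"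
    unfolding c_def by (subst sum.swap, rule sum.cong[OF refl], rule sum.swap)
  also have "\<dots> \<le> (\<Sum>r=1..R. \<Sum>r'=1..R. real q / 4 * (T r r' + T r' r) + 2 * real e * real R)"
    by (intro sum_mono cT)
  also have "\<dots> = real q / 4 * ((\<Sum>r=1..R. \<Sum>r'=1..R. T r r') + (\<Sum>r=1..R. \<Sum>r'=1..R. T r' r)) + 2 * real e * real R ^ 3"
  proof -
    have "(\<Sum>r=1..R. \<Sum>r'=1..R. Q * (T r r' + T r' r) + K) = Q * ((\<Sum>r=1..R. \<Sum>r'=1..R. T r r') + (\<Sum>r=1..R. \<Sum>r'=1..R. T r' r)) + real R * (real R * K)" for Q K
      by (simp add: sum.distrib distrib_left sum_distrib_left)
    from this[of "real q / 4" "2 * real e * real R"] show ?thesis by (simp only: power3_eq_cube mult_ac)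
  qed
  also have "\<dots> = real q / 4 * (2 * (\<Sum>r=1..R. \<Sum>r'=1..r. real (gcd r r') / real r)) + 2 * real e * real R ^ 3"
    unfolding sT sT' by simp
  also have "\<dots> \<le> real q / 4 * (2 * (real R * (2 * sqrt (real R)))) + 2 * real e * real R ^ 3"
  proof (intro add_right_mono mult_left_mono)
    have "real R * (1 + ln (real R)) \<le> real R * (2 * sqrt (real R))"
      using R by (intro mult_left_mono one_plus_ln_le_sqrt) auto
    then show "(\<Sum>r=1..R. \<Sum>r'=1..r. real (gcd r r') / real r) \<le> real R * (2 * sqrt (real R))"
      using sum_gcd_div_le[OF R] by linarith
  qed auto
  finally show ?thesis by simp
qed

lemma sawtooth_first_moment:
  assumes q: "q > 0" and e: "e \<in> {1, 2}" and R: "R \<ge> 1"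
  shows "(\<Sum>\<mu><q. \<bar>\<Sum>r=1..R. sawtooth (real (e * r) * real \<mu> / real q)\<bar>) \<le> real q * sqrt (real R * sqrt (real R)) + 2 * sqrt (real q) * (real R * sqrt (real R))"
proof -
  define S where "S \<mu> = (\<Sum>r=1..R. sawtooth (real (e * r) * real \<mu> / real q))" for \<mu>
  have "(\<Sum>\<mu><q. \<bar>S \<mu>\<bar>)\<^sup>2 \<le> real q * (\<Sum>\<mu><q. (S \<mu>)\<^sup>2)"
    using Cauchy_Schwarz_ineq_sum[of "\<lambda>_. 1" "\<lambda>\<mu>. \<bar>S \<mu>\<bar>" "{..<q}"] by simp
  also have "\<dots> \<le> real q * (real q * (real R * sqrt (real R)) + 4 * real R ^ 3)"
  proof (rule mult_left_mono)
    have "2 * real e * real R ^ 3 \<le> 4 * real R ^ 3" using e by (intro mult_right_mono) auto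
    moreover have "e > 0" using e by auto
    ultimately show "(\<Sum>\<mu><q. (S \<mu>)\<^sup>2) \<le> real q * (real R * sqrt (real R)) + 4 * real R ^ 3"
      using sawtooth_second_moment[OF q _ R, of e] unfolding S_def by linarith
  qed simp
  also have "\<dots> = (real q)\<^sup>2 * (real R * sqrt (real R)) + 4 * real q * real R ^ 3"
    by (simp add: power2_eq_square algebra_simps)
  finally have "(\<Sum>\<mu><q. \<bar>S \<mu>\<bar>) \<le> sqrt ((real q)\<^sup>2 * (real R * sqrt (real R)) + 4 * real q * real R ^ 3)"
    by (rule real_le_rsqrt)
  also have "\<dots> \<le> sqrt ((real q)\<^sup>2 * (real R * sqrt (real R))) + sqrt (4 * real q * real R ^ 3)"
    by (rule sqrt_add_le_add_sqrt) auto
  also have "\<dots> = real q * sqrt (real R * sqrt (real R)) + 2 * sqrt (real q) * (real R * sqrt (real R))"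
    by (simp add: real_sqrt_mult power3_eq_cube)
  finally show ?thesis unfolding S_def .
qed

section \<open>The first moment of the cotangent sums\<close>

lemma summation_by_parts:
  fixes w t :: "nat \<Rightarrow> real"
  assumes "n \<ge> 1"
  shows "(\<Sum>i=1..n. w i * t i) = w n * (\<Sum>i=1..n. t i) + (\<Sum>i=1..<n. (w i - w (Suc i)) * (\<Sum>j=1..i. t j))"
  using assms by (induction n rule: dec_induct) (simp_all add: algebra_simps)

lemma abs_summation_by_parts_le:
  fixes w t :: "nat \<Rightarrow> real"
  assumes "n \<ge> 1"
  shows "\<bar>\<Sum>i=1..n. w i * t i\<bar> \<le> \<bar>w n\<bar> * \<bar>\<Sum>i=1..n. t i\<bar> + (\<Sum>i=1..<n. \<bar>w i - w (Suc i)\<bar> * \<bar>\<Sum>j=1..i. t j\<bar>)"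
  unfolding summation_by_parts[OF assms]
  by (intro order_trans[OF abs_triangle_ineq] add_mono order_trans[OF sum_abs]) (simp_all add: abs_mult)

lemma sum_inverse_sqrt_le: "(\<Sum>r=1..n. 1 / sqrt (real r)) \<le> 2 * sqrt (real n)"
proof (induction n)
  case (Suc n)
  define a b where "a = sqrt (real n)" and "b = sqrt (real (Suc n))"
  have b: "b > 0" "a \<ge> 0" and ab: "b\<^sup>2 = a\<^sup>2 + 1" by (simp_all add: a_def b_def)
  have "0 \<le> (b - a)\<^sup>2" by simp
  then have "1 \<le> (2 * b - 2 * a) * b" using ab by (simp add: power2_eq_square algebra_simps)
  then have "1 / b \<le> 2 * b - 2 * a" using b by (simp add: divide_le_eq)
  then show ?case using Suc by (simp add: a_def b_def)
qed simp

lemma sum_powr_five_quarters_bounded: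
  obtains Z :: real where "Z \<ge> 0" "\<And>n. (\<Sum>r=1..<n. sqrt (real r * sqrt (real r)) / (real r)\<^sup>2) \<le> Z"
proof
  have eq: "sqrt (real r * sqrt (real r)) / (real r)\<^sup>2 = real r powr (-5/4)" if "r \<ge> 1" for r
  proof -
    have "sqrt (real r * sqrt (real r)) = (real r powr 1 * real r powr (1/2)) powr (1/2)"
      using that by (simp add: powr_half_sqrt)
    also have "\<dots> = real r powr (3/4)"
      by (simp only: powr_add[symmetric] powr_powr) simp
    finally show ?thesis
      using that by (simp add: powr_diff[symmetric] powr_numeral[symmetric] del: powr_numeral)
  qed
  have sm: "summable (\<lambda>r. real r powr (-5/4))" by (simp add: summable_real_powr_iff)
  show "0 \<le> (\<Sum>r. real r powr (-5/4))" by (intro suminf_nonneg sm) auto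
  fix n
  have "(\<Sum>r=1..<n. sqrt (real r * sqrt (real r)) / (real r)\<^sup>2) = (\<Sum>r=1..<n. real r powr (-5/4))"
    by (intro sum.cong refl eq) auto
  also have "\<dots> \<le> (\<Sum>r. real r powr (-5/4))" by (intro sum_le_suminf sm) auto
  finally show "(\<Sum>r=1..<n. sqrt (real r * sqrt (real r)) / (real r)\<^sup>2) \<le> (\<Sum>r. real r powr (-5/4))" .
qed

definition cot_sawtooth :: "nat \<Rightarrow> nat \<Rightarrow> nat \<Rightarrow> real" where
  "cot_sawtooth q e \<mu> = (\<Sum>r\<in>half_range q. cotpi (real r / real q) * sawtooth (real (e * r) * real \<mu> / real q))"

lemma cotpi_step_le:
  assumes r: "1 \<le> r" "2 * Suc r < q"
  shows "\<bar>cotpi (real r / real q) - cotpi (real (Suc r) / real q)\<bar> \<le> 8 * real q / (real r)\<^sup>2"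
proof -
  define x where "x = real (Suc r) / real q"
  have "2 * real (Suc r) < real q" using r(2) by (metis of_nat_less_iff of_nat_mult of_nat_numeral)
  then have x: "0 < x" "x < 1/2" using r by (auto simp: x_def field_simps)
  have "2 * (1 / real q) \<le> x" using r by (auto simp: x_def intro!: divide_right_mono)
  from cotpi_diff_bounds[OF _ this] x
  have b: "0 \<le> cotpi (x - 1 / real q) - cotpi x" "cotpi (x - 1 / real q) - cotpi x \<le> 4 * (1 / real q) * (1 / x\<^sup>2 + 1 / (1 - x)\<^sup>2)"
    by auto
  have e: "x - 1 / real q = real r / real q" by (simp add: x_def add_divide_distrib)
  have "1 / (1 - x)\<^sup>2 \<le> 1 / x\<^sup>2"
    using x by (intro divide_left_mono power_mono mult_pos_pos zero_less_power) auto
  then have "4 * (1 / real q) * (1 / x\<^sup>2 + 1 / (1 - x)\<^sup>2) \<le> 4 * (1 / real q) * (1 / x\<^sup>2 + 1 / x\<^sup>2)"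
    by (intro mult_left_mono add_left_mono) auto
  also have "\<dots> = 8 * real q * (1 / (real (Suc r))\<^sup>2)"
    using r by (simp add: x_def power2_eq_square)
  also have "\<dots> \<le> 8 * real q * (1 / (real r)\<^sup>2)"
    using r by (intro mult_left_mono divide_left_mono power_mono mult_pos_pos zero_less_power) auto
  finally have "4 * (1 / real q) * (1 / x\<^sup>2 + 1 / (1 - x)\<^sup>2) \<le> 8 * real q / (real r)\<^sup>2" by simp
  with b have "\<bar>cotpi (x - 1 / real q) - cotpi x\<bar> \<le> 8 * real q / (real r)\<^sup>2"
    by (simp only: abs_of_nonneg)
  then show ?thesis unfolding e unfolding x_def .
qed

lemma cot_sawtooth_first_moment:
  obtains K :: real where "K \<ge> 0" "\<And>q e. q > 0 \<Longrightarrow> e \<in> {1, 2} \<Longrightarrow> (\<Sum>\<mu><q. \<bar>cot_sawtooth q e \<mu>\<bar>) \<le> K * (real q)\<^sup>2"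
proof -
  obtain Z :: real where Z: "Z \<ge> 0" "\<And>n. (\<Sum>r=1..<n. sqrt (real r * sqrt (real r)) / (real r)\<^sup>2) \<le> Z"
    using sum_powr_five_quarters_bounded by blast
  show ?thesis
  proof
    show "0 \<le> 35 + 8 * Z" using Z by simp
    fix q e :: nat assume q: "q > 0" and e: "e \<in> {1, 2}"
    define n where "n = (q - 1) div 2"
    define S where "S R \<mu> = (\<Sum>r=1..R. sawtooth (real (e * r) * real \<mu> / real q))" for R \<mu>
    define w where "w r = cotpi (real r / real q)" for r
    define B where "B R = real q * sqrt (real R * sqrt (real R)) + 2 * sqrt (real q) * (real R * sqrt (real R))" for R
    have S: "(\<Sum>\<mu><q. \<bar>S R \<mu>\<bar>) \<le> B R" if "R \<ge> 1" for R
      unfolding S_def B_def by (rule sawtooth_first_moment[OF q e that])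
    have Y: "cot_sawtooth q e \<mu> = (\<Sum>r=1..n. w r * sawtooth (real (e * r) * real \<mu> / real q))" for \<mu>
      unfolding cot_sawtooth_def half_range_eq n_def w_def ..
    show "(\<Sum>\<mu><q. \<bar>cot_sawtooth q e \<mu>\<bar>) \<le> (35 + 8 * Z) * (real q)\<^sup>2"
    proof (cases "n = 0")
      case True
      then show ?thesis using Z(1) by (simp add: Y)
    next
      case False
      then have n: "n \<ge> 1" "2 * n < q" by (auto simp: n_def)
      have nq: "real n \<le> real q" using n by simp
      have 1: "\<bar>w n\<bar> * B n \<le> 3 * (real q)\<^sup>2"
      proof -
        have "n \<in> half_range q" using n by (simp add: half_range_def)
        then have x: "0 < real n / real q" "real n / real q \<le> 1/2" using half_range_frac[of n q] by simp_all
        have "\<bar>w n\<bar> = w n" unfolding w_def using cotpi_nonneg[of "real n / real q"] x by auto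
        also have "\<dots> \<le> 1 / (pi * (real n / real q))" unfolding w_def using cotpi_approx(1)[OF x] .
        also have "\<dots> \<le> 1 / (1 * (real n / real q))" 
          using x pi_gt3 by (intro divide_left_mono mult_right_mono mult_pos_pos) auto
        finally have w: "\<bar>w n\<bar> \<le> real q / real n" by simp
        have a: "sqrt (real n * sqrt (real n)) \<le> real n"
        proof -
          have "sqrt (real n) \<le> real n" using n by (intro real_le_lsqrt) (auto simp: power2_eq_square)
          then have "real n * sqrt (real n) \<le> (real n)\<^sup>2" by (simp add: power2_eq_square mult_left_mono)
          then show ?thesis by (intro real_le_lsqrt) auto
        qed
        have b: "sqrt (real q) * (real n * sqrt (real n)) \<le> real n * real q"
        proof -
          have "sqrt (real n) \<le> sqrt (real q)" using nq by simp
          then have "sqrt (real q) * (real n * sqrt (real n)) \<le> sqrt (real q) * (real n * sqrt (real q))"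
            by (intro mult_left_mono) auto
          also have "\<dots> = real n * real q" by (simp add: mult.left_commute)
          finally show ?thesis .
        qed
        have "B n \<le> real q * real n + 2 * (real n * real q)"
          unfolding B_def mult.assoc using a b by (intro add_mono mult_left_mono) auto
        then have "\<bar>w n\<bar> * B n \<le> real q / real n * (real q * real n + 2 * (real n * real q))"
          using w by (intro mult_mono) (auto simp: B_def)
        also have "\<dots> = 3 * (real q)\<^sup>2" using n by (simp add: power2_eq_square field_simps)
        finally show ?thesis .
      qed
      have 2: "(\<Sum>r=1..<n. \<bar>w r - w (Suc r)\<bar> * B r) \<le> (32 + 8 * Z) * (real q)\<^sup>2"
      proof -
        have "(\<Sum>r=1..<n. \<bar>w r - w (Suc r)\<bar> * B r) \<le> (\<Sum>r=1..<n. 8 * real q / (real r)\<^sup>2 * B r)"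
        proof (intro sum_mono mult_right_mono)
          fix r assume "r \<in> {1..<n}"
          then show "\<bar>w r - w (Suc r)\<bar> \<le> 8 * real q / (real r)\<^sup>2"
            unfolding w_def using n by (intro cotpi_step_le) auto
        qed (auto simp: B_def)
        also have "\<dots> = (\<Sum>r=1..<n. 8 * (real q)\<^sup>2 * (sqrt (real r * sqrt (real r)) / (real r)\<^sup>2) + 16 * real q * sqrt (real q) * (1 / sqrt (real r)))"
        proof (rule sum.cong)
          fix r assume "r \<in> {1..<n}"
          then have r: "real r > 0" by simp
          have "real r * sqrt (real r) / (real r)\<^sup>2 = 1 / sqrt (real r)"
            using r by (simp add: power2_eq_square field_simps)
          moreover have "8 * real q / (real r)\<^sup>2 * (2 * sqrt (real q) * (real r * sqrt (real r))) = 16 * real q * sqrt (real q) * (real r * sqrt (real r) / (real r)\<^sup>2)"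
            by simp
          ultimately have "8 * real q / (real r)\<^sup>2 * (2 * sqrt (real q) * (real r * sqrt (real r))) = 16 * real q * sqrt (real q) * (1 / sqrt (real r))"
            by (simp only:)
          moreover have "8 * real q / (real r)\<^sup>2 * (real q * sqrt (real r * sqrt (real r))) = 8 * (real q)\<^sup>2 * (sqrt (real r * sqrt (real r)) / (real r)\<^sup>2)"
            by (simp add: power2_eq_square)
          ultimately show "8 * real q / (real r)\<^sup>2 * B r = 8 * (real q)\<^sup>2 * (sqrt (real r * sqrt (real r)) / (real r)\<^sup>2) + 16 * real q * sqrt (real q) * (1 / sqrt (real r))"
            unfolding B_def distrib_left by (rule arg_cong2[where f = "(+)", rotated])
        qed simp
        also have "\<dots> = 8 * (real q)\<^sup>2 * (\<Sum>r=1..<n. sqrt (real r * sqrt (real r)) / (real r)\<^sup>2) + 16 * real q * sqrt (real q) * (\<Sum>r=1..<n. 1 / sqrt (real r))"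
          by (simp only: sum.distrib sum_distrib_left)
        also have "\<dots> \<le> 8 * (real q)\<^sup>2 * Z + 16 * real q * sqrt (real q) * (2 * sqrt (real q))"
        proof (intro add_mono mult_left_mono Z)
          have "(\<Sum>r=1..<n. 1 / sqrt (real r)) \<le> (\<Sum>r=1..q. 1 / sqrt (real r))"
            using n by (intro sum_mono2) auto
          then show "(\<Sum>r=1..<n. 1 / sqrt (real r)) \<le> 2 * sqrt (real q)"
            using sum_inverse_sqrt_le[of q] by linarith
        qed auto
        also have "\<dots> = (32 + 8 * Z) * (real q)\<^sup>2" by (simp add: power2_eq_square algebra_simps)
        finally show ?thesis .
      qed
      have "(\<Sum>\<mu><q. \<bar>cot_sawtooth q e \<mu>\<bar>) \<le> (\<Sum>\<mu><q. \<bar>w n\<bar> * \<bar>S n \<mu>\<bar> + (\<Sum>r=1..<n. \<bar>w r - w (Suc r)\<bar> * \<bar>S r \<mu>\<bar>))"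
        unfolding Y S_def by (intro sum_mono abs_summation_by_parts_le n)
      also have "\<dots> = \<bar>w n\<bar> * (\<Sum>\<mu><q. \<bar>S n \<mu>\<bar>) + (\<Sum>r=1..<n. \<bar>w r - w (Suc r)\<bar> * (\<Sum>\<mu><q. \<bar>S r \<mu>\<bar>))"
        unfolding sum.distrib sum_distrib_left by (subst (2) sum.swap) simp
      also have "\<dots> \<le> \<bar>w n\<bar> * B n + (\<Sum>r=1..<n. \<bar>w r - w (Suc r)\<bar> * B r)"
        using n by (intro add_mono sum_mono mult_left_mono S) auto
      also have "\<dots> \<le> 3 * (real q)\<^sup>2 + (32 + 8 * Z) * (real q)\<^sup>2" by (intro add_mono 1 2)
      also have "\<dots> = (35 + 8 * Z) * (real q)\<^sup>2" by (simp add: algebra_simps)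
      finally show ?thesis .
    qed
  qed
qed

definition square_wave :: "real \<Rightarrow> real" where
  "square_wave x = 2 * sawtooth (2 * x) - 4 * sawtooth x"

lemma square_wave_eq_1: "0 < x \<Longrightarrow> x < 1/2 \<Longrightarrow> square_wave x = 1"
  by (simp add: square_wave_def sawtooth_frac)

lemma square_wave_minus [simp]: "square_wave (- x) = - square_wave x"
  by (simp add: square_wave_def)

lemma square_wave_0 [simp]: "square_wave 0 = 0"
  by (simp add: square_wave_def)

lemma square_wave_half [simp]: "square_wave (1/2) = 0"
  by (simp add: square_wave_def sawtooth_frac)

lemma square_wave_add_nat: "square_wave (x + real n) = square_wave x"
proof -
  have "2 * (x + real n) = 2 * x + real (2 * n)" by simp
  then show ?thesis unfolding square_wave_def by (simp only: sawtooth_add_nat)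
qed

lemma cotsum_coprime_eq:
  assumes q: "q > 0" and inv: "(b * \<mu>) mod q = 1 mod q" and cop: "coprime \<mu> q"
  shows "cotsum q b = 2 * cot_sawtooth q 2 \<mu> - 4 * cot_sawtooth q 1 \<mu>"
proof -
  have 1: "(\<Sum>i<q. square_wave (real i / real q) * cotpi (real b * (real i / real q))) = 2 * cotsum q b"
  proof -
    define f where "f x = square_wave x * cotpi (real b * x)" for x
    have "f (x + 1) = f x" for x
      using square_wave_add_nat[of x 1] cotpi_add_nat[of "real b * x" b] by (simp add: f_def distrib_left)
    from sum_residues_halves[where f = f, OF this q]
    have "(\<Sum>i<q. f (real i / real q)) = (\<Sum>i\<in>half_range q. 2 * cotpi (real (b * i) / real q))"
    proof -
      have "f (real i / real q) + f (- (real i / real q)) = 2 * cotpi (real (b * i) / real q)" if "i \<in> half_range q" for i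
        using square_wave_eq_1 half_range_frac[OF that] by (simp add: f_def)
      moreover have "f 0 = 0" "f (1/2) = 0" by (simp_all add: f_def)
      ultimately show ?thesis using \<open>(\<Sum>i<q. f (real i / real q)) = _\<close> by simp
    qed
    then show ?thesis by (simp add: f_def cotsum_def sum_distrib_left)
  qed
  have 2: "(\<Sum>r<q. square_wave (real \<mu> * (real r / real q)) * cotpi (real r / real q)) = 
      2 * (\<Sum>r\<in>half_range q. cotpi (real r / real q) * square_wave (real \<mu> * real r / real q))"
  proof -
    define f where "f x = square_wave (real \<mu> * x) * cotpi x" for x
    have "f (x + 1) = f x" for x
      using square_wave_add_nat[of "real \<mu> * x" \<mu>] by (simp add: f_def distrib_left)
    from sum_residues_halves[where f = f, OF this q]
    have "(\<Sum>i<q. f (real i / real q)) = (\<Sum>i\<in>half_range q. 2 * (cotpi (real i / real q) * square_wave (real \<mu> * real i / real q)))"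
      by (simp add: f_def mult.commute)
    then show ?thesis by (simp add: f_def sum_distrib_left)
  qed
  have "(\<Sum>i<q. square_wave (real i / real q) * cotpi (real b * (real i / real q))) = 
     (\<Sum>r<q. square_wave (real (\<mu> * r mod q) / real q) * cotpi (real b * (real (\<mu> * r mod q) / real q)))"
    by (rule sum_permute_residues[OF q cop, symmetric])
  also have "\<dots> = (\<Sum>r<q. square_wave (real \<mu> * (real r / real q)) * cotpi (real r / real q))"
  proof (rule sum.cong)
    fix r assume "r \<in> {..<q}"
    define k where "k = \<mu> * r div q"
    have k: "real \<mu> * (real r / real q) = real (\<mu> * r mod q) / real q + real k"
      using real_div_mod[OF q, of "\<mu> * r"] by (simp add: k_def)
    have "(b * \<mu> * r) mod q = r mod q" using inv by (metis mod_mult_left_eq mult_1)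
    then have "[b * \<mu> * r = r] (mod q)" by (simp add: cong_def)
    then obtain u v where uv: "r + v * q = b * \<mu> * r + u * q" unfolding cong_iff_lin_nat by blast
    then have "real (r + v * q) = real (b * \<mu> * r + u * q)" by (simp only:)
    then have "real b * (real \<mu> * (real r / real q)) + real u = real r / real q + real v"
      using q by (simp add: field_simps)
    then have "cotpi (real b * (real \<mu> * (real r / real q))) = cotpi (real r / real q)"
      by (metis cotpi_add_nat)
    moreover have "cotpi (real b * (real \<mu> * (real r / real q))) = cotpi (real b * (real (\<mu> * r mod q) / real q))"
      unfolding k distrib_left using cotpi_add_nat[of _ "b * k"] by simp
    moreover have "square_wave (real \<mu> * (real r / real q)) = square_wave (real (\<mu> * r mod q) / real q)"
      unfolding k by (rule square_wave_add_nat)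
    ultimately show "square_wave (real (\<mu> * r mod q) / real q) * cotpi (real b * (real (\<mu> * r mod q) / real q)) =
       square_wave (real \<mu> * (real r / real q)) * cotpi (real r / real q)" by simp
  qed simp
  finally have "cotsum q b = (\<Sum>r\<in>half_range q. cotpi (real r / real q) * square_wave (real \<mu> * real r / real q))"
    unfolding 1 2 by simp
  also have "\<dots> = 2 * cot_sawtooth q 2 \<mu> - 4 * cot_sawtooth q 1 \<mu>"
    unfolding cot_sawtooth_def square_wave_def sum_distrib_left sum_subtractf[symmetric]
    by (intro sum.cong) (simp_all add: algebra_simps)
  finally show ?thesis .
qed

lemma cotsum_coprime_first_moment:
  obtains K :: real where "K \<ge> 0" "\<And>q. q > 0 \<Longrightarrow> (\<Sum>b\<in>{b\<in>{..<q}. coprime b q}. \<bar>cotsum q b\<bar>) \<le> K * (real q)\<^sup>2"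
proof -
  obtain K :: real where K: "K \<ge> 0" "\<And>q e. q > 0 \<Longrightarrow> e \<in> {1, 2} \<Longrightarrow> (\<Sum>\<mu><q. \<bar>cot_sawtooth q e \<mu>\<bar>) \<le> K * (real q)\<^sup>2"
    using cot_sawtooth_first_moment by blast
  show ?thesis
  proof
    show "0 \<le> 6 * K" using K by simp
    fix q :: nat assume q: "q > 0"
    have ex: "\<exists>\<mu>. \<mu> < q \<and> (b * \<mu>) mod q = 1 mod q" if "coprime b q" for b
    proof -
      from that have "\<exists>x. [b * x = 1] (mod q)" using cong_solve_coprime_nat[of b q] by simp
      then obtain x where "[b * x = 1] (mod q)" by blast
      then have "(b * (x mod q)) mod q = 1 mod q" by (simp add: cong_def mod_mult_right_eq)
      then show ?thesis using q by (intro exI[of _ "x mod q"]) auto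
    qed
    define \<mu> where "\<mu> b = (SOME m. m < q \<and> (b * m) mod q = 1 mod q)" for b
    have \<mu>: "\<mu> b < q" "(b * \<mu> b) mod q = 1 mod q" if "coprime b q" for b
      using someI_ex[OF ex[OF that]] unfolding \<mu>_def by auto
    let ?U = "{b\<in>{..<q}. coprime b q}"
    have c\<mu>: "coprime (\<mu> b) q" if "coprime b q" for b
    proof -
      have "[\<mu> b * b = Suc 0] (mod q)" using \<mu>(2)[OF that] by (simp add: cong_def mult.commute)
      then show ?thesis unfolding coprime_iff_invertible_nat by blast
    qed
    have inj: "inj_on \<mu> ?U"
    proof (rule inj_onI)
      fix x y assume xy: "x \<in> ?U" "y \<in> ?U" "\<mu> x = \<mu> y"
      then have "[x * \<mu> x = y * \<mu> x] (mod q)" using \<mu>(2)[of x] \<mu>(2)[of y] by (simp add: cong_def)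
      then have "[x = y] (mod q)" using c\<mu>[of x] xy by (simp add: cong_mult_rcancel_nat)
      then show "x = y" using xy by (simp add: cong_def)
    qed
    have "(\<Sum>b\<in>?U. \<bar>cotsum q b\<bar>) \<le> (\<Sum>b\<in>?U. 2 * \<bar>cot_sawtooth q 2 (\<mu> b)\<bar> + 4 * \<bar>cot_sawtooth q 1 (\<mu> b)\<bar>)"
    proof (rule sum_mono)
      fix b assume "b \<in> ?U"
      then show "\<bar>cotsum q b\<bar> \<le> 2 * \<bar>cot_sawtooth q 2 (\<mu> b)\<bar> + 4 * \<bar>cot_sawtooth q 1 (\<mu> b)\<bar>"
        using cotsum_coprime_eq[OF q \<mu>(2)[of b] c\<mu>[of b]] by simp
    qed
    also have "\<dots> = (\<Sum>m\<in>\<mu> ` ?U. 2 * \<bar>cot_sawtooth q 2 m\<bar> + 4 * \<bar>cot_sawtooth q 1 m\<bar>)"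
      by (subst sum.reindex[OF inj]) simp
    also have "\<dots> \<le> (\<Sum>m<q. 2 * \<bar>cot_sawtooth q 2 m\<bar> + 4 * \<bar>cot_sawtooth q 1 m\<bar>)"
      using \<mu>(1) by (intro sum_mono2) auto
    also have "\<dots> \<le> 6 * K * (real q)\<^sup>2"
      using K(2)[OF q, of 1] K(2)[OF q, of 2] by (simp add: sum.distrib sum_distrib_left[symmetric])
    finally show "(\<Sum>b\<in>?U. \<bar>cotsum q b\<bar>) \<le> 6 * K * (real q)\<^sup>2" .
  qed
qed

lemma sum_periodic_add_period:
  fixes h :: "nat \<Rightarrow> real"
  assumes per: "\<And>j. h (j + \<kappa>) = h j" and zero: "(\<Sum>j<\<kappa>. h j) = 0"
  shows "(\<Sum>j<n + \<kappa>. h j) = (\<Sum>j<n. h j)"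
  by (induction n) (simp_all add: zero per)

lemma abs_sum_periodic_le:
  fixes h :: "nat \<Rightarrow> real"
  assumes per: "\<And>j. h (j + \<kappa>) = h j" and zero: "(\<Sum>j<\<kappa>. h j) = 0" and \<kappa>: "\<kappa> > 0"
  shows "\<bar>\<Sum>j<n. h j\<bar> \<le> (\<Sum>j<\<kappa>. \<bar>h j\<bar>)"
proof (induction n rule: less_induct)
  case (less n)
  show ?case
  proof (cases "n < \<kappa>")
    case True
    have "\<bar>\<Sum>j<n. h j\<bar> \<le> (\<Sum>j<n. \<bar>h j\<bar>)" by (rule sum_abs)
    also have "\<dots> \<le> (\<Sum>j<\<kappa>. \<bar>h j\<bar>)" using True by (intro sum_mono2) auto
    finally show ?thesis .
  next
    case False
    then have "(\<Sum>j<n. h j) = (\<Sum>j<n - \<kappa>. h j)"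
      using sum_periodic_add_period[of h \<kappa> "n - \<kappa>", OF per zero] by simp
    then show ?thesis using less[of "n - \<kappa>"] False \<kappa> by simp
  qed
qed

lemma cotpi_half_nat [simp]: "cotpi (real n / 2) = 0"
proof -
  have "real n / 2 = real (n mod 2) / 2 + real (n div 2)"
    using real_div_mod[of 2 n] by simp
  then have "cotpi (real n / 2) = cotpi (real (n mod 2) / 2)" by (simp only: cotpi_add_nat)
  then show ?thesis by (simp add: mod2_eq_if)
qed

lemma sum_cotpi_period:
  assumes q: "q > 0"
  shows "(\<Sum>j<q. cotpi (real \<beta> * (real j / real q))) = 0"
proof -
  have "cotpi (real \<beta> * (x + 1)) = cotpi (real \<beta> * x)" for x
    using cotpi_add_nat[of "real \<beta> * x" \<beta>] by (simp add: distrib_left)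
  from sum_residues_halves[where f = "\<lambda>x. cotpi (real \<beta> * x)", OF this q]
  show ?thesis by simp
qed

lemma cotsum_altdef: "cotsum q b = (\<Sum>j<(q + 1) div 2. cotpi (real b * (real j / real q)))"
proof -
  have "(\<Sum>j<(q + 1) div 2. cotpi (real b * (real j / real q))) = (\<Sum>j\<in>half_range q. cotpi (real b * (real j / real q)))"
  proof (rule sum.mono_neutral_right)
    have "j = 0" if "j \<in> {..<(q + 1) div 2} - half_range q" for j
      using that by (simp add: half_range_def) linarith
    then show "\<forall>j\<in>{..<(q + 1) div 2} - half_range q. cotpi (real b * (real j / real q)) = 0"
      by force
  qed (auto simp: half_range_def)
  then show ?thesis by (simp add: cotsum_def)
qed

lemma cotsum_mult:
  assumes \<kappa>: "\<kappa> > 0" and d: "d > 0"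
  shows "cotsum (d * \<kappa>) (d * \<beta>) = (if odd d then cotsum \<kappa> \<beta> else 0)"
proof -
  define h where "h j = cotpi (real \<beta> * (real j / real \<kappa>))" for j
  have per: "h (j + \<kappa>) = h j" for j
    using cotpi_add_nat[of "real \<beta> * (real j / real \<kappa>)" \<beta>] \<kappa>
    by (simp add: h_def add_divide_distrib distrib_left)
  have zero: "(\<Sum>j<\<kappa>. h j) = 0" unfolding h_def by (rule sum_cotpi_period[OF \<kappa>])
  have "real (d * \<beta>) * (real j / real (d * \<kappa>)) = real \<beta> * (real j / real \<kappa>)" for j
    using d by simp
  then have F: "cotsum (d * \<kappa>) (d * \<beta>) = (\<Sum>j<(d * \<kappa> + 1) div 2. h j)"
    unfolding cotsum_altdef h_def by (simp only:)
  have step: "(\<Sum>j<(n + 2 * \<kappa> * m + 1) div 2. h j) = (\<Sum>j<(n + 1) div 2. h j)" for n m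
  proof (induction m)
    case (Suc m)
    have "(n + 2 * \<kappa> * Suc m + 1) div 2 = (n + 2 * \<kappa> * m + 1) div 2 + \<kappa>" by simp
    then show ?case using Suc sum_periodic_add_period[of h \<kappa>, OF per zero] by simp
  qed simp
  show ?thesis
  proof (cases "odd d")
    case True
    then obtain m where "d = 2 * m + 1" by (elim oddE)
    then have "d * \<kappa> = \<kappa> + 2 * \<kappa> * m" by (simp add: algebra_simps)
    then show ?thesis unfolding F using True step[of \<kappa> m] by (simp add: cotsum_altdef h_def)
  next
    case False
    then have "even d" by simp
    then obtain m where "d = 2 * m" by (elim evenE)
    then have e: "d * \<kappa> = 0 + 2 * \<kappa> * m" by (simp add: algebra_simps)
    have "(\<Sum>j<(d * \<kappa> + 1) div 2. h j) = (\<Sum>j<(0 + 1) div 2. h j)" unfolding e by (rule step)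
    then show ?thesis unfolding F using False by simp
  qed
qed

lemma cotsum_first_moment:
  obtains K :: real where "K \<ge> 0" "\<And>q. q > 0 \<Longrightarrow> (\<Sum>b<q. \<bar>cotsum q b\<bar>) \<le> K * (real q)\<^sup>2"
proof -
  obtain K :: real where K: "K \<ge> 0" "\<And>q. q > 0 \<Longrightarrow> (\<Sum>b\<in>{b\<in>{..<q}. coprime b q}. \<bar>cotsum q b\<bar>) \<le> K * (real q)\<^sup>2"
    using cotsum_coprime_first_moment by blast
  show ?thesis
  proof
    show "0 \<le> K * 2" using K by simp
    fix q :: nat assume q: "q > 0"
    have "(\<Sum>b<q. \<bar>cotsum q b\<bar>) = (\<Sum>d=1..q. \<Sum>b\<in>{b\<in>{..<q}. gcd b q = d}. \<bar>cotsum q b\<bar>)"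
      using q by (intro sum.group[symmetric]) (auto simp: Suc_le_eq intro!: gcd_le2_nat)
    also have "\<dots> \<le> (\<Sum>d=1..q. K * ((real q)\<^sup>2 * (1 / (real d)\<^sup>2)))"
    proof (rule sum_mono)
      fix d assume "d \<in> {1..q}"
      then have d: "d > 0" by simp
      show "(\<Sum>b\<in>{b\<in>{..<q}. gcd b q = d}. \<bar>cotsum q b\<bar>) \<le> K * ((real q)\<^sup>2 * (1 / (real d)\<^sup>2))"
      proof (cases "d dvd q")
        case True
        then obtain \<kappa> where \<kappa>: "q = d * \<kappa>" by blast
        have \<kappa>0: "\<kappa> > 0" using q \<kappa> by simp
        have "(\<Sum>b\<in>{b\<in>{..<q}. gcd b q = d}. \<bar>cotsum q b\<bar>) = (\<Sum>\<beta>\<in>{\<beta>\<in>{..<\<kappa>}. coprime \<beta> \<kappa>}. \<bar>cotsum q (d * \<beta>)\<bar>)"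
        proof (rule sum.reindex_bij_witness[where i = "\<lambda>\<beta>. d * \<beta>" and j = "\<lambda>b. b div d"])
          fix b assume "b \<in> {b\<in>{..<q}. gcd b q = d}"
          then have b: "b < q" "gcd b q = d" by auto
          then have dvd: "d dvd b" by auto
          then show "d * (b div d) = b" by simp
          then have "gcd (d * (b div d)) (d * \<kappa>) = d" using b \<kappa> by simp
          then have "d * gcd (b div d) \<kappa> = d" by (simp add: gcd_mult_distrib_nat)
          then have "coprime (b div d) \<kappa>" using d by (simp add: coprime_iff_gcd_eq_1)
          moreover have "b div d < \<kappa>" using b d \<kappa> by (simp add: div_less_iff_less_mult mult.commute)
          ultimately show "b div d \<in> {\<beta>\<in>{..<\<kappa>}. coprime \<beta> \<kappa>}" by simp
          show "\<bar>cotsum q (d * (b div d))\<bar> = \<bar>cotsum q b\<bar>" using dvd by simp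
        next
          fix \<beta> assume "\<beta> \<in> {\<beta>\<in>{..<\<kappa>}. coprime \<beta> \<kappa>}"
          then show "d * \<beta> \<in> {b\<in>{..<q}. gcd b q = d}"
            using d by (simp add: \<kappa> gcd_mult_distrib_nat[symmetric] coprime_iff_gcd_eq_1)
        qed (use d in auto)
        also have "\<dots> \<le> (\<Sum>\<beta>\<in>{\<beta>\<in>{..<\<kappa>}. coprime \<beta> \<kappa>}. \<bar>cotsum \<kappa> \<beta>\<bar>)"
          unfolding \<kappa> by (intro sum_mono) (simp add: cotsum_mult[OF \<kappa>0 d])
        also have "\<dots> \<le> K * (real \<kappa>)\<^sup>2" by (rule K(2)[OF \<kappa>0])
        also have "real \<kappa> = real q / real d" using d by (simp add: \<kappa>)
        finally show ?thesis by (simp add: power_divide)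
      next
        case False
        then have "{b\<in>{..<q}. gcd b q = d} = {}" by auto
        then show ?thesis using K(1) by (simp only: sum.empty) simp
      qed
    qed
    also have "\<dots> = K * (real q)\<^sup>2 * (\<Sum>d=1..q. 1 / (real d)\<^sup>2)"
      by (simp add: sum_distrib_left)
    also have "\<dots> \<le> K * (real q)\<^sup>2 * 2"
      using K(1) by (intro mult_left_mono sum_inverse_squares_le) auto
    finally show "(\<Sum>b<q. \<bar>cotsum q b\<bar>) \<le> K * 2 * (real q)\<^sup>2" by simp
  qed
qed

lemma cotsum_add_period: "q > 0 \<Longrightarrow> cotsum q (b + q) = cotsum q b"
  unfolding cotsum_altdef
proof (rule sum.cong)
  fix j assume "q > 0"
  then have "real (b + q) * (real j / real q) = real b * (real j / real q) + real j"
    by (simp add: distrib_right add_divide_distrib)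
  then show "cotpi (real (b + q) * (real j / real q)) = cotpi (real b * (real j / real q))"
    by (simp only: cotpi_add_nat)
qed simp

lemma sum_cotsum_period:
  assumes q: "q > 0"
  shows "(\<Sum>b<q. cotsum q b) = 0"
proof -
  have "(\<Sum>b<q. cotsum q b) = (\<Sum>j<(q + 1) div 2. \<Sum>b<q. cotpi (real j * (real b / real q)))"
    unfolding cotsum_altdef by (subst sum.swap) (simp add: mult.commute)
  also have "\<dots> = 0" by (simp only: sum_cotpi_period[OF q] sum.neutral_const)
  finally show ?thesis .
qed

lemma abs_sum_weighted_cotsum_le:
  assumes k: "k > 0" and L: "(\<Sum>b<k. \<bar>cotsum k b\<bar>) \<le> L" and M: "M > 2 * k"
  shows "\<bar>\<Sum>b=2 * k + 1..M. cotpi (real k / real b) * cotsum k b\<bar> \<le> 2 * (real M / real k) * L"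
proof -
  define w where "w b = cotpi (real k / real (2 * k + b))" for b
  define t where "t b = cotsum k (2 * k + b)" for b
  define n where "n = M - 2 * k"
  have n: "n \<ge> 1" using M by (simp add: n_def)
  note per = cotsum_add_period[OF k] and zero = sum_cotsum_period[OF k]
  have t: "\<bar>\<Sum>b=1..i. t b\<bar> \<le> L" for i
  proof -
    have "(\<Sum>j<(i + 1) + k + k. cotsum k j) = (\<Sum>j<2 * k + 1. cotsum k j) + (\<Sum>b=1..i. t b)"
    proof -
      have "(\<Sum>b=1..i. t b) = (\<Sum>j\<in>{2 * k + 1..<(i + 1) + k + k}. cotsum k j)"
        unfolding t_def by (rule sum.reindex_bij_witness[where i = "\<lambda>j. j - 2 * k" and j = "\<lambda>b. 2 * k + b"]) auto
      moreover have "(\<Sum>j\<in>{0..<2 * k + 1}. cotsum k j) + (\<Sum>j\<in>{2 * k + 1..<(i + 1) + k + k}. cotsum k j)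
          = (\<Sum>j\<in>{0..<(i + 1) + k + k}. cotsum k j)"
        by (rule sum.atLeastLessThan_concat) auto
      ultimately show ?thesis unfolding lessThan_atLeast0 by linarith
    qed
    moreover have "(\<Sum>j<2 * k + 1. cotsum k j) = cotsum k 0"
      using sum_periodic_add_period[of "cotsum k" k "1 + k", OF per zero] sum_periodic_add_period[of "cotsum k" k 1, OF per zero]
      by (simp add: mult_2 add_ac)
    moreover have "cotsum k 0 = 0" by (simp add: cotsum_def)
    ultimately have "(\<Sum>b=1..i. t b) = (\<Sum>j<(i + 1) + k + k. cotsum k j)" by simp
    then show ?thesis using abs_sum_periodic_le[of "cotsum k" k, OF per zero k, of "(i + 1) + k + k"] L by simp
  qed
  have wx: "0 < real k / real (2 * k + b)" "real k / real (2 * k + b) \<le> 1/2" for b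
    using k by (simp_all add: field_simps)
  have w0: "0 \<le> w b" for b unfolding w_def using wx[of b] by (intro cotpi_nonneg) auto
  have wmono: "w b \<le> w (Suc b)" for b
  proof -
    define x y where "x = real k / real (2 * k + b)" and "y = real k / real (2 * k + Suc b)"
    have yx: "0 < y" "y \<le> x" "x \<le> 1/2" "2 * (x - y) \<le> x"
    proof -
      show "0 < y" "x \<le> 1/2" unfolding x_def y_def by (rule wx)+
      show "y \<le> x" unfolding x_def y_def using k by (intro divide_left_mono) auto
      have "2 * k + Suc b \<le> 2 * (2 * k + b)" using k by simp
      then have "real (2 * k + Suc b) \<le> real (2 * (2 * k + b))" by (rule of_nat_mono)
      moreover have "real (2 * k + Suc b) > 0" by (simp only: of_nat_0_less_iff)
      ultimately have "real k / real (2 * (2 * k + b)) \<le> y"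
        unfolding y_def by (intro frac_le) simp_all
      moreover have "real k / real (2 * (2 * k + b)) = x / 2" unfolding x_def by simp
      ultimately have "x / 2 \<le> y" by (simp only:)
      then show "2 * (x - y) \<le> x" by simp
    qed
    have "0 \<le> cotpi (x - (x - y)) - cotpi x"
      using yx by (intro cotpi_diff_bounds(1)) auto
    then show ?thesis unfolding w_def x_def[symmetric] y_def[symmetric] by simp
  qed
  have "w n \<le> 1 / (pi * (real k / real (2 * k + n)))"
    unfolding w_def by (intro cotpi_approx wx)
  also have "\<dots> \<le> 1 / (1 * (real k / real (2 * k + n)))"
    using wx[of n] pi_gt3 by (intro divide_left_mono mult_right_mono mult_pos_pos) auto
  also have "\<dots> = real M / real k" using M by (simp add: n_def)
  finally have wn: "w n \<le> real M / real k" .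
  have L0: "L \<ge> 0" using L by (rule order_trans[rotated]) (auto intro: sum_nonneg)
  have "(\<Sum>b=2 * k + 1..M. cotpi (real k / real b) * cotsum k b) = (\<Sum>i=1..n. w i * t i)"
    unfolding w_def t_def n_def
    by (rule sum.reindex_bij_witness[where j = "\<lambda>j. j - 2 * k" and i = "\<lambda>b. 2 * k + b"]) auto
  also have "\<bar>\<dots>\<bar> \<le> \<bar>w n\<bar> * \<bar>\<Sum>i=1..n. t i\<bar> + (\<Sum>i=1..<n. \<bar>w i - w (Suc i)\<bar> * \<bar>\<Sum>j=1..i. t j\<bar>)"
    by (rule abs_summation_by_parts_le[OF n])
  also have "\<dots> \<le> w n * L + (\<Sum>i=1..<n. (w (Suc i) - w i) * L)"
    using w0 wmono t by (intro add_mono sum_mono mult_mono) (auto simp: abs_le_iff)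
  also have "(\<Sum>i=1..<n. (w (Suc i) - w i) * L) = (w n - w 1) * L"
    unfolding sum_distrib_right[symmetric] using n by (simp add: sum_Suc_diff')
  also have "w n * L + (w n - w 1) * L \<le> 2 * w n * L"
    using w0[of 1] L0 by (simp add: algebra_simps)
  also have "\<dots> \<le> 2 * (real M / real k) * L"
    using wn L0 by (intro mult_right_mono mult_left_mono) auto
  finally show ?thesis .
qed

section \<open>Dedekind sums over half a period\<close>

definition dedekind_half_sum :: "nat \<Rightarrow> real" where
  "dedekind_half_sum b = (\<Sum>a\<in>half_range b. dedekind_sum (int a) (int b))"

lemma dedekind_half_sum_eq:
  assumes b: "b > 0"
  shows "dedekind_half_sum b = (\<Sum>k\<in>half_range b. cotpi (real k / real b) * cotsum b k) / (2 * real b)"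
proof -
  define G where "G x = (\<Sum>a\<in>half_range b. cotpi (real a * x))" for x
  have G: "G (real k / real b) = cotsum b k" for k
    by (simp add: G_def cotsum_def mult.commute)
  have Gp: "G (x + 1) = G x" for x
    unfolding G_def
  proof (rule sum.cong)
    fix a
    have "real a * (x + 1) = real a * x + real a" by (simp add: distrib_left)
    then show "cotpi (real a * (x + 1)) = cotpi (real a * x)" by (simp only: cotpi_add_nat)
  qed simp
  have Gm: "G (- x) = - G x" for x by (simp add: G_def sum_negf)
  have "{..<b} = insert 0 {1..<b}" using b by auto
  then have "dedekind_half_sum b = (\<Sum>a\<in>half_range b. (\<Sum>k<b. cotpi (real k / real b) * cotpi (real (k * a) / real b))) / (4 * real b)"
    unfolding dedekind_half_sum_def dedekind_sum_cotpi[OF b] sum_divide_distrib[symmetric] by simp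
  also have "(\<Sum>a\<in>half_range b. (\<Sum>k<b. cotpi (real k / real b) * cotpi (real (k * a) / real b))) = (\<Sum>k<b. cotpi (real k / real b) * G (real k / real b))"
    unfolding G cotsum_def sum_distrib_left by (rule sum.swap)
  also have "\<dots> = 2 * (\<Sum>k\<in>half_range b. cotpi (real k / real b) * cotsum b k)"
  proof -
    have "cotpi (x + 1) * G (x + 1) = cotpi x * G x" for x by (simp add: Gp)
    from sum_residues_halves[where f = "\<lambda>x. cotpi x * G x", OF this b]
    show ?thesis by (simp add: Gm G sum_distrib_left mult.commute)
  qed
  finally show ?thesis by simp
qed

lemma odd_inverse_squares_sums: "(\<lambda>n. \<Sum>j<n. 1 / (real (2 * j + 1))\<^sup>2) \<longlonglongrightarrow> pi\<^sup>2 / 8"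
proof -
  define A where "A n = (\<Sum>j<n. 1 / (real (j + 1))\<^sup>2)" for n
  have A: "A \<longlonglongrightarrow> pi\<^sup>2 / 6"
    using inverse_squares_sums unfolding sums_def A_def by simp
  have split: "(\<Sum>j<n. 1 / (real (2 * j + 1))\<^sup>2) = A (2 * n) - A n / 4" for n
  proof (induction n)
    case (Suc n)
    have "A (2 * Suc n) = A (2 * n) + 1 / (real (2 * n + 1))\<^sup>2 + 1 / (real (2 * n + 2))\<^sup>2"
      by (simp add: A_def add_ac)
    moreover have "(real (2 * n + 2))\<^sup>2 = 4 * (real (n + 1))\<^sup>2" by (simp add: power2_eq_square algebra_simps)
    then have "1 / (real (2 * n + 2))\<^sup>2 = (1 / (real (n + 1))\<^sup>2) / 4" by simp
    moreover have "A (Suc n) = A n + 1 / (real (n + 1))\<^sup>2" by (simp add: A_def)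
    moreover have "s + u = A2 - A1 / 4" if "A2 = a2 + u + v" "v = t / 4" "A1 = a1 + t" "s = a2 - a1 / 4"
      for s u v t A2 A1 a2 a1 :: real using that by (simp add: field_simps)
    ultimately show ?case using Suc unfolding sum.lessThan_Suc by blast
  qed (simp add: A_def)
  have "filterlim (\<lambda>n::nat. 2 * n) sequentially sequentially"
    by (rule mult_nat_left_at_top) simp
  then have "(\<lambda>n. A (2 * n)) \<longlonglongrightarrow> pi\<^sup>2 / 6" by (rule filterlim_compose[OF A])
  then have "(\<lambda>n. A (2 * n) - A n / 4) \<longlonglongrightarrow> pi\<^sup>2 / 6 - (pi\<^sup>2 / 6) / 4"
    by (intro tendsto_intros A) auto
  moreover have "pi\<^sup>2 / 6 - (pi\<^sup>2 / 6) / 4 = pi\<^sup>2 / 8" by simp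
  ultimately show ?thesis unfolding split by (simp only:)
qed

lemma sum_odd_inverse_squares_bounds:
  shows "(\<Sum>j<n. 1 / (real (2 * j + 1))\<^sup>2) \<le> pi\<^sup>2 / 8"
    and "n \<ge> 1 \<Longrightarrow> pi\<^sup>2 / 8 \<le> (\<Sum>j<n. 1 / (real (2 * j + 1))\<^sup>2) + 1 / (4 * real n)"
proof -
  define O' where "O' n = (\<Sum>j<n. 1 / (real (2 * j + 1))\<^sup>2)" for n
  have lim: "O' \<longlonglongrightarrow> pi\<^sup>2 / 8" using odd_inverse_squares_sums by (simp add: O'_def[abs_def])
  have "incseq O'" by (rule incseq_SucI) (simp add: O'_def)
  from incseq_le[OF this lim] show "(\<Sum>j<n. 1 / (real (2 * j + 1))\<^sup>2) \<le> pi\<^sup>2 / 8" by (simp add: O'_def)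
  assume n: "n \<ge> 1"
  have "O' N \<le> O' n + 1 / (4 * real n) - 1 / (4 * real N)" if "N \<ge> n" for N
    using that
  proof (induction N rule: dec_induct)
    case (step N)
    have N: "real N > 0" using step n by simp
    have "1 / (real (2 * N + 1))\<^sup>2 \<le> 1 / (4 * real N * real (Suc N))"
      using N by (intro frac_le) (auto simp: power2_eq_square algebra_simps intro!: add_pos_pos mult_pos_pos)
    also have "\<dots> = 1 / (4 * real N) - 1 / (4 * real (Suc N))" using N by (simp add: field_simps)
    finally show ?case using step by (simp add: O'_def)
  qed simp
  then have "O' N \<le> O' n + 1 / (4 * real n)" if "N \<ge> n" for N
    using that by (smt (verit) divide_nonneg_nonneg of_nat_0_le_iff)
  then have "pi\<^sup>2 / 8 \<le> O' n + 1 / (4 * real n)"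
    by (intro LIMSEQ_le_const2[OF lim]) blast
  then show "pi\<^sup>2 / 8 \<le> (\<Sum>j<n. 1 / (real (2 * j + 1))\<^sup>2) + 1 / (4 * real n)" by (simp add: O'_def)
qed

lemma sum_odd_half_range:
  assumes b: "b \<ge> 1"
  shows "\<bar>(\<Sum>k\<in>half_range b. if odd k then 1 / (real k)\<^sup>2 else 0) - pi\<^sup>2 / 8\<bar> \<le> 4 / real b"
proof -
  define m where "m = (b + 1) div 4"
  have "(\<Sum>k\<in>half_range b. if odd k then 1 / (real k)\<^sup>2 else 0) = (\<Sum>k\<in>{k\<in>half_range b. odd k}. 1 / (real k)\<^sup>2)"
    by (rule sum.inter_filter[symmetric]) simp
  also have "\<dots> = (\<Sum>j<m. 1 / (real (2 * j + 1))\<^sup>2)"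
  proof (rule sum.reindex_bij_witness[where i = "\<lambda>j. 2 * j + 1" and j = "\<lambda>k. k div 2"])
    fix k assume k: "k \<in> {k\<in>half_range b. odd k}"
    then show "2 * (k div 2) + 1 = k" by simp
    moreover have "k div 2 < (b + 1) div 4" if "2 * k < b" "2 * (k div 2) + 1 = k"
      using that by presburger
    ultimately show "k div 2 \<in> {..<m}" using k by (simp add: half_range_def m_def)
    show "1 / (real (2 * (k div 2) + 1))\<^sup>2 = 1 / (real k)\<^sup>2" by (simp only: \<open>2 * (k div 2) + 1 = k\<close>)
  next
    fix j assume "j \<in> {..<m}"
    then show "2 * j + 1 \<in> {k\<in>half_range b. odd k}" by (auto simp: half_range_def m_def)
  qed auto
  finally have e: "(\<Sum>k\<in>half_range b. if odd k then 1 / (real k)\<^sup>2 else 0) = (\<Sum>j<m. 1 / (real (2 * j + 1))\<^sup>2)" .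
  have tail: "pi\<^sup>2 / 8 \<le> (\<Sum>j<m. 1 / (real (2 * j + 1))\<^sup>2) + 4 / real b"
  proof (cases "m = 0")
    case True
    then have "b \<le> 2" by (simp add: m_def)
    have "pi\<^sup>2 \<le> 4\<^sup>2" using pi_less_4 by (intro power_mono) auto
    then have "pi\<^sup>2 / 8 \<le> 4 / 2" by simp
    also have "\<dots> \<le> 4 / real b" using b \<open>b \<le> 2\<close> by (intro divide_left_mono) auto
    finally show ?thesis using True by simp
  next
    case False
    then have m: "m \<ge> 1" by simp
    have "b \<le> 6 * m" using m unfolding m_def by linarith
    then have "real b \<le> 6 * real m" by (metis of_nat_le_iff of_nat_mult of_nat_numeral)
    then have "1 / (4 * real m) \<le> 4 / real b" using b m by (simp add: field_simps)
    then show ?thesis using sum_odd_inverse_squares_bounds(2)[OF m] by linarith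
  qed
  show ?thesis unfolding e using tail sum_odd_inverse_squares_bounds(1)[of m] b by simp
qed

lemma dedekind_half_sum_main_term:
  assumes b: "b \<ge> 1"
  shows "\<bar>ln (real b) / (2 * pi) * (\<Sum>k\<in>half_range b. if odd k then cotpi (real k / real b) / real k else 0) - real b * ln (real b) / 16\<bar> \<le> 12 * real b"
proof -
  define O' where "O' = (\<Sum>k\<in>half_range b. if odd k then 1 / (real k)\<^sup>2 else 0)"
  define C' where "C' = (\<Sum>k\<in>half_range b. if odd k then cotpi (real k / real b) / real k else 0)"
  define l where "l = ln (real b)"
  have l: "0 \<le> l" using b by (simp add: l_def)
  have ls: "1 + l \<le> 2 * sqrt (real b)" unfolding l_def using b by (intro one_plus_ln_le_sqrt) simp
  have l1: "l \<le> real b" unfolding l_def using b ln_le_minus_one[of "real b"] by simp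
  have l2: "l * (1 + l) \<le> 4 * real b"
  proof -
    have "l * (1 + l) \<le> (2 * sqrt (real b)) * (2 * sqrt (real b))" using l ls by (intro mult_mono) auto
    then show ?thesis by simp
  qed
  have "\<bar>C' - real b / pi * O'\<bar> \<le> (\<Sum>k\<in>half_range b. 2 * (1 / real k))"
    unfolding C'_def O'_def sum_distrib_left sum_subtractf[symmetric]
  proof (rule order_trans[OF sum_abs], rule sum_mono)
    fix k assume k: "k \<in> half_range b"
    then have x: "0 < real k / real b" "real k / real b \<le> 1/2" using half_range_frac[of k b] by auto
    have k0: "real k > 0" using k by (simp add: half_range_def)
    have "\<bar>cotpi (real k / real b) - real b / (pi * real k)\<bar> \<le> 2"
      using cotpi_approx[OF x] by simp
    then have "\<bar>cotpi (real k / real b) - real b / (pi * real k)\<bar> / real k \<le> 2 / real k"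
      by (rule divide_right_mono) simp
    also have "\<bar>cotpi (real k / real b) - real b / (pi * real k)\<bar> / real k = \<bar>cotpi (real k / real b) / real k - real b / pi * (1 / (real k)\<^sup>2)\<bar>"
    proof -
      have "\<bar>X\<bar> / real k = \<bar>X / real k\<bar>" for X by simp
      then show ?thesis by (simp only: diff_divide_distrib) (simp add: power2_eq_square)
    qed
    finally show "\<bar>(if odd k then cotpi (real k / real b) / real k else 0) - real b / pi * (if odd k then 1 / (real k)\<^sup>2 else 0)\<bar> \<le> 2 * (1 / real k)"
      by (cases "odd k") (simp_all add: mult.commute)
  qed
  also have "\<dots> \<le> 2 * (1 + l)"
    unfolding sum_distrib_left[symmetric] l_def by (intro mult_left_mono sum_inverse_half_range_le b) auto
  finally have 1: "\<bar>C' - real b / pi * O'\<bar> \<le> 2 * (1 + l)" .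
  have "l / (2 * pi) * C' - real b * l / 16 = l / (2 * pi) * (C' - real b / pi * O') + real b * l / (2 * pi\<^sup>2) * (O' - pi\<^sup>2 / 8)"
    by (simp add: field_simps power2_eq_square)
  also have "\<bar>\<dots>\<bar> \<le> l * (2 * (1 + l)) + real b * l * (4 / real b)"
  proof (intro order_trans[OF abs_triangle_ineq] add_mono)
    have "l / (2 * pi) \<le> l / 1" using l pi_gt3 by (intro divide_left_mono) auto
    then show "\<bar>l / (2 * pi) * (C' - real b / pi * O')\<bar> \<le> l * (2 * (1 + l))"
      unfolding abs_mult using 1 l by (intro mult_mono) auto
    have "1 \<le> pi\<^sup>2" using pi_gt3 by (intro one_le_power) simp
    then have "1 \<le> 2 * pi\<^sup>2" by simp
    then have "real b * l / (2 * pi\<^sup>2) \<le> real b * l / 1" using l by (intro divide_left_mono) auto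
    then show "\<bar>real b * l / (2 * pi\<^sup>2) * (O' - pi\<^sup>2 / 8)\<bar> \<le> real b * l * (4 / real b)"
      unfolding abs_mult using l sum_odd_half_range[OF b] unfolding O'_def[symmetric] by (intro mult_mono) auto
  qed
  also have "\<dots> = 2 * (l * (1 + l)) + 4 * l" using b by simp
  also have "\<dots> \<le> 12 * real b" using l1 l2 by simp
  finally show ?thesis unfolding l_def C'_def .
qed

lemma sum_ln_div_squares_bounded:
  obtains Z :: real where "Z \<ge> 0" "\<And>b. (\<Sum>k\<in>half_range b. (1 + ln (real k)) / (real k)\<^sup>2) \<le> Z"
proof -
  obtain Z :: real where Z: "Z \<ge> 0" "\<And>n. (\<Sum>r=1..<n. sqrt (real r * sqrt (real r)) / (real r)\<^sup>2) \<le> Z"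
    using sum_powr_five_quarters_bounded by blast
  show ?thesis
  proof
    show "0 \<le> 2 * Z" using Z by simp
    fix b
    have "(\<Sum>k\<in>half_range b. (1 + ln (real k)) / (real k)\<^sup>2) \<le> (\<Sum>k\<in>half_range b. 2 * (sqrt (real k * sqrt (real k)) / (real k)\<^sup>2))"
    proof (rule sum_mono)
      fix k assume "k \<in> half_range b"
      then have k: "real k \<ge> 1" by (simp add: half_range_def)
      have "1 + ln (real k) \<le> 2 * sqrt (real k)" by (rule one_plus_ln_le_sqrt[OF k])
      also have "\<dots> \<le> 2 * sqrt (real k * sqrt (real k))"
        using k by (intro mult_left_mono real_sqrt_le_mono) (auto simp: mult_le_cancel_left1)
      finally have "(1 + ln (real k)) / (real k)\<^sup>2 \<le> 2 * sqrt (real k * sqrt (real k)) / (real k)\<^sup>2"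
        by (rule divide_right_mono) simp
      then show "(1 + ln (real k)) / (real k)\<^sup>2 \<le> 2 * (sqrt (real k * sqrt (real k)) / (real k)\<^sup>2)" by simp
    qed
    also have "\<dots> \<le> (\<Sum>k=1..<b. 2 * (sqrt (real k * sqrt (real k)) / (real k)\<^sup>2))"
      by (rule sum_mono2) (auto simp: half_range_def)
    also have "\<dots> \<le> 2 * Z" unfolding sum_distrib_left[symmetric] by (intro mult_left_mono Z) auto
    finally show "(\<Sum>k\<in>half_range b. (1 + ln (real k)) / (real k)\<^sup>2) \<le> 2 * Z" .
  qed
qed

definition swapped_sum :: "nat \<Rightarrow> real" where
  "swapped_sum b = (\<Sum>k\<in>half_range b. cotpi (real k / real b) / real k * cotsum k b)"

lemma dedekind_half_sum_approx:
  obtains C :: real where "C \<ge> 0"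
    "\<And>b. b \<ge> 1 \<Longrightarrow> \<bar>dedekind_half_sum b - (real b * ln (real b) / 16 - swapped_sum b / 2)\<bar> \<le> C * real b"
proof -
  obtain Z :: real where Z: "Z \<ge> 0" "\<And>b. (\<Sum>k\<in>half_range b. (1 + ln (real k)) / (real k)\<^sup>2) \<le> Z"
    using sum_ln_div_squares_bounded by blast
  show ?thesis
  proof
    show "0 \<le> 12 + 41 * Z" using Z by simp
    fix b :: nat assume b: "b \<ge> 1"
    define w where "w k = cotpi (real k / real b) / real k" for k
    define h where "h k = (if odd k then real b / pi * ln (real b) else 0)" for k :: nat
    define err where "err k = real k * cotsum b k + real b * cotsum k b - h k" for k
    define m where "m = ln (real b) / (2 * pi) * (\<Sum>k\<in>half_range b. if odd k then cotpi (real k / real b) / real k else 0)"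
    have err: "\<bar>err k\<bar> \<le> 41 * real b * (1 + ln (real k))" if "k \<in> half_range b" for k
      unfolding err_def h_def using that by (intro cotsum_approx_reciprocity) (auto simp: half_range_def)
    have w: "0 \<le> w k" "w k \<le> real b / (real k)\<^sup>2" if "k \<in> half_range b" for k
    proof -
      have x: "0 < real k / real b" "real k / real b \<le> 1/2" using half_range_frac[OF that] by auto
      show "0 \<le> w k" unfolding w_def using x by (intro divide_nonneg_nonneg cotpi_nonneg) auto
      have "cotpi (real k / real b) \<le> 1 / (pi * (real k / real b))" by (rule cotpi_approx(1)[OF x])
      also have "\<dots> \<le> 1 / (1 * (real k / real b))"
        using x pi_gt3 by (intro divide_left_mono mult_right_mono mult_pos_pos) auto
      finally have "cotpi (real k / real b) \<le> real b / real k" by simp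
      then have "w k \<le> real b / real k / real k" unfolding w_def by (rule divide_right_mono) simp
      then show "w k \<le> real b / (real k)\<^sup>2" by (simp add: power2_eq_square)
    qed
    have "(\<Sum>k\<in>half_range b. cotpi (real k / real b) * cotsum b k) = (\<Sum>k\<in>half_range b. w k * (h k + err k - real b * cotsum k b))"
    proof (rule sum.cong)
      fix k assume "k \<in> half_range b"
      then have "real k > 0" by (simp add: half_range_def)
      then show "cotpi (real k / real b) * cotsum b k = w k * (h k + err k - real b * cotsum k b)"
        by (simp add: w_def err_def)
    qed simp
    also have "\<dots> = (\<Sum>k\<in>half_range b. w k * h k) + (\<Sum>k\<in>half_range b. w k * err k) - real b * swapped_sum b"
    proof -
      have "real b * swapped_sum b = (\<Sum>k\<in>half_range b. w k * (real b * cotsum k b))"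
        by (simp add: swapped_sum_def w_def sum_distrib_left mult_ac)
      then show ?thesis by (simp only: distrib_left right_diff_distrib sum.distrib sum_subtractf)
    qed
    also have "(\<Sum>k\<in>half_range b. w k * h k) = 2 * real b * m"
    proof -
      have "(\<Sum>k\<in>half_range b. w k * h k) = (\<Sum>k\<in>half_range b. real b / pi * ln (real b) * (if odd k then w k else 0))"
        by (intro sum.cong) (auto simp: h_def)
      also have "\<dots> = 2 * real b * m" unfolding sum_distrib_left[symmetric] m_def w_def by simp
      finally show ?thesis .
    qed
    finally have "dedekind_half_sum b = (2 * real b * m + (\<Sum>k\<in>half_range b. w k * err k) - real b * swapped_sum b) / (2 * real b)"
      using b by (simp add: dedekind_half_sum_eq)
    then have eq: "dedekind_half_sum b = m + (\<Sum>k\<in>half_range b. w k * err k) / (2 * real b) - swapped_sum b / 2"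
      using b by (simp add: add_divide_distrib diff_divide_distrib)
    have "\<bar>\<Sum>k\<in>half_range b. w k * err k\<bar> \<le> (\<Sum>k\<in>half_range b. real b / (real k)\<^sup>2 * (41 * real b * (1 + ln (real k))))"
    proof (rule order_trans[OF sum_abs], rule sum_mono)
      fix k assume k: "k \<in> half_range b"
      have "\<bar>w k * err k\<bar> = w k * \<bar>err k\<bar>" using w(1)[OF k] by (simp add: abs_mult)
      also have "\<dots> \<le> real b / (real k)\<^sup>2 * (41 * real b * (1 + ln (real k)))"
        by (rule mult_mono[OF w(2)[OF k] err[OF k]]) auto
      finally show "\<bar>w k * err k\<bar> \<le> real b / (real k)\<^sup>2 * (41 * real b * (1 + ln (real k)))" .
    qed
    also have "\<dots> = 41 * (real b)\<^sup>2 * (\<Sum>k\<in>half_range b. (1 + ln (real k)) / (real k)\<^sup>2)"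
      by (simp add: sum_distrib_left power2_eq_square mult_ac)
    also have "\<dots> \<le> 41 * (real b)\<^sup>2 * Z" by (intro mult_left_mono Z) auto
    finally have "\<bar>\<Sum>k\<in>half_range b. w k * err k\<bar> / (2 * real b) \<le> 41 * (real b)\<^sup>2 * Z / (2 * real b)"
      by (rule divide_right_mono) simp
    also have "\<dots> \<le> 41 * Z * real b" using b Z(1) by (simp add: power2_eq_square)
    finally have e: "\<bar>(\<Sum>k\<in>half_range b. w k * err k) / (2 * real b)\<bar> \<le> 41 * Z * real b" by simp
    have m: "\<bar>m - real b * ln (real b) / 16\<bar> \<le> 12 * real b"
      unfolding m_def by (rule dedekind_half_sum_main_term[OF b])
    have "\<bar>A + B - S - (D - S)\<bar> \<le> x + y" if "\<bar>A - D\<bar> \<le> x" "\<bar>B\<bar> \<le> y" for A B S D x y :: real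
      using that by linarith
    from this[OF m e] show "\<bar>dedekind_half_sum b - (real b * ln (real b) / 16 - swapped_sum b / 2)\<bar> \<le> (12 + 41 * Z) * real b"
      unfolding eq by (simp add: distrib_right)
  qed
qed

lemma sum_swapped_sum_bound:
  obtains C :: real where "C \<ge> 0" "\<And>M. \<bar>\<Sum>b=1..M. swapped_sum b\<bar> \<le> C * (real M)\<^sup>2"
proof -
  obtain K :: real where K: "K \<ge> 0" "\<And>q. q > 0 \<Longrightarrow> (\<Sum>b<q. \<bar>cotsum q b\<bar>) \<le> K * (real q)\<^sup>2"
    using cotsum_first_moment by blast
  show ?thesis
  proof
    show "0 \<le> 2 * K" using K by simp
    fix M
    have "(\<Sum>b=1..M. swapped_sum b) = (\<Sum>b=1..M. \<Sum>k\<in>{k\<in>half_range M. 2 * k < b}. cotpi (real k / real b) / real k * cotsum k b)"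
      unfolding swapped_sum_def by (intro sum.cong) (auto simp: half_range_def)
    also have "\<dots> = (\<Sum>k\<in>half_range M. \<Sum>b\<in>{b\<in>{1..M}. 2 * k < b}. cotpi (real k / real b) / real k * cotsum k b)"
      by (rule sum.swap_restrict) auto
    also have "\<dots> = (\<Sum>k\<in>half_range M. (1 / real k) * (\<Sum>b=2 * k + 1..M. cotpi (real k / real b) * cotsum k b))"
    proof (rule sum.cong)
      fix k
      have "{b\<in>{1..M}. 2 * k < b} = {2 * k + 1..M}" by auto
      then show "(\<Sum>b\<in>{b\<in>{1..M}. 2 * k < b}. cotpi (real k / real b) / real k * cotsum k b) = (1 / real k) * (\<Sum>b=2 * k + 1..M. cotpi (real k / real b) * cotsum k b)"
        by (simp add: sum_distrib_left)
    qed simp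
    also have "\<bar>\<dots>\<bar> \<le> (\<Sum>k\<in>half_range M. 2 * K * real M)"
    proof (rule order_trans[OF sum_abs], rule sum_mono)
      fix k assume "k \<in> half_range M"
      then have k: "k > 0" "M > 2 * k" by (auto simp: half_range_def)
      have "\<bar>(1 / real k) * (\<Sum>b=2 * k + 1..M. cotpi (real k / real b) * cotsum k b)\<bar> = (1 / real k) * \<bar>\<Sum>b=2 * k + 1..M. cotpi (real k / real b) * cotsum k b\<bar>"
        by (simp add: abs_mult)
      also have "\<dots> \<le> (1 / real k) * (2 * (real M / real k) * (K * (real k)\<^sup>2))"
        using k K by (intro mult_left_mono abs_sum_weighted_cotsum_le) auto
      also have "\<dots> = 2 * K * real M" using k by (simp add: power2_eq_square)
      finally show "\<bar>(1 / real k) * (\<Sum>b=2 * k + 1..M. cotpi (real k / real b) * cotsum k b)\<bar> \<le> 2 * K * real M" .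
    qed
    also have "\<dots> = real ((M - 1) div 2) * (2 * K * real M)" by (simp add: half_range_eq)
    also have "\<dots> \<le> real M * (2 * K * real M)"
      using K(1) by (intro mult_right_mono) auto
    finally show "\<bar>\<Sum>b=1..M. swapped_sum b\<bar> \<le> 2 * K * (real M)\<^sup>2" by (simp add: power2_eq_square mult_ac)
  qed
qed

lemma sum_dedekind_half_sum_asymp:
  obtains C :: real where "C \<ge> 0"
    "\<And>M. M \<ge> 1 \<Longrightarrow> \<bar>(\<Sum>b=1..M. dedekind_half_sum b) - ln (real M) / 16 * (\<Sum>b=1..M. real b)\<bar> \<le> C * (real M)\<^sup>2"
proof -
  obtain C :: real where C: "C \<ge> 0" "\<And>b. b \<ge> 1 \<Longrightarrow> \<bar>dedekind_half_sum b - (real b * ln (real b) / 16 - swapped_sum b / 2)\<bar> \<le> C * real b"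
    using dedekind_half_sum_approx by blast
  obtain C' :: real where C': "C' \<ge> 0" "\<And>M. \<bar>\<Sum>b=1..M. swapped_sum b\<bar> \<le> C' * (real M)\<^sup>2"
    using sum_swapped_sum_bound by blast
  show ?thesis
  proof
    show "0 \<le> C + C' + 1" using C C' by simp
    fix M :: nat assume M: "M \<ge> 1"
    have s: "(\<Sum>b=1..M. x) = real M * x" for x :: real by simp
    have "\<bar>(\<Sum>b=1..M. dedekind_half_sum b - (real b * ln (real b) / 16 - swapped_sum b / 2))\<bar> \<le> (\<Sum>b=1..M. C * real M)"
      by (rule order_trans[OF sum_abs], rule sum_mono) (use C in \<open>auto intro!: order_trans[OF C(2)] mult_left_mono\<close>)
    then have 1: "\<bar>(\<Sum>b=1..M. dedekind_half_sum b) - (\<Sum>b=1..M. real b * ln (real b) / 16) + (\<Sum>b=1..M. swapped_sum b) / 2\<bar> \<le> C * (real M)\<^sup>2"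
      by (simp add: sum_subtractf sum_divide_distrib[symmetric] power2_eq_square mult.left_commute)
    have "\<bar>\<Sum>b=1..M. real b * ln (real b) / 16 - ln (real M) / 16 * real b\<bar> \<le> (\<Sum>b=1..M. real M)"
    proof (rule order_trans[OF sum_abs], rule sum_mono)
      fix b assume "b \<in> {1..M}"
      then have b: "1 \<le> b" "b \<le> M" by auto
      have l: "ln (real b) \<le> ln (real M)" using b by simp
      have "ln (real M / real b) \<le> real M / real b - 1" using b M by (intro ln_le_minus_one) auto
      then have "ln (real M) - ln (real b) \<le> real M / real b - 1" using b M by (simp add: ln_div)
      then have "real b * (ln (real M) - ln (real b)) \<le> real b * (real M / real b - 1)" by (rule mult_left_mono) simp
      also have "\<dots> \<le> real M" using b by (simp add: right_diff_distrib)
      finally have u: "real b * (ln (real M) - ln (real b)) \<le> real M" .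
      have "0 \<le> real b * (ln (real M) - ln (real b))" using l by simp
      moreover have "real b * ln (real b) / 16 - ln (real M) / 16 * real b = - (real b * (ln (real M) - ln (real b))) / 16"
        by (simp add: field_simps)
      ultimately show "\<bar>real b * ln (real b) / 16 - ln (real M) / 16 * real b\<bar> \<le> real M" using u by simp
    qed
    then have 2: "\<bar>(\<Sum>b=1..M. real b * ln (real b) / 16) - ln (real M) / 16 * (\<Sum>b=1..M. real b)\<bar> \<le> (real M)\<^sup>2"
      by (simp only: sum_subtractf sum_distrib_left[symmetric]) (simp add: power2_eq_square)
    have "\<bar>A - E\<bar> \<le> x + y + z" if "\<bar>A - D + S / 2\<bar> \<le> x" "\<bar>S\<bar> \<le> y" "\<bar>D - E\<bar> \<le> z" for A D E S x y z :: real
      using that by linarith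
    from this[OF 1 C'(2) 2] show "\<bar>(\<Sum>b=1..M. dedekind_half_sum b) - ln (real M) / 16 * (\<Sum>b=1..M. real b)\<bar> \<le> (C + C' + 1) * (real M)\<^sup>2"
      by (simp add: distrib_right)
  qed
qed

section \<open>Farey fractions\<close>

lemma sum_dirichlet_swap:
  fixes h :: "nat \<Rightarrow> real"
  shows "(\<Sum>n=1..Q. \<Sum>b | b dvd n. h b) = (\<Sum>d=1..Q. \<Sum>b=1..Q div d. h b)"
proof -
  have "(\<Sum>n=1..Q. \<Sum>b | b dvd n. h b) = (\<Sum>(n, b)\<in>(SIGMA n:{1..Q}. {b. b dvd n}). h b)"
    by (rule sum.Sigma) auto
  also have "\<dots> = (\<Sum>(d, b)\<in>(SIGMA d:{1..Q}. {1..Q div d}). h b)"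
  proof (rule sum.reindex_bij_witness[where i = "\<lambda>(d, b). (d * b, b)" and j = "\<lambda>(n, b). (n div b, b)"])
    fix p assume "p \<in> (SIGMA n:{1..Q}. {b. b dvd n})"
    then obtain n b where p: "p = (n, b)" "1 \<le> n" "n \<le> Q" "b dvd n" by auto
    then have b: "b > 0" using dvd_pos_nat by auto
    from p obtain d where d: "n = b * d" by blast
    have "d > 0" using p d by auto
    moreover have "b \<le> Q div d" using p d \<open>d > 0\<close> by (simp add: less_eq_div_iff_mult_less_eq)
    moreover have "d \<le> Q" using p d b by (metis dvd_imp_le dvd_triv_right le_trans less_le_trans zero_less_one)
    ultimately show "(case p of (n, b) \<Rightarrow> (n div b, b)) \<in> (SIGMA d:{1..Q}. {1..Q div d})"
      using p d b by auto
  next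
    fix p assume "p \<in> (SIGMA d:{1..Q}. {1..Q div d})"
    then obtain d b where p: "p = (d, b)" "1 \<le> d" "1 \<le> b" "b \<le> Q div d" by auto
    then have "d * b \<le> Q" by (simp add: less_eq_div_iff_mult_less_eq mult.commute)
    then show "(case p of (d, b) \<Rightarrow> (d * b, b)) \<in> (SIGMA n:{1..Q}. {b. b dvd n})"
      using p by auto
    show "(case (case p of (d, b) \<Rightarrow> (d * b, b)) of (n, b) \<Rightarrow> (n div b, b)) = p" using p by auto
  qed auto
  also have "\<dots> = (\<Sum>d=1..Q. \<Sum>b=1..Q div d. h b)" by (rule sum.Sigma[symmetric]) auto
  finally show ?thesis .
qed

lemma sum_inverse_squares_from_2_le: "(\<Sum>d=2..n. 1 / (real d)\<^sup>2) \<le> 3/4"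
proof (cases "n \<ge> 2")
  case True
  have "(\<Sum>d=2..n. 1 / (real d)\<^sup>2) = 1/4 + (\<Sum>d=3..n. 1 / (real d)\<^sup>2)"
    using True by (subst sum.atLeast_Suc_atMost) (auto simp: numeral_3_eq_3)
  also have "(\<Sum>d=3..n. 1 / (real d)\<^sup>2) = (\<Sum>a=1..n - 2. 1 / (real a + 2)\<^sup>2)"
    by (rule sum.reindex_bij_witness[where i = "\<lambda>a. a + 2" and j = "\<lambda>a. a - 2"]) auto
  also have "\<dots> \<le> 1 / 2" by (rule sum_inverse_squares_shift_le) simp
  finally show ?thesis by simp
qed simp

lemma real_div_squared_le: "(real (Q div d))\<^sup>2 \<le> (real Q)\<^sup>2 * (1 / (real d)\<^sup>2)"
proof -
  have "(real (Q div d))\<^sup>2 \<le> (real Q / real d)\<^sup>2"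
    by (intro power_mono of_nat_div_le_of_nat) simp
  then show ?thesis by (simp add: power_divide)
qed

text \<open>A substitute for Moebius inversion: it suffices that the sum of \<open>1/d\<^sup>2\<close> over \<open>d \<ge> 2\<close>
  is less than 1.\<close>

lemma quadratic_bound_from_divisor_sums:
  fixes G :: "nat \<Rightarrow> real"
  assumes C: "C \<ge> 0" and G: "\<And>Q. Q \<ge> 1 \<Longrightarrow> \<bar>\<Sum>d=1..Q. G (Q div d)\<bar> \<le> C * (real Q)\<^sup>2"
  shows "Q \<ge> 1 \<Longrightarrow> \<bar>G Q\<bar> \<le> 4 * C * (real Q)\<^sup>2"
proof (induction Q rule: less_induct)
  case (less Q)
  have "(\<Sum>d=1..Q. G (Q div d)) = G Q + (\<Sum>d=2..Q. G (Q div d))"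
    using less.prems by (subst sum.atLeast_Suc_atMost) (auto simp: numeral_2_eq_2)
  moreover have "\<bar>\<Sum>d=2..Q. G (Q div d)\<bar> \<le> (\<Sum>d=2..Q. 4 * C * ((real Q)\<^sup>2 * (1 / (real d)\<^sup>2)))"
  proof (rule order_trans[OF sum_abs], rule sum_mono)
    fix d assume d: "d \<in> {2..Q}"
    then have "Q div d < Q" "Q div d \<ge> 1" by (auto simp: div_greater_zero_iff Suc_le_eq)
    then have "\<bar>G (Q div d)\<bar> \<le> 4 * C * (real (Q div d))\<^sup>2" by (rule less.IH)
    also have "\<dots> \<le> 4 * C * ((real Q)\<^sup>2 * (1 / (real d)\<^sup>2))"
      using C by (intro mult_left_mono real_div_squared_le) auto
    finally show "\<bar>G (Q div d)\<bar> \<le> 4 * C * ((real Q)\<^sup>2 * (1 / (real d)\<^sup>2))" .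
  qed
  moreover have "(\<Sum>d=2..Q. 4 * C * ((real Q)\<^sup>2 * (1 / (real d)\<^sup>2))) \<le> 4 * C * ((real Q)\<^sup>2 * (3/4))"
    unfolding sum_distrib_left[symmetric] using C
    by (intro mult_left_mono sum_inverse_squares_from_2_le) auto
  moreover have "\<bar>g\<bar> \<le> 4 * c" if "\<bar>s\<bar> \<le> c" "s = g + t" "\<bar>t\<bar> \<le> u" "u \<le> 3 * c" for g s t u c :: real
    using that by linarith
  ultimately have "\<bar>G Q\<bar> \<le> 4 * (C * (real Q)\<^sup>2)" using G[OF less.prems] by fastforce
  then show ?case by simp
qed

definition coprime_half_sum :: "nat \<Rightarrow> real" where
  "coprime_half_sum b = (\<Sum>a\<in>{a\<in>half_range b. coprime a b}. dedekind_sum (int a) (int b))"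

lemma dedekind_half_sum_divisors:
  assumes n: "n > 0"
  shows "dedekind_half_sum n = (\<Sum>b | b dvd n. coprime_half_sum b)"
proof -
  have "n div gcd a n dvd n" for a by (metis dvd_div_mult_self dvd_triv_left gcd_dvd2)
  then have "dedekind_half_sum n = (\<Sum>b | b dvd n. \<Sum>a\<in>{a\<in>half_range n. n div gcd a n = b}. dedekind_sum (int a) (int n))"
    unfolding dedekind_half_sum_def using n by (intro sum.group[symmetric]) auto
  also have "\<dots> = (\<Sum>b | b dvd n. coprime_half_sum b)"
  proof (rule sum.cong)
    fix b assume "b \<in> {b. b dvd n}"
    then obtain g where g: "n = b * g" by blast
    have g0: "g > 0" and b0: "b > 0" using n g by auto
    show "(\<Sum>a\<in>{a\<in>half_range n. n div gcd a n = b}. dedekind_sum (int a) (int n)) = coprime_half_sum b"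
      unfolding coprime_half_sum_def
    proof (rule sum.reindex_bij_witness[where i = "\<lambda>a. g * a" and j = "\<lambda>a. a div g"])
      fix a assume a: "a \<in> {a\<in>half_range n. n div gcd a n = b}"
      then have "n = b * gcd a n" by (metis (mono_tags, lifting) dvd_div_mult_self gcd_dvd2 mem_Collect_eq)
      then have gg: "gcd a n = g" using g b0 by simp
      then have dvd: "g dvd a" by auto
      then show "g * (a div g) = a" by simp
      then have "gcd (g * (a div g)) (g * b) = g" using gg g by (simp add: mult.commute)
      then have "coprime (a div g) b" using g0 by (simp add: gcd_mult_distrib_nat[symmetric] coprime_iff_gcd_eq_1)
      moreover have "a div g \<in> half_range b"
      proof -
        have "0 < g * (a div g)" "2 * (g * (a div g)) < g * b"
          using a \<open>g * (a div g) = a\<close> g by (simp_all add: half_range_def mult.commute)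
        moreover have "2 * (g * (a div g)) = g * (2 * (a div g))" by simp
        ultimately show ?thesis using g0 by (simp add: half_range_def)
      qed
      ultimately show "a div g \<in> {a\<in>half_range b. coprime a b}" by simp
      have "dedekind_sum (int g * int (a div g)) (int g * int b) = dedekind_sum (int (a div g)) (int b)"
        using g0 b0 by (intro dedekind_sum_mult) auto
      moreover have "int g * int (a div g) = int a" using \<open>g * (a div g) = a\<close> by (metis of_nat_mult)
      moreover have "int g * int b = int n" by (simp add: g)
      ultimately show "dedekind_sum (int (a div g)) (int b) = dedekind_sum (int a) (int n)" by simp
    next
      fix a assume a: "a \<in> {a\<in>half_range b. coprime a b}"
      have "gcd (g * a) n = g"
        using a unfolding g mult.commute[of b g] gcd_mult_distrib_nat[symmetric] by (simp add: coprime_iff_gcd_eq_1)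
      moreover have "2 * (g * a) < b * g" using a g0 by (simp add: half_range_def mult.left_commute[of 2] mult.commute[of b])
      ultimately show "g * a \<in> {a\<in>half_range n. n div gcd a n = b}"
        using a g0 by (simp add: half_range_def g)
      show "g * a div g = a" using g0 by simp
    qed
  qed simp
  finally show ?thesis .
qed

definition farey_pairs :: "nat \<Rightarrow> (nat \<times> nat) set" where
  "farey_pairs Q = (SIGMA b:{1..Q}. {a. a \<le> b \<and> coprime a b})"

definition frac_of_pair :: "nat \<times> nat \<Rightarrow> rat" where
  "frac_of_pair p = of_nat (snd p) / of_nat (fst p)"

lemma inj_frac_of_pair: "inj_on frac_of_pair (farey_pairs Q)"
proof (rule inj_onI)
  fix p p' assume p: "p \<in> farey_pairs Q" "p' \<in> farey_pairs Q" "frac_of_pair p = frac_of_pair p'"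
  obtain b a where ba: "p = (b, a)" "b > 0" "coprime a b" using p by (auto simp: farey_pairs_def)
  obtain b' a' where ba': "p' = (b', a')" "b' > 0" "coprime a' b'" using p by (auto simp: farey_pairs_def)
  have "(of_nat (a * b') :: rat) = of_nat (a' * b)"
    using p(3) ba ba' by (simp add: frac_of_pair_def field_simps)
  then have "a * b' = a' * b" by (simp only: of_nat_eq_iff)
  then have "a = a' \<and> b' = b" using ba ba' coprime_crossproduct_nat[of a b a' b'] by (auto simp: mult.commute)
  then show "p = p'" using ba ba' by simp
qed

lemma farey_eq_image: "farey Q = frac_of_pair ` farey_pairs Q"
proof (intro equalityI subsetI)
  fix x assume "x \<in> farey Q"
  then obtain a b where ab: "x = of_int a / of_int b" "gcd a b = 1" "0 \<le> a" "a \<le> b" "b \<le> int Q"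
    unfolding farey_def by auto
  have "b \<noteq> 0" using ab by auto
  then have b: "b > 0" using ab by simp
  obtain a' b' where ab': "a = int a'" "b = int b'" using ab b by (metis less_imp_le nonneg_int_cases)
  have "gcd a' b' = 1" using ab(2) unfolding ab' by simp
  then have "(b', a') \<in> farey_pairs Q" using ab b unfolding ab' by (auto simp: farey_pairs_def coprime_iff_gcd_eq_1)
  moreover have "x = frac_of_pair (b', a')" using ab ab' by (simp add: frac_of_pair_def)
  ultimately show "x \<in> frac_of_pair ` farey_pairs Q" by blast
next
  fix x assume "x \<in> frac_of_pair ` farey_pairs Q"
  then obtain b a where "x = of_nat a / of_nat b" "1 \<le> b" "b \<le> Q" "a \<le> b" "coprime a b"
    by (auto simp: farey_pairs_def frac_of_pair_def)
  then show "x \<in> farey Q" unfolding farey_def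
    by (intro CollectI exI[of _ "int a"] exI[of _ "int b"]) (auto simp: gcd_int_int_eq coprime_iff_gcd_eq_1)
qed

lemma card_farey:
  assumes Q: "Q \<ge> 1"
  shows "card (farey Q) = 1 + (\<Sum>b=1..Q. totient b)"
proof -
  have "{a. a \<le> b \<and> coprime a b} = totatives b \<union> (if b = 1 then {0} else {})" if "b \<ge> 1" for b :: nat
    using that by (auto simp: totatives_def intro!: Nat.gr0I)
  then have "card {a. a \<le> b \<and> coprime a b} = totient b + (if b = 1 then 1 else 0)" if "b \<ge> 1" for b :: nat
    using that by (auto simp: totient_def totatives_def)
  then have "card (farey_pairs Q) = (\<Sum>b=1..Q. totient b + (if b = 1 then 1 else 0))"
    unfolding farey_pairs_def by (subst card_SigmaI) auto
  also have "\<dots> = (\<Sum>b=1..Q. totient b) + 1" using Q by (simp add: sum.distrib)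
  finally show ?thesis unfolding farey_eq_image by (simp add: card_image[OF inj_frac_of_pair])
qed

lemma sum_dedekind_farey0: "(\<Sum>x\<in>farey0 Q. dedekind x) = (\<Sum>b=1..Q. coprime_half_sum b)"
proof -
  let ?P = "{p \<in> farey_pairs Q. 2 * snd p < fst p}"
  have "farey0 Q = frac_of_pair ` ?P"
  proof -
    have "frac_of_pair p \<in> {0..<1/2} \<longleftrightarrow> 2 * snd p < fst p" if "p \<in> farey_pairs Q" for p
    proof -
      have "fst p > 0" using that by (auto simp: farey_pairs_def)
      then have "frac_of_pair p < 1/2 \<longleftrightarrow> of_nat (2 * snd p) < (of_nat (fst p) :: rat)"
        by (simp add: frac_of_pair_def field_simps)
      also have "\<dots> \<longleftrightarrow> 2 * snd p < fst p" by (rule of_nat_less_iff)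
      finally show ?thesis by (simp add: frac_of_pair_def)
    qed
    then show ?thesis unfolding farey0_def farey_eq_image by blast
  qed
  then have "(\<Sum>x\<in>farey0 Q. dedekind x) = (\<Sum>p\<in>?P. dedekind (frac_of_pair p))"
    using inj_on_subset[OF inj_frac_of_pair[of Q], of ?P] by (simp add: sum.reindex)
  also have "\<dots> = (\<Sum>p\<in>?P. dedekind_sum (int (snd p)) (int (fst p)))"
  proof (rule sum.cong)
    fix p assume "p \<in> ?P"
    then have "int (fst p) \<noteq> 0" by (auto simp: farey_pairs_def)
    then show "dedekind (frac_of_pair p) = dedekind_sum (int (snd p)) (int (fst p))"
      using dedekind_of_int_div[of "int (fst p)" "int (snd p)"] by (simp add: frac_of_pair_def)
  qed simp
  also have "?P = (SIGMA b:{1..Q}. {a. 2 * a < b \<and> coprime a b})" by (auto simp: farey_pairs_def)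
  also have "(\<Sum>p\<in>\<dots>. dedekind_sum (int (snd p)) (int (fst p))) = (\<Sum>b=1..Q. \<Sum>a | 2 * a < b \<and> coprime a b. dedekind_sum (int a) (int b))"
  proof -
    have "finite {a. 2 * a < b \<and> coprime a b}" for b :: nat by (rule finite_subset[of _ "{..<b}"]) auto
    then show ?thesis by (subst sum.Sigma) (auto simp: case_prod_unfold)
  qed
  also have "\<dots> = (\<Sum>b=1..Q. coprime_half_sum b)"
  proof (rule sum.cong)
    fix b
    show "(\<Sum>a | 2 * a < b \<and> coprime a b. dedekind_sum (int a) (int b)) = coprime_half_sum b"
      unfolding coprime_half_sum_def
    proof (rule sum.mono_neutral_right)
      show "finite {a. 2 * a < b \<and> coprime a b}" by (rule finite_subset[of _ "{..<b}"]) auto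
      have "dedekind_sum 0 (int b) = 0" by (simp add: dedekind_sum_def)
      then show "\<forall>a\<in>{a. 2 * a < b \<and> coprime a b} - {a \<in> half_range b. coprime a b}. dedekind_sum (int a) (int b) = 0"
        by (auto simp: half_range_def intro!: Nat.gr0I)
    qed (auto simp: half_range_def)
  qed simp
  finally show ?thesis .
qed

definition totient_sum :: "nat \<Rightarrow> real" where
  "totient_sum Q = (\<Sum>b=1..Q. real (totient b))"

lemma totient_sum_nonneg: "totient_sum m \<ge> 0"
  by (simp add: totient_sum_def sum_nonneg)

lemma totient_sum_le: "m \<ge> 1 \<Longrightarrow> totient_sum m \<le> (real m)\<^sup>2 / 2 + 1/2"
proof (induction m rule: dec_induct)
  case (step m)
  have "totient (Suc m) < Suc m" using step by (intro totient_less) auto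
  then have "real (totient (Suc m)) \<le> real m" by simp
  then have "totient_sum (Suc m) \<le> (real m)\<^sup>2 / 2 + 1/2 + real m"
    using step by (simp add: totient_sum_def)
  also have "\<dots> \<le> (real (Suc m))\<^sup>2 / 2 + 1/2" by (simp add: power2_eq_square field_simps)
  finally show ?case .
qed (simp add: totient_sum_def)

lemma sum_totient_sum: "(\<Sum>d=1..Q. totient_sum (Q div d)) = (\<Sum>n=1..Q. real n)"
proof -
  have "(\<Sum>b | b dvd n. real (totient b)) = real n" for n
    using totient_divisor_sum[of n] by (metis of_nat_sum)
  then show ?thesis
    using sum_dirichlet_swap[of "\<lambda>b. real (totient b)" Q] by (simp add: totient_sum_def)
qed

lemma totient_sum_ge:
  assumes Q: "Q \<ge> 1"
  shows "(real Q)\<^sup>2 / 8 \<le> totient_sum Q"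
proof -
  have gauss: "(\<Sum>n=1..Q. real n) = ((real Q)\<^sup>2 + real Q) / 2"
    by (induction Q) (auto simp: power2_eq_square field_simps)
  have "(\<Sum>d=1..Q. totient_sum (Q div d)) = totient_sum Q + (\<Sum>d=2..Q. totient_sum (Q div d))"
    using Q by (subst sum.atLeast_Suc_atMost) (auto simp: numeral_2_eq_2)
  moreover have "(\<Sum>d=2..Q. totient_sum (Q div d)) \<le> (\<Sum>d=2..Q. (real Q)\<^sup>2 / 2 * (1 / (real d)\<^sup>2) + 1/2)"
  proof (rule sum_mono)
    fix d assume "d \<in> {2..Q}"
    then have "Q div d \<ge> 1" by (auto simp: div_greater_zero_iff Suc_le_eq)
    from totient_sum_le[OF this] real_div_squared_le[of Q d]
    show "totient_sum (Q div d) \<le> (real Q)\<^sup>2 / 2 * (1 / (real d)\<^sup>2) + 1/2" by simp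
  qed
  moreover have "\<dots> = (real Q)\<^sup>2 / 2 * (\<Sum>d=2..Q. 1 / (real d)\<^sup>2) + real (Q - 1) / 2"
    unfolding sum.distrib sum_distrib_left[symmetric] by simp
  moreover have "(real Q)\<^sup>2 / 2 * (\<Sum>d=2..Q. 1 / (real d)\<^sup>2) \<le> (real Q)\<^sup>2 / 2 * (3/4)"
    by (intro mult_left_mono sum_inverse_squares_from_2_le) auto
  moreover have "real (Q - 1) \<le> real Q" by simp
  moreover have "x / 8 \<le> t" if "s = t + u" "u \<le> v" "v = w + z / 2" "w \<le> x / 2 * (3/4)" "z \<le> y" "s = (x + y) / 2"
    for s t u v w x y z :: real using that by simp
  ultimately show ?thesis using sum_totient_sum[of Q] gauss by metis
qed

lemma ln_div_defect_le:
  assumes d: "d \<in> {1..Q}"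
  shows "0 \<le> ln (real Q) - ln (real (Q div d))" "ln (real Q) - ln (real (Q div d)) \<le> 3 * sqrt (real d)"
proof -
  define m where "m = Q div d"
  have m: "m \<ge> 1" using d by (auto simp: m_def div_greater_zero_iff Suc_le_eq)
  have "m \<le> Q" by (simp add: m_def)
  then show "0 \<le> ln (real Q) - ln (real (Q div d))" using m by (simp add: m_def[symmetric])
  have "Q < d * (m + 1)"
    using d dividend_less_times_div[of d Q] by (simp add: m_def)
  also have "\<dots> \<le> d * (2 * m)" using m by (intro mult_left_mono) auto
  finally have "real Q \<le> real (2 * d * m)" by (intro of_nat_mono) simp
  then have "ln (real Q) \<le> ln (real (2 * d) * real m)" using d by (subst ln_le_cancel_iff) auto
  also have "\<dots> = ln (real (2 * d)) + ln (real m)" using d m by (subst ln_mult) auto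
  finally have "ln (real Q) - ln (real m) \<le> ln (real (2 * d))" by simp
  also have "\<dots> = ln 2 + ln (real d)" using d by (simp add: ln_mult)
  also have "\<dots> \<le> 1 + ln (real d)" using ln_2_less_1 by simp
  also have "\<dots> \<le> 2 * sqrt (real d)" using d by (intro one_plus_ln_le_sqrt) auto
  also have "\<dots> \<le> 3 * sqrt (real d)" by simp
  finally show "ln (real Q) - ln (real (Q div d)) \<le> 3 * sqrt (real d)" by (simp add: m_def)
qed

lemma farey0_sum_asymp:
  obtains C :: real where "C \<ge> 0"
    "\<And>Q. Q \<ge> 1 \<Longrightarrow> \<bar>(\<Sum>b=1..Q. coprime_half_sum b) - ln (real Q) / 16 * totient_sum Q\<bar> \<le> C * (real Q)\<^sup>2"
proof -
  obtain C :: real where C: "C \<ge> 0" "\<And>M. M \<ge> 1 \<Longrightarrow> \<bar>(\<Sum>b=1..M. dedekind_half_sum b) - ln (real M) / 16 * (\<Sum>b=1..M. real b)\<bar> \<le> C * (real M)\<^sup>2"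
    using sum_dedekind_half_sum_asymp by blast
  obtain Z :: real where Z: "Z \<ge> 0" "\<And>n. (\<Sum>r=1..<n. sqrt (real r * sqrt (real r)) / (real r)\<^sup>2) \<le> Z"
    using sum_powr_five_quarters_bounded by blast
  define G where "G Q = (\<Sum>b=1..Q. coprime_half_sum b) - ln (real Q) / 16 * totient_sum Q" for Q
  have "\<bar>\<Sum>d=1..Q. G (Q div d)\<bar> \<le> (C + 3 * Z) * (real Q)\<^sup>2" if Q: "Q \<ge> 1" for Q
  proof -
    define e where "e d = (ln (real Q) - ln (real (Q div d))) * totient_sum (Q div d)" for d
    have "(\<Sum>d=1..Q. \<Sum>b=1..Q div d. coprime_half_sum b) = (\<Sum>n=1..Q. dedekind_half_sum n)"
      unfolding sum_dirichlet_swap[symmetric] by (intro sum.cong) (auto simp: dedekind_half_sum_divisors)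
    moreover have "(\<Sum>d=1..Q. ln (real (Q div d)) / 16 * totient_sum (Q div d)) = ln (real Q) / 16 * (\<Sum>n=1..Q. real n) - (\<Sum>d=1..Q. e d) / 16"
      unfolding sum_totient_sum[symmetric] e_def sum_distrib_left sum_divide_distrib sum_subtractf[symmetric]
      by (intro sum.cong refl) (simp add: field_simps)
    ultimately have G: "(\<Sum>d=1..Q. G (Q div d)) = (\<Sum>n=1..Q. dedekind_half_sum n) - (ln (real Q) / 16 * (\<Sum>n=1..Q. real n) - (\<Sum>d=1..Q. e d) / 16)"
      unfolding G_def sum_subtractf by simp
    have "\<bar>\<Sum>d=1..Q. e d\<bar> \<le> (\<Sum>d=1..Q. 3 * (real Q)\<^sup>2 * (sqrt (real d * sqrt (real d)) / (real d)\<^sup>2))"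
    proof (rule order_trans[OF sum_abs], rule sum_mono)
      fix d assume d: "d \<in> {1..Q}"
      then have m: "Q div d \<ge> 1" by (auto simp: div_greater_zero_iff Suc_le_eq)
      have d1: "real d \<ge> 1" using d by simp
      have "1 \<le> (real (Q div d))\<^sup>2" using m by (intro one_le_power) simp
      then have t: "totient_sum (Q div d) \<le> (real (Q div d))\<^sup>2" using totient_sum_le[OF m] by simp
      have "\<bar>e d\<bar> = e d" unfolding e_def using ln_div_defect_le[OF d] totient_sum_nonneg by simp
      also have "\<dots> \<le> 3 * sqrt (real d) * ((real Q)\<^sup>2 * (1 / (real d)\<^sup>2))"
        unfolding e_def using ln_div_defect_le[OF d] order_trans[OF t real_div_squared_le] totient_sum_nonneg
        by (intro mult_mono) auto
      also have "\<dots> \<le> 3 * sqrt (real d * sqrt (real d)) * ((real Q)\<^sup>2 * (1 / (real d)\<^sup>2))"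
        using d1 by (intro mult_left_mono mult_right_mono real_sqrt_le_mono) (auto simp: mult_le_cancel_left1)
      finally show "\<bar>e d\<bar> \<le> 3 * (real Q)\<^sup>2 * (sqrt (real d * sqrt (real d)) / (real d)\<^sup>2)" by (simp add: mult_ac)
    qed
    also have "\<dots> = 3 * (real Q)\<^sup>2 * (\<Sum>r=1..<Suc Q. sqrt (real r * sqrt (real r)) / (real r)\<^sup>2)"
      unfolding sum_distrib_left[symmetric] by (simp only: atLeastLessThanSuc_atLeastAtMost)
    also have "\<dots> \<le> 3 * (real Q)\<^sup>2 * Z" by (intro mult_left_mono Z) auto
    finally have e: "\<bar>\<Sum>d=1..Q. e d\<bar> \<le> 3 * (real Q)\<^sup>2 * Z" .
    have "\<bar>A - (B - E / 16)\<bar> \<le> x + y" if "\<bar>A - B\<bar> \<le> x" "\<bar>E\<bar> \<le> y" for A B E x y :: real using that by linarith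
    from this[OF C(2)[OF Q] e] show ?thesis unfolding G by (simp add: algebra_simps)
  qed
  from quadratic_bound_from_divisor_sums[OF _ this] C Z
  have "\<bar>G Q\<bar> \<le> 4 * (C + 3 * Z) * (real Q)\<^sup>2" if "Q \<ge> 1" for Q using that by simp
  then show ?thesis using C Z by (intro that[of "4 * (C + 3 * Z)"]) (auto simp: G_def)
qed

theorem theorem2p1:
  shows "(\<lambda>Q::nat. (\<Sum>x\<in>farey0 Q. dedekind x) / real (card (farey Q)) - 1 / 16 * ln (real Q))
           \<in> O[at_top](\<lambda>_. 1 :: real)
         \<and> filterlim (\<lambda>Q::nat. (\<Sum>x\<in>farey0 Q. dedekind x) / real (card (farey Q))) at_top at_top"
proof -
  define r where "r Q = (\<Sum>x\<in>farey0 Q. dedekind x) / real (card (farey Q))" for Q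
  obtain C :: real where C: "C \<ge> 0" "\<And>Q. Q \<ge> 1 \<Longrightarrow> \<bar>(\<Sum>b=1..Q. coprime_half_sum b) - ln (real Q) / 16 * totient_sum Q\<bar> \<le> C * (real Q)\<^sup>2"
    using farey0_sum_asymp by blast
  have bound: "\<bar>r Q - 1 / 16 * ln (real Q)\<bar> \<le> 8 * (C + 1)" if Q: "Q \<ge> 1" for Q
  proof -
    define F where "F = 1 + totient_sum Q"
    define N where "N = (\<Sum>b=1..Q. coprime_half_sum b)"
    have F: "real (card (farey Q)) = F" using card_farey[OF Q] by (simp add: F_def totient_sum_def)
    have F1: "(real Q)\<^sup>2 / 8 \<le> F" using totient_sum_ge[OF Q] by (simp add: F_def)
    have Q1: "real Q \<ge> 1" using Q by simp
    have QQ: "real Q \<le> (real Q)\<^sup>2" using Q1 by (simp add: power2_eq_square)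
    have F0: "F > 0" using totient_sum_nonneg[of Q] by (simp add: F_def)
    have l: "0 \<le> ln (real Q)" "ln (real Q) \<le> real Q" using Q1 ln_le_minus_one[of "real Q"] by auto
    have "r Q - 1 / 16 * ln (real Q) = (N - ln (real Q) / 16 * totient_sum Q - ln (real Q) / 16) / F"
      unfolding r_def sum_dedekind_farey0 F N_def[symmetric] using F0 by (simp add: F_def field_simps)
    then have "\<bar>r Q - 1 / 16 * ln (real Q)\<bar> = \<bar>N - ln (real Q) / 16 * totient_sum Q - ln (real Q) / 16\<bar> / F"
      using F0 by simp
    also have "\<dots> \<le> ((C + 1) * (real Q)\<^sup>2) / ((real Q)\<^sup>2 / 8)"
    proof (rule frac_le)
      have "\<bar>a - l / 16\<bar> \<le> c + q" if "\<bar>a\<bar> \<le> c" "0 \<le> l" "l \<le> x" "x \<le> q" for a l c x q :: real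
        using that by linarith
      from this[OF C(2)[OF Q] l QQ] show "\<bar>N - ln (real Q) / 16 * totient_sum Q - ln (real Q) / 16\<bar> \<le> (C + 1) * (real Q)\<^sup>2"
        by (simp add: N_def distrib_right)
    qed (use F1 Q1 C in auto)
    also have "\<dots> = 8 * (C + 1)" using Q1 by simp
    finally show ?thesis .
  qed
  have 1: "(\<lambda>Q. r Q - 1 / 16 * ln (real Q)) \<in> O(\<lambda>_. 1)"
    using bound by (intro bigoI[of _ "8 * (C + 1)"] eventually_sequentiallyI[of 1]) simp
  have "filterlim (\<lambda>Q::nat. - (8 * (C + 1)) + 1 / 16 * ln (real Q)) at_top at_top"
    by (intro filterlim_tendsto_add_at_top[OF tendsto_const] filterlim_tendsto_pos_mult_at_top[OF tendsto_const]
          filterlim_compose[OF ln_at_top filterlim_real_sequentially]) simp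
  then have 2: "filterlim r at_top at_top"
  proof (rule filterlim_at_top_mono)
    have "- (8 * (C + 1)) + 1 / 16 * ln (real Q) \<le> r Q" if "Q \<ge> 1" for Q using bound[OF that] by linarith
    then show "eventually (\<lambda>Q. - (8 * (C + 1)) + 1 / 16 * ln (real Q) \<le> r Q) at_top"
      by (rule eventually_sequentiallyI)
  qed
  show ?thesis using 1 2 by (simp add: r_def[abs_def])
qed

end
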